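(* Let $(M_1,\tilde g_1)$ and $(M_2,\tilde g_2)$ be pseudo-Riemannian manifolds with cometrics $g_1,g_2$, let $\Pi_i$ be a bivector field on $M_i$ ($i=1,2$), let $f$ be a positive smooth function on $M_1$ and $\mu$ a smooth function on $M_1$. Let $\mathcal D$ be the Levi-Civita contravariant connection on $M_1\times M_2$ associated with the pair $(g^f,\Pi^\mu)$, and let $\mathcal D^1,\mathcal D^2$ be the Levi-Civita contravariant connections associated with $(g_1,\Pi_1)$ and $(g_2,\Pi_2)$. Then for any $\alpha_i,\beta_i\in\Gamma(T^*M_i)$, $i=1,2$: 1. $\mathcal D_{\alpha_1^h}\beta_1^h=(\mathcal D^1_{\alpha_1}\beta_1)^h$; 2. $\mathcal D_{\alpha_2^v}\beta_2^v=\mu^h(\mathcal D^2_{\alpha_2}\beta_2)^v+\frac12\Pi_2(\alpha_2,\beta_2)^v(d\mu)^h+\frac12 g_2(\alpha_2,\beta_2)^v(J_1df)^h$; 3. $\mathcal D_{\alpha_1^h}\beta_2^v=-\frac{1}{2f^h}\left[g_1(J_1df,\alpha_1)^h\,\beta_2^v+g_1(d\mu,\alpha_1)^h\,(J_2\beta_2)^v\right]$; 4. $\mathcal D_{\beta_2^v}\alpha_1^h=\mathcal D_{\alpha_1^h}\beta_2^v$.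
   Context: For a bivector field $\Pi$ on $M$, the anchor map $\sharp_\Pi:T^*M\to TM$ is given by $\beta(\sharp_\Pi(\alpha))=\Pi(\alpha,\beta)$, and the Koszul bracket of 1-forms is $[\alpha,\beta]_\Pi=\mathcal L_{\sharp_\Pi(\alpha)}\beta-\mathcal L_{\sharp_\Pi(\beta)}\alpha-d(\Pi(\alpha,\beta))$. A contravariant connection with respect to $\Pi$ is an $\mathbb R$-bilinear map $\mathcal D:\Gamma(T^*M)\times\Gamma(T^*M)\to\Gamma(T^*M)$ with $\mathcal D_{\varphi\alpha}\beta=\varphi\mathcal D_\alpha\beta$ and $\mathcal D_\alpha(\varphi\beta)=\varphi\mathcal D_\alpha\beta+\sharp_\Pi(\alpha)(\varphi)\beta$. The cometric of a pseudo-Riemannian metric $\tilde g$ is the induced metric $g$ on $T^*M$. The Levi-Civita contravariant connection of $(g,\Pi)$ is the unique contravariant connection with respect to $\Pi$ satisfying $\sharp_\Pi(\alpha).g(\beta,\gamma)=g(\mathcal D_\alpha\beta,\gamma)+g(\beta,\mathcal D_\alpha\gamma)$ and $\mathcal D_\alpha\beta-\mathcal D_\beta\alpha=[\alpha,\beta]_\Pi$. The endomorphism field $J_i$ of $T^*M_i$ is defined by $g_i(J_i\alpha,\beta)=\Pi_i(\alpha,\beta)$. With $\sigma_i:M_1\times M_2\to M_i$ the projections, lifts of functions and forms are $\omega_1^h=\sigma_1^*\omega_1$, $\omega_2^v=\sigma_2^*\omega_2$. The warped bivector field $\Pi^\mu$ on $M_1\times M_2$ is determined by $\Pi^\mu(\alpha_1^h,\beta_1^h)=\Pi_1(\alpha_1,\beta_1)^h$,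 $\Pi^\mu(\alpha_2^v,\beta_2^v)=\mu^h\Pi_2(\alpha_2,\beta_2)^v$, $\Pi^\mu(\alpha_1^h,\beta_2^v)=0$. The contravariant warped metric $g^f$ on $M_1\times M_2$ is determined by $g^f(\alpha_1^h,\beta_1^h)=g_1(\alpha_1,\beta_1)^h$, $g^f(\alpha_2^v,\beta_2^v)=f^hg_2(\alpha_2,\beta_2)^v$, $g^f(\alpha_1^h,\alpha_2^v)=0$. *)

theory Defs
  imports "HOL-Analysis.Analysis"
begin

subsection \<open>Smooth manifolds\<close>

fun higher_differentiable_on ::
  "nat \<Rightarrow> 'e::real_normed_vector set \<Rightarrow> ('e \<Rightarrow> 'c::real_normed_vector) \<Rightarrow> bool" where
  "higher_differentiable_on 0 S f \<longleftrightarrow> continuous_on S f"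
| "higher_differentiable_on (Suc k) S f \<longleftrightarrow>
     (\<forall>x\<in>S. f differentiable (at x)) \<and>
     (\<forall>e. higher_differentiable_on k S (\<lambda>x. frechet_derivative f (at x) e))"

text \<open>Only used for open \<open>S\<close>.\<close>

definition smooth_on ::
  "'e::real_normed_vector set \<Rightarrow> ('e \<Rightarrow> 'c::real_normed_vector) \<Rightarrow> bool" where
  "smooth_on S f \<longleftrightarrow> (\<forall>k. higher_differentiable_on k S f)"

text \<open>The underlying space of a manifold is a whole type; a chart is a pair of its domain
  and its coordinate map, whose values outside the domain are irrelevant.\<close>

type_synonym ('a, 'e) atlas = "('a set \<times> ('a \<Rightarrow> 'e)) set"

definition smooth_atlas ::
  "('a::{t2_space, second_countable_topology}, 'e::euclidean_space) atlas \<Rightarrow> bool" where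
  "smooth_atlas A \<longleftrightarrow>
     (\<Union>(U, \<phi>)\<in>A. U) = UNIV \<and>
     (\<forall>(U, \<phi>)\<in>A. open U \<and> open (\<phi> ` U) \<and> homeomorphism U (\<phi> ` U) \<phi> (inv_into U \<phi>)) \<and>
     (\<forall>(U, \<phi>)\<in>A. \<forall>(V, \<psi>)\<in>A. smooth_on (\<phi> ` (U \<inter> V)) (\<psi> \<circ> inv_into U \<phi>))"

definition smooth_functions :: "('a, 'e::euclidean_space) atlas \<Rightarrow> ('a \<Rightarrow> real) set" where
  "smooth_functions A = {f. \<forall>(U, \<phi>)\<in>A. smooth_on (\<phi> ` U) (f \<circ> inv_into U \<phi>)}"

definition prod_atlas ::
  "('a, 'e) atlas \<Rightarrow> ('b, 'd) atlas \<Rightarrow> ('a \<times> 'b, 'e \<times> 'd) atlas" where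
  "prod_atlas A B = {(U \<times> V, map_prod \<phi> \<psi>) | U \<phi> V \<psi>. (U, \<phi>) \<in> A \<and> (V, \<psi>) \<in> B}"

subsection \<open>Tangent vectors, covectors, vector fields and 1-forms\<close>

text \<open>Tangent vectors are derivations of the algebra of smooth functions, extended by 0 to
  non-smooth functions; covectors are extended by 0 to functionals that are not tangent
  vectors. Thus vectors, covectors and forms are equal iff they are equal as HOL functions.\<close>

type_synonym 'a tangent = "('a \<Rightarrow> real) \<Rightarrow> real"
type_synonym 'a cotangent = "'a tangent \<Rightarrow> real"
type_synonym 'a vfield = "'a \<Rightarrow> 'a tangent"
type_synonym 'a form = "'a \<Rightarrow> 'a cotangent"

definition linear_functional :: "('x \<Rightarrow> real) set \<Rightarrow> (('x \<Rightarrow> real) \<Rightarrow> real) \<Rightarrow> bool" where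
  "linear_functional V L \<longleftrightarrow>
     (\<forall>u\<in>V. \<forall>v\<in>V. L (\<lambda>x. u x + v x) = L u + L v) \<and>
     (\<forall>c. \<forall>u\<in>V. L (\<lambda>x. c * u x) = c * L u)"

definition bilinear_form ::
  "('x \<Rightarrow> real) set \<Rightarrow> (('x \<Rightarrow> real) \<Rightarrow> ('x \<Rightarrow> real) \<Rightarrow> real) \<Rightarrow> bool" where
  "bilinear_form V B \<longleftrightarrow>
     (\<forall>u\<in>V. linear_functional V (B u)) \<and> (\<forall>v\<in>V. linear_functional V (\<lambda>u. B u v))"

definition tangent_space :: "('a, 'e::euclidean_space) atlas \<Rightarrow> 'a \<Rightarrow> 'a tangent set" where
  "tangent_space A p =
     {v. linear_functional (smooth_functions A) v \<and>
         (\<forall>f\<in>smooth_functions A. \<forall>g\<in>smooth_functions A.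
            v (\<lambda>x. f x * g x) = f p * v g + g p * v f) \<and>
         (\<forall>f. f \<notin> smooth_functions A \<longrightarrow> v f = 0)}"

definition cotangent_space :: "('a, 'e::euclidean_space) atlas \<Rightarrow> 'a \<Rightarrow> 'a cotangent set" where
  "cotangent_space A p =
     {\<omega>. linear_functional (tangent_space A p) \<omega> \<and> (\<forall>v. v \<notin> tangent_space A p \<longrightarrow> \<omega> v = 0)}"

text \<open>Smoothness of vector fields and tensor fields is tested on global smooth functions,
  vector fields and 1-forms. By bump functions this is the same as smoothness of all
  components in charts.\<close>

definition vector_fields :: "('a, 'e::euclidean_space) atlas \<Rightarrow> 'a vfield set" where
  "vector_fields A =
     {X. (\<forall>p. X p \<in> tangent_space A p) \<and>
         (\<forall>f\<in>smooth_functions A. (\<lambda>p. X p f) \<in> smooth_functions A)}"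

definition one_forms :: "('a, 'e::euclidean_space) atlas \<Rightarrow> 'a form set" where
  "one_forms A =
     {\<alpha>. (\<forall>p. \<alpha> p \<in> cotangent_space A p) \<and>
         (\<forall>X\<in>vector_fields A. (\<lambda>p. \<alpha> p (X p)) \<in> smooth_functions A)}"

definition form_add :: "'a form \<Rightarrow> 'a form \<Rightarrow> 'a form" (infixl "+\<^sub>F" 65) where
  "\<alpha> +\<^sub>F \<beta> = (\<lambda>p v. \<alpha> p v + \<beta> p v)"

definition form_scale :: "('a \<Rightarrow> real) \<Rightarrow> 'a form \<Rightarrow> 'a form" (infixr "*\<^sub>F" 70) where
  "\<phi> *\<^sub>F \<alpha> = (\<lambda>p v. \<phi> p * \<alpha> p v)"

definition differential :: "('a, 'e::euclidean_space) atlas \<Rightarrow> ('a \<Rightarrow> real) \<Rightarrow> 'a form" where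
  "differential A f p v = (if v \<in> tangent_space A p then v f else 0)"

definition lie_bracket :: "'a vfield \<Rightarrow> 'a vfield \<Rightarrow> 'a vfield" where
  "lie_bracket X Y p f = X p (\<lambda>x. Y x f) - Y p (\<lambda>x. X x f)"

text \<open>The Lie derivative of a 1-form, given by its values on vector fields:
  \<open>(L\<^sub>X \<beta>)(Y) = X (\<beta>(Y)) - \<beta>([X, Y])\<close>.\<close>

definition lie_derivative :: "'a vfield \<Rightarrow> 'a form \<Rightarrow> 'a vfield \<Rightarrow> 'a \<Rightarrow> real" where
  "lie_derivative X \<beta> Y p = X p (\<lambda>x. \<beta> x (Y x)) - \<beta> p (lie_bracket X Y p)"

definition pushforward ::
  "('b, 'd::euclidean_space) atlas \<Rightarrow> ('a \<Rightarrow> 'b) \<Rightarrow> 'a tangent \<Rightarrow> 'b tangent" where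
  "pushforward B \<sigma> v f = (if f \<in> smooth_functions B then v (f \<circ> \<sigma>) else 0)"

definition pullback ::
  "('a, 'e::euclidean_space) atlas \<Rightarrow> ('b, 'd::euclidean_space) atlas \<Rightarrow> ('a \<Rightarrow> 'b) \<Rightarrow>
     'b form \<Rightarrow> 'a form" where
  "pullback A B \<sigma> \<omega> p v =
     (if v \<in> tangent_space A p then \<omega> (\<sigma> p) (pushforward B \<sigma> v) else 0)"

subsection \<open>Metrics and bivector fields\<close>

type_synonym 'a metric = "'a \<Rightarrow> 'a tangent \<Rightarrow> 'a tangent \<Rightarrow> real"
type_synonym 'a cotensor2 = "'a \<Rightarrow> 'a cotangent \<Rightarrow> 'a cotangent \<Rightarrow> real"

definition on_forms :: "'a cotensor2 \<Rightarrow> 'a form \<Rightarrow> 'a form \<Rightarrow> 'a \<Rightarrow> real" where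
  "on_forms B \<alpha> \<beta> = (\<lambda>p. B p (\<alpha> p) (\<beta> p))"

definition smooth_cotensor2 :: "('a, 'e::euclidean_space) atlas \<Rightarrow> 'a cotensor2 \<Rightarrow> bool" where
  "smooth_cotensor2 A B \<longleftrightarrow>
     (\<forall>p. bilinear_form (cotangent_space A p) (B p)) \<and>
     (\<forall>\<alpha>\<in>one_forms A. \<forall>\<beta>\<in>one_forms A. on_forms B \<alpha> \<beta> \<in> smooth_functions A)"

definition bivector_field :: "('a, 'e::euclidean_space) atlas \<Rightarrow> 'a cotensor2 \<Rightarrow> bool" where
  "bivector_field A P \<longleftrightarrow> smooth_cotensor2 A P \<and>
     (\<forall>p. \<forall>\<alpha>\<in>cotangent_space A p. \<forall>\<beta>\<in>cotangent_space A p. P p \<alpha> \<beta> = - P p \<beta> \<alpha>)"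

definition contravariant_metric :: "('a, 'e::euclidean_space) atlas \<Rightarrow> 'a cotensor2 \<Rightarrow> bool" where
  "contravariant_metric A g \<longleftrightarrow> smooth_cotensor2 A g \<and>
     (\<forall>p. \<forall>\<alpha>\<in>cotangent_space A p. \<forall>\<beta>\<in>cotangent_space A p. g p \<alpha> \<beta> = g p \<beta> \<alpha>) \<and>
     (\<forall>p. \<forall>\<alpha>\<in>cotangent_space A p.
        (\<forall>\<beta>\<in>cotangent_space A p. g p \<alpha> \<beta> = 0) \<longrightarrow> \<alpha> = (\<lambda>v. 0))"

definition pseudo_riemannian_metric :: "('a, 'e::euclidean_space) atlas \<Rightarrow> 'a metric \<Rightarrow> bool" where
  "pseudo_riemannian_metric A h \<longleftrightarrow>
     (\<forall>p. bilinear_form (tangent_space A p) (h p)) \<and>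
     (\<forall>X\<in>vector_fields A. \<forall>Y\<in>vector_fields A. (\<lambda>p. h p (X p) (Y p)) \<in> smooth_functions A) \<and>
     (\<forall>p. \<forall>v\<in>tangent_space A p. \<forall>w\<in>tangent_space A p. h p v w = h p w v) \<and>
     (\<forall>p. \<forall>v\<in>tangent_space A p. (\<forall>w\<in>tangent_space A p. h p v w = 0) \<longrightarrow> v = (\<lambda>f. 0))"

definition metric_dual ::
  "('a, 'e::euclidean_space) atlas \<Rightarrow> 'a metric \<Rightarrow> 'a \<Rightarrow> 'a cotangent \<Rightarrow> 'a tangent" where
  "metric_dual A h p \<alpha> =
     (THE v. v \<in> tangent_space A p \<and> (\<forall>w\<in>tangent_space A p. h p v w = \<alpha> w))"

definition cometric :: "('a, 'e::euclidean_space) atlas \<Rightarrow> 'a metric \<Rightarrow> 'a cotensor2" where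
  "cometric A h p \<alpha> \<beta> = h p (metric_dual A h p \<alpha>) (metric_dual A h p \<beta>)"

definition anchor ::
  "('a, 'e::euclidean_space) atlas \<Rightarrow> 'a cotensor2 \<Rightarrow> 'a form \<Rightarrow> 'a vfield" where
  "anchor A P \<alpha> p =
     (THE v. v \<in> tangent_space A p \<and> (\<forall>\<beta>\<in>cotangent_space A p. \<beta> v = P p (\<alpha> p) \<beta>))"

definition J_field ::
  "('a, 'e::euclidean_space) atlas \<Rightarrow> 'a cotensor2 \<Rightarrow> 'a cotensor2 \<Rightarrow> 'a form \<Rightarrow> 'a form" where
  "J_field A g P \<alpha> p =
     (THE \<gamma>. \<gamma> \<in> cotangent_space A p \<and> (\<forall>\<beta>\<in>cotangent_space A p. g p \<gamma> \<beta> = P p (\<alpha> p) \<beta>))"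

subsection \<open>Contravariant connections\<close>

text \<open>As for \<^const>\<open>lie_derivative\<close>, the bracket is given by its values on vector fields.\<close>

definition koszul_bracket ::
  "('a, 'e::euclidean_space) atlas \<Rightarrow> 'a cotensor2 \<Rightarrow> 'a form \<Rightarrow> 'a form \<Rightarrow>
     'a vfield \<Rightarrow> 'a \<Rightarrow> real" where
  "koszul_bracket A P \<alpha> \<beta> Y p =
     lie_derivative (anchor A P \<alpha>) \<beta> Y p - lie_derivative (anchor A P \<beta>) \<alpha> Y p
     - differential A (on_forms P \<alpha> \<beta>) p (Y p)"

definition contravariant_connection ::
  "('a, 'e::euclidean_space) atlas \<Rightarrow> 'a cotensor2 \<Rightarrow> ('a form \<Rightarrow> 'a form \<Rightarrow> 'a form) \<Rightarrow> bool" where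
  "contravariant_connection A P D \<longleftrightarrow>
     (\<forall>\<alpha>\<in>one_forms A. \<forall>\<beta>\<in>one_forms A. D \<alpha> \<beta> \<in> one_forms A) \<and>
     (\<forall>\<alpha>\<in>one_forms A. \<forall>\<beta>\<in>one_forms A. \<forall>\<gamma>\<in>one_forms A.
        D (\<alpha> +\<^sub>F \<beta>) \<gamma> = D \<alpha> \<gamma> +\<^sub>F D \<beta> \<gamma> \<and> D \<alpha> (\<beta> +\<^sub>F \<gamma>) = D \<alpha> \<beta> +\<^sub>F D \<alpha> \<gamma>) \<and>
     (\<forall>c::real. \<forall>\<alpha>\<in>one_forms A. \<forall>\<beta>\<in>one_forms A.
        D ((\<lambda>p. c) *\<^sub>F \<alpha>) \<beta> = (\<lambda>p. c) *\<^sub>F D \<alpha> \<beta> \<and> D \<alpha> ((\<lambda>p. c) *\<^sub>F \<beta>) = (\<lambda>p. c) *\<^sub>F D \<alpha> \<beta>) \<and>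
     (\<forall>\<phi>\<in>smooth_functions A. \<forall>\<alpha>\<in>one_forms A. \<forall>\<beta>\<in>one_forms A.
        D (\<phi> *\<^sub>F \<alpha>) \<beta> = \<phi> *\<^sub>F D \<alpha> \<beta> \<and>
        D \<alpha> (\<phi> *\<^sub>F \<beta>) = \<phi> *\<^sub>F D \<alpha> \<beta> +\<^sub>F (\<lambda>p. anchor A P \<alpha> p \<phi>) *\<^sub>F \<beta>)"

definition levi_civita ::
  "('a, 'e::euclidean_space) atlas \<Rightarrow> 'a cotensor2 \<Rightarrow> 'a cotensor2 \<Rightarrow>
     ('a form \<Rightarrow> 'a form \<Rightarrow> 'a form) \<Rightarrow> bool" where
  "levi_civita A g P D \<longleftrightarrow>
     contravariant_connection A P D \<and>
     (\<forall>\<alpha>\<in>one_forms A. \<forall>\<beta>\<in>one_forms A. \<forall>\<gamma>\<in>one_forms A. \<forall>p.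
        anchor A P \<alpha> p (on_forms g \<beta> \<gamma>) = on_forms g (D \<alpha> \<beta>) \<gamma> p + on_forms g \<beta> (D \<alpha> \<gamma>) p) \<and>
     (\<forall>\<alpha>\<in>one_forms A. \<forall>\<beta>\<in>one_forms A. \<forall>Y\<in>vector_fields A. \<forall>p.
        D \<alpha> \<beta> p (Y p) - D \<beta> \<alpha> p (Y p) = koszul_bracket A P \<alpha> \<beta> Y p)"

subsection \<open>Lifts and warped structures on a product\<close>

text \<open>Functions are lifted by composing with \<^const>\<open>fst\<close> and \<^const>\<open>snd\<close>.\<close>

definition hlift ::
  "('a, 'e::euclidean_space) atlas \<Rightarrow> ('b, 'd::euclidean_space) atlas \<Rightarrow> 'a form \<Rightarrow> ('a \<times> 'b) form"
  where "hlift A1 A2 \<omega> = pullback (prod_atlas A1 A2) A1 fst \<omega>"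

definition vlift ::
  "('a, 'e::euclidean_space) atlas \<Rightarrow> ('b, 'd::euclidean_space) atlas \<Rightarrow> 'b form \<Rightarrow> ('a \<times> 'b) form"
  where "vlift A1 A2 \<omega> = pullback (prod_atlas A1 A2) A2 snd \<omega>"

definition warped_bivector ::
  "('a, 'e::euclidean_space) atlas \<Rightarrow> ('b, 'd::euclidean_space) atlas \<Rightarrow> ('a \<Rightarrow> real) \<Rightarrow>
     'a cotensor2 \<Rightarrow> 'b cotensor2 \<Rightarrow> ('a \<times> 'b) cotensor2 \<Rightarrow> bool" where
  "warped_bivector A1 A2 \<mu> P1 P2 P \<longleftrightarrow>
     bivector_field (prod_atlas A1 A2) P \<and>
     (\<forall>\<alpha>1\<in>one_forms A1. \<forall>\<beta>1\<in>one_forms A1.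
        on_forms P (hlift A1 A2 \<alpha>1) (hlift A1 A2 \<beta>1) = on_forms P1 \<alpha>1 \<beta>1 \<circ> fst) \<and>
     (\<forall>\<alpha>2\<in>one_forms A2. \<forall>\<beta>2\<in>one_forms A2.
        on_forms P (vlift A1 A2 \<alpha>2) (vlift A1 A2 \<beta>2) =
          (\<lambda>x. (\<mu> \<circ> fst) x * (on_forms P2 \<alpha>2 \<beta>2 \<circ> snd) x)) \<and>
     (\<forall>\<alpha>1\<in>one_forms A1. \<forall>\<beta>2\<in>one_forms A2.
        on_forms P (hlift A1 A2 \<alpha>1) (vlift A1 A2 \<beta>2) = (\<lambda>x. 0))"

definition warped_metric ::
  "('a, 'e::euclidean_space) atlas \<Rightarrow> ('b, 'd::euclidean_space) atlas \<Rightarrow> ('a \<Rightarrow> real) \<Rightarrow>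
     'a cotensor2 \<Rightarrow> 'b cotensor2 \<Rightarrow> ('a \<times> 'b) cotensor2 \<Rightarrow> bool" where
  "warped_metric A1 A2 f g1 g2 g \<longleftrightarrow>
     contravariant_metric (prod_atlas A1 A2) g \<and>
     (\<forall>\<alpha>1\<in>one_forms A1. \<forall>\<beta>1\<in>one_forms A1.
        on_forms g (hlift A1 A2 \<alpha>1) (hlift A1 A2 \<beta>1) = on_forms g1 \<alpha>1 \<beta>1 \<circ> fst) \<and>
     (\<forall>\<alpha>2\<in>one_forms A2. \<forall>\<beta>2\<in>one_forms A2.
        on_forms g (vlift A1 A2 \<alpha>2) (vlift A1 A2 \<beta>2) =
          (\<lambda>x. (f \<circ> fst) x * (on_forms g2 \<alpha>2 \<beta>2 \<circ> snd) x)) \<and>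
     (\<forall>\<alpha>1\<in>one_forms A1. \<forall>\<alpha>2\<in>one_forms A2.
        on_forms g (hlift A1 A2 \<alpha>1) (vlift A1 A2 \<alpha>2) = (\<lambda>x. 0))"

end

(* A tangent vector is a derivation of the algebra of smooth functions. Hadamard's lemma and bump
   functions show that it is determined by its values on finitely many functions that agree with
   chart coordinates near the point. Hence every covector is the value of a differential df, and on
   the product every covector at (x, y) is the sum of a horizontal and a vertical lift of 1-forms.

   As the warped metric is nondegenerate, the connection is therefore determined by the functions
   g(D_a b, c) with a, b, c lifts, and these are given by the Koszul formula. With the Koszul bracket
   evaluated on the vector fields dual to lifts, each term reduces to the factors, because the
   anchors and duals of lifts are horizontal or vertical lifts of vector fields, up to the factors
   mu and f. The derivatives of mu and f produce the terms with d mu and J_1 df. *)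

theory Submission
  imports Defs
begin

text \<open>Tangent vectors act on global functions, so a chart says nothing about them until its
  coordinates are cut off by a bump function; the analytic half of the proof serves this. The
  anchor, the metric dual and \<open>J_field\<close> are definite descriptions, so each needs
  existence and uniqueness. For the anchor of a bilinear form B the witness is the derivation f ->
  B(\<alpha>, df); it pairs correctly with all covectors because all of them are differentials. This
  works for any B, in particular for a cometric, whose anchor is the dual vector field. Such fields
  are needed because \<open>koszul_bracket\<close> takes a vector field as argument and is not a
  form: g([\<alpha>, \<beta>], \<gamma>) becomes the bracket evaluated at the dual of \<gamma>. The
  warped tensors are prescribed on lifts of global 1-forms, while J_1 df is known only as a family
  of covectors. The gap is closed point by point: a covector is replaced by a global differential
  with the same value there. Smoothness of the cometrics of the factors is not computed from an
  inverse matrix but read off slices of the warped metric.\<close>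

subsection \<open>Calculus of smooth maps\<close>

lemma frechet_derivative_cong_open:
  assumes "open S" "x \<in> S" "\<And>x. x \<in> S \<Longrightarrow> f x = g x"
  shows "frechet_derivative f (at x) = frechet_derivative g (at x)"
proof -
  have "(f has_derivative D) (at x) \<longleftrightarrow> (g has_derivative D) (at x)" for D
    using assms by (metis has_derivative_transform_within_open)
  then show ?thesis
    unfolding frechet_derivative_def by simp
qed

lemma differentiable_cong_open:
  assumes "open S" "x \<in> S" "\<And>x. x \<in> S \<Longrightarrow> f x = g x"
  shows "f differentiable (at x) \<longleftrightarrow> g differentiable (at x)"
  unfolding differentiable_def using assms by (metis has_derivative_transform_within_open)

lemma higher_differentiable_on_cong:
  assumes "open S" "\<And>x. x \<in> S \<Longrightarrow> f x = g x"
  shows "higher_differentiable_on k S f \<longleftrightarrow> higher_differentiable_on k S g"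
  using assms(2)
proof (induction k arbitrary: f g)
  case 0
  then show ?case
    unfolding higher_differentiable_on.simps by (intro continuous_on_cong) auto
next
  case (Suc k)
  have "frechet_derivative f (at x) = frechet_derivative g (at x)" if "x \<in> S" for x
    by (rule frechet_derivative_cong_open[OF assms(1) that Suc.prems])
  then have "higher_differentiable_on k S (\<lambda>x. frechet_derivative f (at x) e) \<longleftrightarrow>
      higher_differentiable_on k S (\<lambda>x. frechet_derivative g (at x) e)" for e
    by (intro Suc.IH) simp
  then show ?case
    using differentiable_cong_open[OF assms(1) _ Suc.prems] by auto
qed

text \<open>Derivatives being unique, an explicit \<open>f'\<close> may replace the chosen
  \<open>frechet_derivative\<close>. Openness of S allows the condition of order k to pass between
  functions that agree only on S. The inductive closure rules go through this rule.\<close>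

lemma higher_differentiable_on_SucI:
  assumes "open S" "\<And>x. x \<in> S \<Longrightarrow> (f has_derivative f' x) (at x)"
    and "\<And>e. higher_differentiable_on k S (\<lambda>x. f' x e)"
  shows "higher_differentiable_on (Suc k) S f"
proof -
  have "higher_differentiable_on k S (\<lambda>x. frechet_derivative f (at x) e)" for e
    by (rule iffD1[OF higher_differentiable_on_cong[OF assms(1)] assms(3)[of e]])
      (simp add: frechet_derivative_at[OF assms(2), symmetric])
  then show ?thesis
    using assms(2) by (auto simp: differentiable_def)
qed

lemma higher_differentiable_on_has_derivative:
  "higher_differentiable_on (Suc k) S f \<Longrightarrow> x \<in> S \<Longrightarrow>
    (f has_derivative frechet_derivative f (at x)) (at x)"
  by (simp add: frechet_derivative_works)

lemma higher_differentiable_on_SucD: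
  "higher_differentiable_on (Suc k) S f \<Longrightarrow> higher_differentiable_on k S f"
proof (induction k arbitrary: f)
  case 0
  then show ?case
    by (auto intro!: continuous_at_imp_continuous_on differentiable_imp_continuous_within)
next
  case (Suc k)
  then show ?case
    by (metis higher_differentiable_on.simps(2))
qed

lemma higher_differentiable_on_continuous:
  "higher_differentiable_on k S f \<Longrightarrow> continuous_on S f"
  by (induction k) (use higher_differentiable_on_SucD in auto)

lemma higher_differentiable_on_subset:
  "higher_differentiable_on k T f \<Longrightarrow> S \<subseteq> T \<Longrightarrow> higher_differentiable_on k S f"
  by (induction k arbitrary: f) (auto intro: continuous_on_subset)

lemma higher_differentiable_on_local:
  assumes "\<And>x. x \<in> S \<Longrightarrow> \<exists>T. open T \<and> x \<in> T \<and> higher_differentiable_on k T f"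
  shows "higher_differentiable_on k S f"
  using assms
proof (induction k arbitrary: f)
  case 0
  then show ?case
    by (auto intro!: continuous_at_imp_continuous_on simp: continuous_on_eq_continuous_at)
       (metis continuous_on_eq_continuous_at)
next
  case (Suc k)
  then show ?case
    by (metis higher_differentiable_on.simps(2))
qed

lemma higher_differentiable_on_const [simp]: "higher_differentiable_on k S (\<lambda>x. c)"
  by (induction k arbitrary: c) auto

lemma higher_differentiable_on_add:
  assumes "open S" "higher_differentiable_on k S f" "higher_differentiable_on k S g"
  shows "higher_differentiable_on k S (\<lambda>x. f x + g x)"
  using assms(2,3)
proof (induction k arbitrary: f g)
  case 0
  then show ?case by (auto intro: continuous_intros)
next
  case (Suc k)
  show ?case
  proof (rule higher_differentiable_on_SucI[OF assms(1)])
    show "((\<lambda>x. f x + g x) has_derivative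
        (\<lambda>e. frechet_derivative f (at x) e + frechet_derivative g (at x) e)) (at x)"
      if "x \<in> S" for x
      using Suc.prems that
      by (intro has_derivative_add higher_differentiable_on_has_derivative)
  qed (use Suc in auto)
qed

lemma higher_differentiable_on_sum:
  assumes "open S" "\<And>i. i \<in> I \<Longrightarrow> higher_differentiable_on k S (f i)"
  shows "higher_differentiable_on k S (\<lambda>x. \<Sum>i\<in>I. f i x)"
  using assms(2)
  by (induction I rule: infinite_finite_induct)
    (auto intro: higher_differentiable_on_add[OF assms(1)])

lemma higher_differentiable_on_linear_comp:
  assumes "bounded_linear L" "open S" "higher_differentiable_on k S f"
  shows "higher_differentiable_on k S (\<lambda>x. L (f x))"
  using assms(3)
proof (induction k arbitrary: f)
  case 0
  then show ?case using assms(1) by (auto intro: bounded_linear.continuous_on)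
next
  case (Suc k)
  show ?case
  proof (rule higher_differentiable_on_SucI[OF assms(2)])
    show "((\<lambda>x. L (f x)) has_derivative (\<lambda>e. L (frechet_derivative f (at x) e))) (at x)"
      if "x \<in> S" for x
      using Suc.prems that
      by (intro bounded_linear.has_derivative[OF assms(1)] higher_differentiable_on_has_derivative)
  qed (use Suc in auto)
qed

lemma higher_differentiable_on_scaleR:
  fixes f :: "'e::real_normed_vector \<Rightarrow> real" and g :: "'e \<Rightarrow> 'c::real_normed_vector"
  assumes "open S" "higher_differentiable_on k S f" "higher_differentiable_on k S g"
  shows "higher_differentiable_on k S (\<lambda>x. f x *\<^sub>R g x)"
  using assms(2,3)
proof (induction k arbitrary: f g)
  case 0
  then show ?case by (auto intro: continuous_intros)
next
  case (Suc k)
  show ?case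
  proof (rule higher_differentiable_on_SucI[OF assms(1)])
    show "((\<lambda>x. f x *\<^sub>R g x) has_derivative
        (\<lambda>e. f x *\<^sub>R frechet_derivative g (at x) e + frechet_derivative f (at x) e *\<^sub>R g x)) (at x)"
      if "x \<in> S" for x
      using Suc.prems that
      by (intro has_derivative_scaleR higher_differentiable_on_has_derivative)
    show "higher_differentiable_on k S
        (\<lambda>x. f x *\<^sub>R frechet_derivative g (at x) e + frechet_derivative f (at x) e *\<^sub>R g x)" for e
      using Suc.prems Suc.prems[THEN higher_differentiable_on_SucD]
      by (intro higher_differentiable_on_add[OF assms(1)] Suc.IH) auto
  qed
qed

lemma higher_differentiable_on_mult:
  fixes f :: "'e::real_normed_vector \<Rightarrow> real"
  assumes "open S" "higher_differentiable_on k S f" "higher_differentiable_on k S g"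
  shows "higher_differentiable_on k S (\<lambda>x. f x * g x)"
  using higher_differentiable_on_scaleR[OF assms] by simp

text \<open>The induction hypothesis covers derivatives of g in a fixed direction, but the chain
  rule yields g'(f x) in the direction f'(x) e, which moves with x. Expanding that direction in the
  basis of the intermediate Euclidean space gives a sum of products that the earlier rules
  handle.\<close>

lemma higher_differentiable_on_compose:
  fixes f :: "'e::real_normed_vector \<Rightarrow> 'f::euclidean_space" and g :: "'f \<Rightarrow> 'c::real_normed_vector"
  assumes "open S" "f ` S \<subseteq> T"
    and "higher_differentiable_on k S f" "higher_differentiable_on k T g"
  shows "higher_differentiable_on k S (\<lambda>x. g (f x))"
  using assms(3,4)
proof (induction k arbitrary: g)
  case 0
  then show ?case using assms(2) by (auto intro: continuous_on_compose2)
next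
  case (Suc k)
  let ?g' = "\<lambda>y. frechet_derivative g (at y)" and ?f' = "\<lambda>x. frechet_derivative f (at x)"
  show ?case
  proof (rule higher_differentiable_on_SucI[OF assms(1)])
    fix x assume x: "x \<in> S"
    then have "f x \<in> T" using assms(2) by auto
    then have g': "(g has_derivative ?g' (f x)) (at (f x))"
      using Suc.prems(2) by (rule higher_differentiable_on_has_derivative[rotated])
    then have lin: "linear (?g' (f x))"
      using bounded_linear.linear has_derivative_bounded_linear by blast
    have eq: "?g' (f x) u = (\<Sum>b\<in>Basis. (u \<bullet> b) *\<^sub>R ?g' (f x) b)" for u
    proof -
      have "?g' (f x) u = ?g' (f x) (\<Sum>b\<in>Basis. (u \<bullet> b) *\<^sub>R b)"
        by (simp add: euclidean_representation)
      then show ?thesis using lin by (simp add: linear_sum linear_scale)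
    qed
    show "((\<lambda>x. g (f x)) has_derivative
        (\<lambda>e. \<Sum>b\<in>Basis. (?f' x e \<bullet> b) *\<^sub>R ?g' (f x) b)) (at x)"
      using has_derivative_compose[OF higher_differentiable_on_has_derivative[OF Suc.prems(1) x] g']
      by (simp only: eq[symmetric])
  next
    fix e
    show "higher_differentiable_on k S (\<lambda>x. \<Sum>b\<in>Basis. (?f' x e \<bullet> b) *\<^sub>R ?g' (f x) b)"
      using Suc.prems higher_differentiable_on_SucD[OF Suc.prems(1)]
      by (intro higher_differentiable_on_sum[OF assms(1)] higher_differentiable_on_scaleR[OF assms(1)]
          Suc.IH higher_differentiable_on_linear_comp[OF bounded_linear_inner_left] assms(1)) auto
  qed
qed

lemma higher_differentiable_on_bounded_linear:
  assumes "bounded_linear L" "open S"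
  shows "higher_differentiable_on k S L"
proof (cases k)
  case 0
  then show ?thesis using assms by (simp add: linear_continuous_on)
next
  case (Suc m)
  have "higher_differentiable_on (Suc m) S L"
    by (rule higher_differentiable_on_SucI[OF assms(2)])
      (use assms bounded_linear_imp_has_derivative in auto)
  with Suc show ?thesis by simp
qed

text \<open>The derivative -f'/f^2 contains the inverse of f itself, so f stays fixed in the
  induction and the hypothesis at order k supplies that factor.\<close>

lemma higher_differentiable_on_inverse:
  fixes f :: "'e::real_normed_vector \<Rightarrow> real"
  assumes "open S" "\<And>x. x \<in> S \<Longrightarrow> f x \<noteq> 0" "higher_differentiable_on k S f"
  shows "higher_differentiable_on k S (\<lambda>x. inverse (f x))"
  using assms(3)
proof (induction k)
  case 0
  then show ?case using assms(2) by (auto intro: continuous_intros)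
next
  case (Suc k)
  note IH = Suc.IH[OF higher_differentiable_on_SucD[OF Suc.prems]]
  show ?case
  proof (rule higher_differentiable_on_SucI[OF assms(1)])
    show "((\<lambda>x. inverse (f x)) has_derivative
        (\<lambda>e. (- 1) * ((inverse (f x) * inverse (f x)) * frechet_derivative f (at x) e))) (at x)"
      if "x \<in> S" for x
      using Deriv.has_derivative_inverse[OF assms(2)[OF that]
          higher_differentiable_on_has_derivative[OF Suc.prems that]]
      by (simp add: algebra_simps)
    show "higher_differentiable_on k S
        (\<lambda>x. (- 1) * ((inverse (f x) * inverse (f x)) * frechet_derivative f (at x) e))" for e
      using Suc.prems by (intro higher_differentiable_on_mult assms(1) IH) auto
  qed
qed

section \<open>Smooth maps: closure rules at all orders together\<close>

lemma smooth_on_cong: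
  "open S \<Longrightarrow> (\<And>x. x \<in> S \<Longrightarrow> f x = g x) \<Longrightarrow> smooth_on S f \<longleftrightarrow> smooth_on S g"
  unfolding smooth_on_def using higher_differentiable_on_cong by blast

lemma smooth_on_eq:
  "open S \<Longrightarrow> smooth_on S f \<Longrightarrow> (\<And>x. x \<in> S \<Longrightarrow> f x = g x) \<Longrightarrow> smooth_on S g"
  using smooth_on_cong by blast

lemma smooth_on_subset: "smooth_on T f \<Longrightarrow> S \<subseteq> T \<Longrightarrow> smooth_on S f"
  unfolding smooth_on_def using higher_differentiable_on_subset by blast

lemma smooth_on_local:
  assumes "\<And>x. x \<in> S \<Longrightarrow> \<exists>T. open T \<and> x \<in> T \<and> smooth_on T f"
  shows "smooth_on S f"
  unfolding smooth_on_def
proof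
  show "higher_differentiable_on k S f" for k
    by (rule higher_differentiable_on_local) (use assms smooth_on_def in metis)
qed

lemma smooth_on_const [simp]: "smooth_on S (\<lambda>x. c)"
  by (simp add: smooth_on_def)

lemma smooth_on_add:
  "open S \<Longrightarrow> smooth_on S f \<Longrightarrow> smooth_on S g \<Longrightarrow> smooth_on S (\<lambda>x. f x + g x)"
  by (simp add: smooth_on_def higher_differentiable_on_add)

lemma smooth_on_mult:
  fixes f :: "'e::real_normed_vector \<Rightarrow> real"
  shows "open S \<Longrightarrow> smooth_on S f \<Longrightarrow> smooth_on S g \<Longrightarrow> smooth_on S (\<lambda>x. f x * g x)"
  by (simp add: smooth_on_def higher_differentiable_on_mult)

lemma smooth_on_inverse:
  fixes f :: "'e::real_normed_vector \<Rightarrow> real"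
  shows "open S \<Longrightarrow> (\<And>x. x \<in> S \<Longrightarrow> f x \<noteq> 0) \<Longrightarrow> smooth_on S f \<Longrightarrow> smooth_on S (\<lambda>x. inverse (f x))"
  by (simp add: smooth_on_def higher_differentiable_on_inverse)

lemma smooth_on_bounded_linear: "bounded_linear L \<Longrightarrow> open S \<Longrightarrow> smooth_on S L"
  by (simp add: smooth_on_def higher_differentiable_on_bounded_linear)

lemma smooth_on_linear_comp:
  "bounded_linear L \<Longrightarrow> open S \<Longrightarrow> smooth_on S f \<Longrightarrow> smooth_on S (\<lambda>x. L (f x))"
  by (simp add: smooth_on_def higher_differentiable_on_linear_comp)

lemma smooth_on_compose:
  fixes f :: "'e::real_normed_vector \<Rightarrow> 'f::euclidean_space"
  shows "open S \<Longrightarrow> f ` S \<subseteq> T \<Longrightarrow> smooth_on S f \<Longrightarrow> smooth_on T g \<Longrightarrow> smooth_on S (\<lambda>x. g (f x))"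
  by (simp add: smooth_on_def higher_differentiable_on_compose)

lemma smooth_on_Pair:
  assumes "open S" "smooth_on S f" "smooth_on S g"
  shows "smooth_on S (\<lambda>x. (f x, g x))"
proof -
  have "smooth_on S (\<lambda>x. (f x, 0) + (0, g x))"
    using assms
    by (intro smooth_on_add smooth_on_linear_comp[of "\<lambda>y. (y, 0)"]
        smooth_on_linear_comp[of "\<lambda>y. (0, y)"] bounded_linear_Pair bounded_linear_ident
        bounded_linear_zero)
  then show ?thesis by simp
qed

lemma smooth_on_has_derivative:
  "smooth_on S f \<Longrightarrow> x \<in> S \<Longrightarrow> (f has_derivative frechet_derivative f (at x)) (at x)"
  unfolding smooth_on_def by (rule higher_differentiable_on_has_derivative) (rule spec)

lemma smooth_on_frechet_derivative:
  "smooth_on S f \<Longrightarrow> smooth_on S (\<lambda>x. frechet_derivative f (at x) e)"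
  unfolding smooth_on_def using higher_differentiable_on.simps(2)[of _ S f] by simp

lemma smooth_on_continuous: "smooth_on S f \<Longrightarrow> continuous_on S f"
  unfolding smooth_on_def using higher_differentiable_on_continuous by blast

subsection \<open>Bump functions\<close>

text \<open>For m = 0 this is the classical function exp(-1/t), flat at 0. The power of 1/t makes
  the family closed under differentiation up to linear combinations, so that smoothness follows by
  induction for all m at once.\<close>

definition flat :: "nat \<Rightarrow> real \<Rightarrow> real" where
  "flat m t = (if 0 < t then exp (- inverse t) * inverse t ^ m else 0)"

lemma flat_tendsto_0: "(flat m \<longlongrightarrow> 0) (at 0)"
proof -
  \<comment> \<open>With s = 1/t the claim on the right of 0 is that powers of s are negligible
    against exp s at infinity.\<close>
  have "((\<lambda>t. t ^ m / exp t) \<longlongrightarrow> (0::real)) at_top"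
    by (rule tendsto_power_div_exp_0)
  then have "((\<lambda>t. inverse t ^ m / exp (inverse t)) \<longlongrightarrow> (0::real)) (at_right 0)"
    by (rule filterlim_compose) (rule filterlim_inverse_at_top_right)
  then have "((\<lambda>t. exp (- inverse t) * inverse t ^ m) \<longlongrightarrow> (0::real)) (at_right 0)"
    by (simp add: exp_minus field_simps)
  moreover have "\<forall>\<^sub>F t in at_right 0. flat m t = exp (- inverse t) * inverse t ^ m"
    by (auto simp: eventually_at_filter flat_def)
  ultimately have "(flat m \<longlongrightarrow> 0) (at_right 0)"
    by (simp add: tendsto_cong)
  moreover have "\<forall>\<^sub>F t in at_left 0. flat m t = 0"
    by (auto simp: eventually_at_filter flat_def)
  then have "(flat m \<longlongrightarrow> 0) (at_left 0)"
    by (simp add: tendsto_eventually)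
  ultimately show ?thesis by (rule filterlim_split_at_real[rotated])
qed

lemma flat_has_derivative:
  "(flat m has_real_derivative (flat (m + 2) t - real m * flat (m + 1) t)) (at t)"
proof -
  consider "0 < t" | "t < 0" | "t = 0" by linarith
  then show ?thesis
  proof cases
    case 1
    have "((\<lambda>t. exp (- inverse t) * inverse t ^ m) has_real_derivative
        (exp (- inverse t) * (inverse t)\<^sup>2 * inverse t ^ m
          + real m * inverse t ^ (m - 1) * (- (inverse t)\<^sup>2) * exp (- inverse t))) (at t)"
      using 1 by (auto intro!: derivative_eq_intros simp: power2_eq_square)
    \<comment> \<open>At m = 0 the truncated exponent m - 1 does no harm, because the factor m kills
      the term.\<close>
    moreover have "real m * inverse t ^ (m - 1) * (inverse t)\<^sup>2 = real m * inverse t ^ (m + 1)"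
      by (cases m) (auto simp: power2_eq_square)
    then have "real m * inverse t ^ (m - 1) * (- (inverse t)\<^sup>2) = - (real m * inverse t ^ (m + 1))"
      by (metis mult_minus_right)
    then have "exp (- inverse t) * (inverse t)\<^sup>2 * inverse t ^ m
          + real m * inverse t ^ (m - 1) * (- (inverse t)\<^sup>2) * exp (- inverse t)
        = flat (m + 2) t - real m * flat (m + 1) t"
      unfolding flat_def using 1 by (simp only: if_True) (simp add: power2_eq_square)
    ultimately have "((\<lambda>t. exp (- inverse t) * inverse t ^ m) has_real_derivative
        (flat (m + 2) t - real m * flat (m + 1) t)) (at t)"
      by simp
    then show ?thesis
      by (rule has_field_derivative_transform_within_open[where S = "{0<..}"])
        (use 1 in \<open>auto simp: flat_def\<close>)
  next
    case 2
    have "((\<lambda>t. 0) has_real_derivative (flat (m + 2) t - real m * flat (m + 1) t)) (at t)"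
      using 2 by (simp add: flat_def)
    then show ?thesis
      by (rule has_field_derivative_transform_within_open[where S = "{..<0}"])
        (use 2 in \<open>auto simp: flat_def\<close>)
  next
    case 3
    \<comment> \<open>The difference quotient of \<open>flat m\<close> at 0 is
      \<open>flat (m + 1)\<close> itself, whose limit is already known.\<close>
    have "\<forall>\<^sub>F h in at 0. flat (m + 1) h = (flat m (0 + h) - flat m 0) / h"
      by (auto simp: eventually_at_filter flat_def divide_inverse)
    then have "((\<lambda>h. (flat m (0 + h) - flat m 0) / h) \<longlongrightarrow> 0) (at 0)"
      using flat_tendsto_0[of "m + 1"] by (simp add: tendsto_cong)
    then show ?thesis
      using 3 by (simp add: DERIV_def flat_def)
  qed
qed

lemma smooth_on_flat: "smooth_on UNIV (flat m)"
proof -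
  have "higher_differentiable_on k UNIV (flat m)" for k
  proof (induction k arbitrary: m)
    case 0
    then show ?case
      by (auto intro!: continuous_at_imp_continuous_on intro: DERIV_isCont flat_has_derivative)
  next
    case (Suc k)
    show ?case
    proof (rule higher_differentiable_on_SucI)
      show "(flat m has_derivative (\<lambda>e. (flat (m + 2) t + (- real m) * flat (m + 1) t) * e)) (at t)" for t
        using flat_has_derivative[of m t] by (simp add: has_field_derivative_def)
      show "higher_differentiable_on k UNIV
          (\<lambda>t. (flat (m + 2) t + (- real m) * flat (m + 1) t) * e)" for e
        using Suc by (intro higher_differentiable_on_mult higher_differentiable_on_add) auto
    qed simp
  qed
  then show ?thesis by (simp add: smooth_on_def)
qed

text \<open>The quotient N / (N + Q), where N is positive exactly inside the ball of radius 2r and Q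
  exactly outside the closed ball of radius r. At every point one of them is positive, so the
  denominator never vanishes; near the centre Q = 0 and the quotient is 1.\<close>

lemma smooth_plateau:
  fixes a :: "'e::euclidean_space"
  assumes "0 < r"
  obtains \<theta> :: "'e \<Rightarrow> real" where "smooth_on UNIV \<theta>"
    "\<And>x. x \<in> ball a r \<Longrightarrow> \<theta> x = 1" "\<And>x. x \<notin> ball a (2 * r) \<Longrightarrow> \<theta> x = 0"
proof -
  \<comment> \<open>The squared distance, which unlike the distance is smooth at the centre too.
    Differences are spelled as sums and products below so that the rules for these apply.\<close>
  define s where "s = (\<lambda>x. (x - a) \<bullet> (x - a))"
  define N where "N = (\<lambda>x. flat 0 ((2 * r)\<^sup>2 + - 1 * s x))"
  define Q where "Q = (\<lambda>x. flat 0 (s x + (- r\<^sup>2)))"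
  have s_dist: "s x = (dist a x)\<^sup>2" for x
    by (metis dist_commute dist_norm power2_norm_eq_inner s_def)
  have "smooth_on UNIV (\<lambda>x. \<Sum>b\<in>Basis. ((x + (- a)) \<bullet> b) * ((x + (- a)) \<bullet> b))"
    unfolding smooth_on_def
    by (intro allI higher_differentiable_on_sum higher_differentiable_on_mult
        higher_differentiable_on_linear_comp[OF bounded_linear_inner_left] higher_differentiable_on_add
        higher_differentiable_on_bounded_linear[OF bounded_linear_ident]
        higher_differentiable_on_const) auto
  moreover have "s = (\<lambda>x. \<Sum>b\<in>Basis. ((x + (- a)) \<bullet> b) * ((x + (- a)) \<bullet> b))"
    unfolding s_def by (rule ext, subst euclidean_inner) simp
  ultimately have s: "smooth_on UNIV s" by simp
  have N: "smooth_on UNIV N" unfolding N_def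
    by (rule smooth_on_compose[OF open_UNIV subset_UNIV _ smooth_on_flat])
      (intro smooth_on_add smooth_on_mult smooth_on_const open_UNIV s)
  have Q: "smooth_on UNIV Q" unfolding Q_def
    by (rule smooth_on_compose[OF open_UNIV subset_UNIV _ smooth_on_flat])
      (intro smooth_on_add smooth_on_mult smooth_on_const open_UNIV s)
  have pos: "flat 0 t \<ge> 0" "t > 0 \<Longrightarrow> flat 0 t > 0" "t \<le> 0 \<Longrightarrow> flat 0 t = 0" for t
    by (auto simp: flat_def)
  have ne: "N x + Q x \<noteq> 0" for x
  proof (cases "s x < (2 * r)\<^sup>2")
    case True
    then have "N x > 0" by (simp add: N_def pos)
    then show ?thesis using pos(1)[of "s x + (- r\<^sup>2)"] by (simp add: Q_def)
  next
    case False
    have "r\<^sup>2 > 0" using assms by simp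
    then have "r\<^sup>2 < s x"
      using False by (simp add: power2_eq_square)
    then have "Q x > 0" by (simp add: Q_def pos)
    then show ?thesis using pos(1)[of "(2 * r)\<^sup>2 + (- 1) * s x"] by (simp add: N_def)
  qed
  show ?thesis
  proof
    show "smooth_on UNIV (\<lambda>x. N x * inverse (N x + Q x))"
      by (intro smooth_on_mult smooth_on_inverse smooth_on_add N Q ne) auto
    show "N x * inverse (N x + Q x) = 1" if "x \<in> ball a r" for x
    proof -
      have "s x \<le> r\<^sup>2" using that assms unfolding s_dist by (auto intro: power_mono)
      then have "Q x = 0" by (simp add: Q_def pos)
      then show ?thesis using ne[of x] by simp
    qed
    show "N x * inverse (N x + Q x) = 0" if "x \<notin> ball a (2 * r)" for x
    proof -
      have "(2 * r)\<^sup>2 \<le> s x" using that assms unfolding s_dist by (intro power_mono) auto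
      then show ?thesis by (simp add: N_def pos)
    qed
  qed
qed

subsection \<open>Hadamard's lemma\<close>

text \<open>Differentiation under the integral sign turns F into a directional derivative of F and
  contributes a factor t, since the inner map is x -> a + t(x - a). The weight t^m absorbs these
  factors and makes the induction on k close. Convexity keeps the rays from a inside S.\<close>

lemma higher_differentiable_on_ray_integral:
  fixes F :: "'e::euclidean_space \<Rightarrow> real"
  assumes "open S" "convex S" "a \<in> S" "higher_differentiable_on k S F"
  shows "higher_differentiable_on k S (\<lambda>x. integral {0..1} (\<lambda>t. t ^ m * F (a + t *\<^sub>R (x - a))))"
  using assms(4)
proof (induction k arbitrary: F m)
  have mem: "a + t *\<^sub>R (x - a) \<in> S" if "x \<in> S" "t \<in> cbox 0 1" for x t
  proof -
    have "a + t *\<^sub>R (x - a) = (1 - t) *\<^sub>R a + t *\<^sub>R x"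
      by (simp add: algebra_simps)
    then show ?thesis using convexD_alt[OF assms(2) assms(3) that(1), of t] that(2) by auto
  qed
  have cont: "continuous_on (S \<times> cbox 0 1) (\<lambda>(x, t). t ^ m * G (a + t *\<^sub>R (x - a)))"
    if "continuous_on S G" for G :: "'e \<Rightarrow> real" and m
    unfolding split_beta
    by (intro continuous_intros continuous_on_compose2[OF that]) (use mem in auto)
  {
    case 0
    then show ?case
      using integral_continuous_on_param[OF cont, of F m] by simp
  next
    case (Suc k)
    let ?F' = "\<lambda>y. frechet_derivative F (at y)"
    have F': "(F has_derivative ?F' y) (at y)" if "y \<in> S" for y
      using higher_differentiable_on_has_derivative[OF Suc.prems that] .
    \<comment> \<open>The derivative of the integrand in x, as an element of the space of bounded
      linear maps because the Leibniz rule asks for that; the exponent has grown by the factor t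
      from the ray.\<close>
    define B where "B = (\<lambda>x t. t ^ Suc m *\<^sub>R Blinfun (?F' (a + t *\<^sub>R (x - a))))"
    have B: "blinfun_apply (B x t) e = t ^ Suc m * ?F' (a + t *\<^sub>R (x - a)) e"
      if "x \<in> S" "t \<in> cbox 0 1" for x t e
      using has_derivative_bounded_linear[OF F'[OF mem[OF that]]]
      by (simp add: B_def blinfun.scaleR_left bounded_linear_Blinfun_apply)
    have contF': "continuous_on S (\<lambda>y. ?F' y e)" for e
    proof -
      have "higher_differentiable_on k S (\<lambda>y. ?F' y e)" using Suc.prems by simp
      then show ?thesis by (rule higher_differentiable_on_continuous)
    qed
    have contB: "continuous_on (S \<times> cbox 0 1) (\<lambda>(x, t). B x t)"
    proof (rule continuous_on_blinfun_componentwise)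
      fix i :: 'e
      show "continuous_on (S \<times> cbox 0 1) (\<lambda>x. blinfun_apply (case x of (x, t) \<Rightarrow> B x t) i)"
        using cont[OF contF', of "Suc m" i] by (rule continuous_on_eq) (auto simp: B)
    qed
    have intB: "B x integrable_on cbox 0 1" if "x \<in> S" for x
    proof -
      have "continuous_on (cbox 0 1) (\<lambda>t. case (x, t) of (x, t) \<Rightarrow> B x t)"
        by (rule continuous_on_compose2[OF contB]) (use that in \<open>auto intro!: continuous_intros\<close>)
      then show ?thesis by (intro integrable_continuous) simp
    qed
    have deriv: "((\<lambda>x. integral (cbox 0 1) (\<lambda>t. t ^ m * F (a + t *\<^sub>R (x - a))))
        has_derivative blinfun_apply (integral (cbox 0 1) (B x))) (at x within S)" if "x \<in> S" for x
    proof (rule leibniz_rule[OF _ _ contB that assms(2)])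
      fix x t assume xt: "x \<in> S" "t \<in> cbox (0::real) 1"
      have inner: "((\<lambda>x. a + t *\<^sub>R (x - a)) has_derivative (\<lambda>e. t *\<^sub>R e)) (at x)"
        by (auto intro!: derivative_eq_intros)
      have "linear (?F' (a + t *\<^sub>R (x - a)))"
        using F'[OF mem[OF xt]] has_derivative_linear by blast
      then have "((\<lambda>x. t ^ m * F (a + t *\<^sub>R (x - a))) has_derivative
          (\<lambda>e. t ^ Suc m * ?F' (a + t *\<^sub>R (x - a)) e)) (at x)"
        using has_derivative_mult_right[OF has_derivative_compose[OF inner F'[OF mem[OF xt]]], of "t ^ m"]
        by (simp add: linear_scale algebra_simps)
      then show "((\<lambda>x. t ^ m * F (a + t *\<^sub>R (x - a))) has_derivative blinfun_apply (B x t)) (at x within S)"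
        unfolding B[OF xt, symmetric] by (rule has_derivative_at_withinI)
    next
      fix x assume "x \<in> S"
      moreover have "continuous_on S F"
        using Suc.prems higher_differentiable_on_continuous by blast
      ultimately have "continuous_on (cbox 0 1)
          (\<lambda>t. case (x, t) of (x, t) \<Rightarrow> t ^ m * F (a + t *\<^sub>R (x - a)))"
        by (intro continuous_on_compose2[OF cont[of F m]]) (auto intro!: continuous_intros)
      then show "(\<lambda>t. t ^ m * F (a + t *\<^sub>R (x - a))) integrable_on cbox 0 1"
        by (intro integrable_continuous) simp
    qed
    have apply_B: "blinfun_apply (integral (cbox 0 1) (B x)) e =
        integral {0..1} (\<lambda>t. t ^ Suc m * ?F' (a + t *\<^sub>R (x - a)) e)" if "x \<in> S" for x e
    proof -
      have "blinfun_apply (integral (cbox 0 1) (B x)) e =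
          integral (cbox 0 1) (\<lambda>t. blinfun_apply (B x t) e)"
        using integral_linear[OF intB[OF that] blinfun.bounded_linear_left[of e]] by (simp add: o_def)
      also have "\<dots> = integral {0..1} (\<lambda>t. t ^ Suc m * ?F' (a + t *\<^sub>R (x - a)) e)"
        using B[OF that] by (auto intro: integral_cong)
      finally show ?thesis .
    qed
    show ?case
    proof (rule higher_differentiable_on_SucI[OF assms(1)])
      fix x assume x: "x \<in> S"
      show "((\<lambda>x. integral {0..1} (\<lambda>t. t ^ m * F (a + t *\<^sub>R (x - a)))) has_derivative
          blinfun_apply (integral (cbox 0 1) (B x))) (at x)"
        using deriv[OF x] unfolding at_within_open[OF x assms(1)] box_real .
    next
      fix e
      have "higher_differentiable_on k S (\<lambda>x. integral {0..1} (\<lambda>t. t ^ Suc m * ?F' (a + t *\<^sub>R (x - a)) e))"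
        using Suc.prems by (intro Suc.IH) auto
      then show "higher_differentiable_on k S (\<lambda>x. blinfun_apply (integral (cbox 0 1) (B x)) e)"
        by (simp only: higher_differentiable_on_cong[OF assms(1) apply_B])
    qed
  }
qed

text \<open>F x - F a is the integral over [0, 1] of the derivative of F along the segment from a to
  x. Expanding x - a in the basis inside the integral gives the coefficients \<open>G b\<close>.
  Their values at a are the partial derivatives, which is all that a derivation at a will
  see.\<close>

lemma hadamard:
  fixes F :: "'e::euclidean_space \<Rightarrow> real"
  assumes "open S" "convex S" "a \<in> S" "smooth_on S F"
  obtains G where "\<And>b. smooth_on S (G b)"
    "\<And>x. x \<in> S \<Longrightarrow> F x = F a + (\<Sum>b\<in>Basis. ((x - a) \<bullet> b) * G b x)"
    "\<And>b. G b a = frechet_derivative F (at a) b"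
proof -
  let ?F' = "\<lambda>y. frechet_derivative F (at y)"
  define G where "G = (\<lambda>b x. integral {0..1} (\<lambda>t. ?F' (a + t *\<^sub>R (x - a)) b))"
  show ?thesis
  proof
    show "smooth_on S (G b)" for b
      using higher_differentiable_on_ray_integral[OF assms(1-3), of _ "\<lambda>y. ?F' y b" 0]
        smooth_on_frechet_derivative[OF assms(4)]
      by (simp add: smooth_on_def G_def)
    show "G b a = ?F' a b" for b
      by (simp add: G_def)
  next
    fix x assume x: "x \<in> S"
    have mem: "a + t *\<^sub>R (x - a) \<in> S" if "t \<in> {0..1}" for t
    proof -
      have "a + t *\<^sub>R (x - a) = (1 - t) *\<^sub>R a + t *\<^sub>R x"
        by (simp add: algebra_simps)
      then show ?thesis using convexD_alt[OF assms(2) assms(3) x, of t] that by auto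
    qed
    have F': "(F has_derivative ?F' y) (at y)" if "y \<in> S" for y
      using smooth_on_has_derivative[OF assms(4) that] .
    have expand: "?F' y (x - a) = (\<Sum>b\<in>Basis. ((x - a) \<bullet> b) * ?F' y b)" if "y \<in> S" for y
    proof -
      have lin: "linear (?F' y)" using F'[OF that] has_derivative_linear by blast
      have "?F' y (x - a) = ?F' y (\<Sum>b\<in>Basis. ((x - a) \<bullet> b) *\<^sub>R b)"
        by (simp add: euclidean_representation)
      then show ?thesis using lin by (simp add: linear_sum linear_scale)
    qed
    have "((\<lambda>t. F (a + t *\<^sub>R (x - a))) has_vector_derivative ?F' (a + t *\<^sub>R (x - a)) (x - a))
        (at t within {0..1})" if "t \<in> {0..1}" for t
    proof -
      have inner: "((\<lambda>t. a + t *\<^sub>R (x - a)) has_derivative (\<lambda>e. e *\<^sub>R (x - a))) (at t within {0..1})"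
        by (auto intro!: derivative_eq_intros)
      have "linear (?F' (a + t *\<^sub>R (x - a)))"
        using F'[OF mem[OF that]] has_derivative_linear by blast
      then show ?thesis
        using has_derivative_compose[OF inner F'[OF mem[OF that]]]
        by (simp add: has_vector_derivative_def linear_scale)
    qed
    then have "((\<lambda>t. ?F' (a + t *\<^sub>R (x - a)) (x - a)) has_integral F x - F a) {0..1}"
      using fundamental_theorem_of_calculus[of 0 1 "\<lambda>t. F (a + t *\<^sub>R (x - a))"] by simp
    then have 1: "((\<lambda>t. \<Sum>b\<in>Basis. ((x - a) \<bullet> b) * ?F' (a + t *\<^sub>R (x - a)) b) has_integral F x - F a) {0..1}"
      by (rule has_integral_eq[rotated]) (use expand mem in auto)
    have "((\<lambda>t. ?F' (a + t *\<^sub>R (x - a)) b) has_integral G b x) {0..1}" for b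
    proof -
      have "continuous_on S (\<lambda>y. ?F' y b)"
        using smooth_on_frechet_derivative[OF assms(4)] by (rule smooth_on_continuous)
      then have "continuous_on {0..1} (\<lambda>t. ?F' (a + t *\<^sub>R (x - a)) b)"
        by (rule continuous_on_compose2) (use mem in \<open>auto intro!: continuous_intros\<close>)
      then show ?thesis
        unfolding G_def by (intro integrable_integral integrable_continuous_real)
    qed
    then have "((\<lambda>t. \<Sum>b\<in>Basis. ((x - a) \<bullet> b) * ?F' (a + t *\<^sub>R (x - a)) b) has_integral
        (\<Sum>b\<in>Basis. ((x - a) \<bullet> b) * G b x)) {0..1}"
      by (intro has_integral_sum has_integral_mult_right) auto
    with 1 have "F x - F a = (\<Sum>b\<in>Basis. ((x - a) \<bullet> b) * G b x)"
      by (rule has_integral_unique)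
    then show "F x = F a + (\<Sum>b\<in>Basis. ((x - a) \<bullet> b) * G b x)" by simp
  qed
qed

subsection \<open>Charts and smooth functions\<close>

lemma smooth_atlas_chart:
  assumes "smooth_atlas A" "(U, \<phi>) \<in> A"
  shows "open U" "open (\<phi> ` U)" "inj_on \<phi> U" "continuous_on U \<phi>"
    "continuous_on (\<phi> ` U) (inv_into U \<phi>)"
proof -
  have *: "open U \<and> open (\<phi> ` U) \<and> homeomorphism U (\<phi> ` U) \<phi> (inv_into U \<phi>)"
    using assms unfolding smooth_atlas_def by blast
  then show "open U" "open (\<phi> ` U)" "continuous_on U \<phi>" "continuous_on (\<phi> ` U) (inv_into U \<phi>)"
    by (auto simp: homeomorphism_def)
  show "inj_on \<phi> U"
    using * unfolding homeomorphism_def by (metis inj_on_inverseI)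
qed

lemma smooth_atlas_cover:
  assumes "smooth_atlas A"
  obtains U \<phi> where "(U, \<phi>) \<in> A" "p \<in> U"
proof -
  have "p \<in> (\<Union>(U, \<phi>)\<in>A. U)" using assms by (simp add: smooth_atlas_def)
  then show ?thesis using that by auto
qed

lemma smooth_atlas_transition:
  assumes "smooth_atlas A" "(U, \<phi>) \<in> A" "(V, \<psi>) \<in> A"
  shows "smooth_on (\<phi> ` (U \<inter> V)) (\<psi> \<circ> inv_into U \<phi>)"
  using assms unfolding smooth_atlas_def by blast

lemma chart_open_image:
  assumes "smooth_atlas A" "(U, \<phi>) \<in> A" "open W"
  shows "open (\<phi> ` (U \<inter> W))"
proof -
  note c = smooth_atlas_chart[OF assms(1,2)]
  have "\<phi> ` (U \<inter> W) = \<phi> ` U \<inter> inv_into U \<phi> -` W"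
    using c(3) by (auto simp: inv_into_f_f f_inv_into_f inv_into_into)
  then show ?thesis
    using continuous_open_preimage[OF c(5,2) assms(3)] by simp
qed

lemma chart_open_vimage:
  assumes "smooth_atlas A" "(U, \<phi>) \<in> A" "open S"
  shows "open (U \<inter> \<phi> -` S)"
  using smooth_atlas_chart[OF assms(1,2)] assms(3) continuous_open_preimage by blast

lemma smooth_functionsD:
  "f \<in> smooth_functions A \<Longrightarrow> (U, \<phi>) \<in> A \<Longrightarrow> smooth_on (\<phi> ` U) (f \<circ> inv_into U \<phi>)"
  unfolding smooth_functions_def by blast

lemma smooth_functions_const [simp]: "(\<lambda>x. c) \<in> smooth_functions A"
  by (auto simp: smooth_functions_def o_def)

lemma smooth_functions_add:
  assumes "smooth_atlas A" "f \<in> smooth_functions A" "g \<in> smooth_functions A"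
  shows "(\<lambda>x. f x + g x) \<in> smooth_functions A"
  unfolding smooth_functions_def
proof safe
  fix U \<phi> assume c: "(U, \<phi>) \<in> A"
  show "smooth_on (\<phi> ` U) ((\<lambda>x. f x + g x) \<circ> inv_into U \<phi>)"
    using smooth_on_add[OF smooth_atlas_chart(2)[OF assms(1) c]
        smooth_functionsD[OF assms(2) c] smooth_functionsD[OF assms(3) c]]
    by (simp add: o_def)
qed

lemma smooth_functions_mult:
  assumes "smooth_atlas A" "f \<in> smooth_functions A" "g \<in> smooth_functions A"
  shows "(\<lambda>x. f x * g x) \<in> smooth_functions A"
  unfolding smooth_functions_def
proof safe
  fix U \<phi> assume c: "(U, \<phi>) \<in> A"
  show "smooth_on (\<phi> ` U) ((\<lambda>x. f x * g x) \<circ> inv_into U \<phi>)"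
    using smooth_on_mult[OF smooth_atlas_chart(2)[OF assms(1) c]
        smooth_functionsD[OF assms(2) c] smooth_functionsD[OF assms(3) c]]
    by (simp add: o_def)
qed

lemma smooth_functions_sum:
  assumes "smooth_atlas A" "\<And>i. i \<in> I \<Longrightarrow> f i \<in> smooth_functions A"
  shows "(\<lambda>x. \<Sum>i\<in>I. f i x) \<in> smooth_functions A"
  using assms(2)
  by (induction I rule: infinite_finite_induct) (auto intro: smooth_functions_add[OF assms(1)])

text \<open>Lets a function be compared near each point with a different global smooth function.
  Pullbacks of 1-forms need this, as their coordinate expression uses a frame that spans only
  locally.\<close>

lemma smooth_functions_local:
  assumes "smooth_atlas A"
    and "\<And>p. \<exists>W g. open W \<and> p \<in> W \<and> g \<in> smooth_functions A \<and> (\<forall>x\<in>W. f x = g x)"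
  shows "f \<in> smooth_functions A"
  unfolding smooth_functions_def
proof safe
  fix U \<phi> assume c: "(U, \<phi>) \<in> A"
  note chart = smooth_atlas_chart[OF assms(1) c]
  show "smooth_on (\<phi> ` U) (f \<circ> inv_into U \<phi>)"
  proof (rule smooth_on_local)
    fix y assume "y \<in> \<phi> ` U"
    then obtain p where p: "p \<in> U" "y = \<phi> p" by auto
    obtain W g where W: "open W" "p \<in> W" "g \<in> smooth_functions A" "\<forall>x\<in>W. f x = g x"
      using assms(2)[of p] by auto
    have op: "open (\<phi> ` (U \<inter> W))" by (rule chart_open_image[OF assms(1) c W(1)])
    have "smooth_on (\<phi> ` (U \<inter> W)) (g \<circ> inv_into U \<phi>)"
      using smooth_functionsD[OF W(3) c] by (rule smooth_on_subset) auto
    moreover have "(g \<circ> inv_into U \<phi>) z = (f \<circ> inv_into U \<phi>) z" if "z \<in> \<phi> ` (U \<inter> W)" for z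
      using that W(4) chart(3) by auto
    ultimately have "smooth_on (\<phi> ` (U \<inter> W)) (f \<circ> inv_into U \<phi>)"
      using smooth_on_cong[OF op, of "g \<circ> inv_into U \<phi>" "f \<circ> inv_into U \<phi>"] by blast
    then show "\<exists>T. open T \<and> y \<in> T \<and> smooth_on T (f \<circ> inv_into U \<phi>)"
      using op p W(2) by blast
  qed
qed

text \<open>Extension by zero is smooth because two open sets cover the manifold: the part of the
  chart over S, where a transition map expresses the function through G, and the complement of the
  preimage K of C, where it vanishes. That K is closed is where the Hausdorff property enters: it is
  compact.\<close>

lemma chart_extension_smooth:
  assumes "smooth_atlas A" "(U, \<phi>) \<in> A"
    and S: "open S" "S \<subseteq> \<phi> ` U" and C: "compact C" "C \<subseteq> S"
    and G: "smooth_on S G" "\<And>y. y \<in> S - C \<Longrightarrow> G y = (0::real)"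
  shows "(\<lambda>x. if x \<in> U \<and> \<phi> x \<in> S then G (\<phi> x) else 0) \<in> smooth_functions A"
    (is "?F \<in> _")
  unfolding smooth_functions_def
proof safe
  note chart = smooth_atlas_chart[OF assms(1,2)]
  define K where "K = inv_into U \<phi> ` C"
  have "continuous_on C (inv_into U \<phi>)"
    using chart(5) C S by (meson continuous_on_subset order_trans)
  then have "closed K"
    unfolding K_def using C(1) by (intro compact_imp_closed compact_continuous_image)
  fix V \<psi> assume c: "(V, \<psi>) \<in> A"
  note chart' = smooth_atlas_chart[OF assms(1) c]
  show "smooth_on (\<psi> ` V) (?F \<circ> inv_into V \<psi>)"
  proof (rule smooth_on_local)
    fix y assume "y \<in> \<psi> ` V"
    then obtain z where z: "z \<in> V" "y = \<psi> z" by auto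
    show "\<exists>T. open T \<and> y \<in> T \<and> smooth_on T (?F \<circ> inv_into V \<psi>)"
    proof (cases "z \<in> K")
      case True
      let ?W = "U \<inter> \<phi> -` S"
      have "z \<in> ?W"
        using True C(2) S(2) unfolding K_def by (auto simp: inv_into_into f_inv_into_f subset_iff)
      have op: "open (\<psi> ` (V \<inter> ?W))"
        by (intro chart_open_image[OF assms(1) c] chart_open_vimage[OF assms(1,2) S(1)])
      have "smooth_on (\<psi> ` (V \<inter> ?W)) (\<phi> \<circ> inv_into V \<psi>)"
        using smooth_atlas_transition[OF assms(1) c assms(2)] by (rule smooth_on_subset) auto
      moreover have "(\<phi> \<circ> inv_into V \<psi>) ` \<psi> ` (V \<inter> ?W) \<subseteq> S" using chart'(3) by auto
      ultimately have "smooth_on (\<psi> ` (V \<inter> ?W)) (\<lambda>x. G ((\<phi> \<circ> inv_into V \<psi>) x))"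
        using smooth_on_compose[OF op _ _ G(1)] by blast
      moreover have "G ((\<phi> \<circ> inv_into V \<psi>) x) = (?F \<circ> inv_into V \<psi>) x" if "x \<in> \<psi> ` (V \<inter> ?W)" for x
        using that chart'(3) by auto
      ultimately have "smooth_on (\<psi> ` (V \<inter> ?W)) (?F \<circ> inv_into V \<psi>)"
        using smooth_on_cong[OF op, of "\<lambda>x. G ((\<phi> \<circ> inv_into V \<psi>) x)" "?F \<circ> inv_into V \<psi>"] by blast
      then show ?thesis using op z \<open>z \<in> ?W\<close> by blast
    next
      case False
      have op: "open (\<psi> ` (V \<inter> - K))"
        using \<open>closed K\<close> by (intro chart_open_image[OF assms(1) c]) auto
      have "?F x = 0" if "x \<notin> K" for x
        using that G(2) chart(3) unfolding K_def by (auto simp: image_iff) (metis Diff_iff inv_into_f_f)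
      then have "(?F \<circ> inv_into V \<psi>) x = 0" if "x \<in> \<psi> ` (V \<inter> - K)" for x
      proof -
        have "inv_into V \<psi> x \<notin> K" using that chart'(3) by auto
        then show ?thesis using \<open>\<And>x. x \<notin> K \<Longrightarrow> ?F x = 0\<close> by (simp only: o_apply)
      qed
      then have "smooth_on (\<psi> ` (V \<inter> - K)) (?F \<circ> inv_into V \<psi>)"
        using smooth_on_cong[OF op, of "?F \<circ> inv_into V \<psi>" "\<lambda>x. 0"] smooth_on_const by blast
      then show ?thesis using op z False by blast
    qed
  qed
qed

text \<open>One cut-off \<theta> and one neighbourhood W serve every G, so that all coordinates, or
  all Hadamard coefficients, become global functions on the same W.\<close>

lemma chart_local_extension:
  fixes A :: "('a::{t2_space, second_countable_topology}, 'e::euclidean_space) atlas"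
  assumes "smooth_atlas A" "(U, \<phi>) \<in> A" "open S" "S \<subseteq> \<phi> ` U" "p \<in> U" "\<phi> p \<in> S"
  obtains \<theta> W where "smooth_on UNIV \<theta>" "open W" "p \<in> W" "W \<subseteq> U \<inter> \<phi> -` S"
    "\<And>x. x \<in> W \<Longrightarrow> \<theta> (\<phi> x) = 1"
    "\<And>G. smooth_on S G \<Longrightarrow>
      (\<lambda>x. if x \<in> U \<and> \<phi> x \<in> S then \<theta> (\<phi> x) * G (\<phi> x) else 0) \<in> smooth_functions A"
proof -
  \<comment> \<open>A closed ball inside S, so that the support of the cut-off lies in a compact
    subset of S.\<close>
  obtain r where r: "r > 0" "cball (\<phi> p) r \<subseteq> S"
    using assms(3,6) open_contains_cball by blast
  obtain \<theta> :: "'e \<Rightarrow> real" where \<theta>: "smooth_on UNIV \<theta>"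
    "\<And>x. x \<in> ball (\<phi> p) (r / 2) \<Longrightarrow> \<theta> x = 1" "\<And>x. x \<notin> ball (\<phi> p) r \<Longrightarrow> \<theta> x = 0"
    using smooth_plateau[of "r / 2" "\<phi> p"] r(1) by auto
  show ?thesis
  proof
    show "smooth_on UNIV \<theta>" by fact
    show "open (U \<inter> \<phi> -` ball (\<phi> p) (r / 2))"
      by (intro chart_open_vimage[OF assms(1,2)]) auto
    show "p \<in> U \<inter> \<phi> -` ball (\<phi> p) (r / 2)" using assms(5) r by auto
    have "ball (\<phi> p) (r / 2) \<subseteq> cball (\<phi> p) r" using r(1) by auto
    then show "U \<inter> \<phi> -` ball (\<phi> p) (r / 2) \<subseteq> U \<inter> \<phi> -` S" using r(2) by auto
    show "\<theta> (\<phi> x) = 1" if "x \<in> U \<inter> \<phi> -` ball (\<phi> p) (r / 2)" for x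
      using that \<theta>(2) by auto
    fix G :: "'e \<Rightarrow> real" assume G: "smooth_on S G"
    show "(\<lambda>x. if x \<in> U \<and> \<phi> x \<in> S then \<theta> (\<phi> x) * G (\<phi> x) else 0) \<in> smooth_functions A"
    proof (rule chart_extension_smooth[OF assms(1-4), of "cball (\<phi> p) r"])
      show "smooth_on S (\<lambda>y. \<theta> y * G y)"
        using \<theta>(1) G assms(3) by (intro smooth_on_mult) (auto intro: smooth_on_subset)
      show "\<theta> y * G y = 0" if "y \<in> S - cball (\<phi> p) r" for y
        using that \<theta>(3)[of y] by auto
    qed (use r in auto)
  qed
qed

subsection \<open>Tangent vectors in coordinates\<close>

lemma linear_functionalD:
  assumes "linear_functional V L"
  shows "u \<in> V \<Longrightarrow> v \<in> V \<Longrightarrow> L (\<lambda>x. u x + v x) = L u + L v" "u \<in> V \<Longrightarrow> L (\<lambda>x. c * u x) = c * L u"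
  using assms unfolding linear_functional_def by blast+

lemma tangent_spaceD:
  assumes "v \<in> tangent_space A p"
  shows "f \<in> smooth_functions A \<Longrightarrow> g \<in> smooth_functions A \<Longrightarrow> v (\<lambda>x. f x + g x) = v f + v g"
    and "f \<in> smooth_functions A \<Longrightarrow> v (\<lambda>x. c * f x) = c * v f"
    and "f \<in> smooth_functions A \<Longrightarrow> g \<in> smooth_functions A \<Longrightarrow>
      v (\<lambda>x. f x * g x) = f p * v g + g p * v f"
    and "f \<notin> smooth_functions A \<Longrightarrow> v f = 0"
  using assms unfolding tangent_space_def linear_functional_def by blast+

lemma tangent_const:
  assumes "v \<in> tangent_space A p"
  shows "v (\<lambda>x. c) = 0"
proof -
  have "v (\<lambda>x. 1) = 0"
    using tangent_spaceD(3)[OF assms, of "\<lambda>x. 1" "\<lambda>x. 1"] by simp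
  then show ?thesis
    using tangent_spaceD(2)[OF assms, of "\<lambda>x. 1" c] by simp
qed

lemma tangent_sum:
  assumes "smooth_atlas A" "v \<in> tangent_space A p" "\<And>i. i \<in> I \<Longrightarrow> f i \<in> smooth_functions A"
  shows "v (\<lambda>x. \<Sum>i\<in>I. f i x) = (\<Sum>i\<in>I. v (f i))"
  using assms(3)
proof (induction I rule: infinite_finite_induct)
  case (insert i I)
  then show ?case
    using tangent_spaceD(1)[OF assms(2), of "f i" "\<lambda>x. \<Sum>i\<in>I. f i x"]
      smooth_functions_sum[OF assms(1), of I f] by simp
qed (simp_all add: tangent_const[OF assms(2)])

text \<open>For a bump \<eta> with \<eta> = 1 at p and \<eta> = 0 off W, the products of \<eta> with
  f and with g coincide everywhere. The Leibniz rule at p and f p = g p then leave v f = v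
  g.\<close>

lemma tangent_local:
  fixes A :: "('a::{t2_space, second_countable_topology}, 'e::euclidean_space) atlas"
  assumes A: "smooth_atlas A" and v: "v \<in> tangent_space A p"
    and f: "f \<in> smooth_functions A" and g: "g \<in> smooth_functions A"
    and W: "open W" "p \<in> W" "\<And>x. x \<in> W \<Longrightarrow> f x = g x"
  shows "v f = v g"
proof -
  obtain U \<phi> where c: "(U, \<phi>) \<in> A" "p \<in> U" by (rule smooth_atlas_cover[OF A])
  have op: "open (\<phi> ` (U \<inter> W))" "\<phi> ` (U \<inter> W) \<subseteq> \<phi> ` U" "\<phi> p \<in> \<phi> ` (U \<inter> W)"
    using chart_open_image[OF A c(1) W(1)] c(2) W(2) by auto
  obtain \<theta> W' where "smooth_on UNIV \<theta>" "open W'" and \<theta>: "p \<in> W'" "W' \<subseteq> U \<inter> \<phi> -` (\<phi> ` (U \<inter> W))"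
    "\<And>x. x \<in> W' \<Longrightarrow> \<theta> (\<phi> x) = 1"
    and ext: "\<And>G. smooth_on (\<phi> ` (U \<inter> W)) G \<Longrightarrow>
      (\<lambda>x. if x \<in> U \<and> \<phi> x \<in> \<phi> ` (U \<inter> W) then \<theta> (\<phi> x) * G (\<phi> x) else 0) \<in> smooth_functions A"
    by (rule chart_local_extension[OF A c(1) op(1,2) c(2) op(3)]) blast
  define \<eta> where "\<eta> = (\<lambda>x. if x \<in> U \<and> \<phi> x \<in> \<phi> ` (U \<inter> W) then \<theta> (\<phi> x) * 1 else 0)"
  have \<eta>: "\<eta> \<in> smooth_functions A" unfolding \<eta>_def by (rule ext) simp
  have "\<eta> p = 1" using \<theta> c W by (auto simp: \<eta>_def)
  have "\<eta> x = 0" if "x \<notin> W" for x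
    using that smooth_atlas_chart(3)[OF A c(1)] by (auto simp: \<eta>_def inj_on_def)
  then have "(\<lambda>x. \<eta> x * f x) = (\<lambda>x. \<eta> x * g x)"
    using W(3) by (auto simp: fun_eq_iff)
  then have "\<eta> p * v f + f p * v \<eta> = \<eta> p * v g + g p * v \<eta>"
    using tangent_spaceD(3)[OF v \<eta>] f g by metis
  then show ?thesis using \<open>\<eta> p = 1\<close> W by simp
qed

text \<open>Near q, f is a constant plus the sum of (u_b - u_b(q)) H_b by Hadamard's lemma. The
  first factor vanishes at q, so the Leibniz rule leaves v(u_b) times H_b(q), a partial derivative
  of f. The functions u_b and the set W are chosen before q, so that one choice covers all points of
  W.\<close>

lemma tangent_coordinate_expansion:
  fixes A :: "('a::{t2_space, second_countable_topology}, 'e::euclidean_space) atlas"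
  assumes A: "smooth_atlas A" and c: "(U, \<phi>) \<in> A" and W: "open W" "W \<subseteq> U" "q \<in> W"
    and u: "\<And>b. b \<in> Basis \<Longrightarrow> u b \<in> smooth_functions A"
      "\<And>b x. b \<in> Basis \<Longrightarrow> x \<in> W \<Longrightarrow> u b x = \<phi> x \<bullet> b"
    and v: "v \<in> tangent_space A q" and f: "f \<in> smooth_functions A"
  shows "v f = (\<Sum>b\<in>Basis. v (u b) * frechet_derivative (f \<circ> inv_into U \<phi>) (at (\<phi> q)) b)"
proof -
  let ?F = "f \<circ> inv_into U \<phi>"
  note chart = smooth_atlas_chart[OF A c]
  have "\<phi> q \<in> \<phi> ` (U \<inter> W)" using W by auto
  then obtain r where r: "r > 0" "ball (\<phi> q) r \<subseteq> \<phi> ` (U \<inter> W)"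
    using chart_open_image[OF A c W(1)] open_contains_ball by blast
  let ?S = "ball (\<phi> q) r"
  have S: "?S \<subseteq> \<phi> ` U" "\<phi> q \<in> ?S" using r by auto
  have "smooth_on ?S ?F" using smooth_functionsD[OF f c] S(1) by (rule smooth_on_subset)
  then obtain G where G: "\<And>b. smooth_on ?S (G b)"
    "\<And>x. x \<in> ?S \<Longrightarrow> ?F x = ?F (\<phi> q) + (\<Sum>b\<in>Basis. ((x - \<phi> q) \<bullet> b) * G b x)"
    "\<And>b. G b (\<phi> q) = frechet_derivative ?F (at (\<phi> q)) b"
    using hadamard[of ?S "\<phi> q" ?F] r(1) by auto
  have "q \<in> U" using W by auto
  obtain \<theta> W' where "smooth_on UNIV \<theta>" and W': "open W'" "q \<in> W'" "W' \<subseteq> U \<inter> \<phi> -` ?S" "\<And>x. x \<in> W' \<Longrightarrow> \<theta> (\<phi> x) = 1"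
    and ext: "\<And>G. smooth_on ?S G \<Longrightarrow>
      (\<lambda>x. if x \<in> U \<and> \<phi> x \<in> ?S then \<theta> (\<phi> x) * G (\<phi> x) else 0) \<in> smooth_functions A"
    by (rule chart_local_extension[OF A c open_ball S(1) \<open>q \<in> U\<close> S(2)]) blast
  \<comment> \<open>The Hadamard coefficients are defined only on a ball in the chart; v can be
    applied to products with them only after the cut-off makes them global.\<close>
  define H where "H = (\<lambda>b x. if x \<in> U \<and> \<phi> x \<in> ?S then \<theta> (\<phi> x) * G b (\<phi> x) else 0)"
  have H: "H b \<in> smooth_functions A" for b unfolding H_def by (rule ext) (rule G(1))
  have H_eq: "H b x = G b (\<phi> x)" if "x \<in> W'" for b x
    using that W'(3,4) by (auto simp: H_def)
  have W'W: "x \<in> W" if "x \<in> W'" for x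
  proof -
    have "x \<in> U" "\<phi> x \<in> \<phi> ` (U \<inter> W)" using that W'(3) r(2) by auto
    then show ?thesis using chart(3) by (auto simp: inj_on_def)
  qed
  let ?d = "\<lambda>b x. u b x + - u b q"
  have d: "?d b \<in> smooth_functions A" if "b \<in> Basis" for b
    by (intro smooth_functions_add[OF A] u(1) that smooth_functions_const)
  have dH: "(\<lambda>x. ?d b x * H b x) \<in> smooth_functions A" if "b \<in> Basis" for b
    by (intro smooth_functions_mult[OF A] d that H)
  have "v f = v (\<lambda>x. f q + (\<Sum>b\<in>Basis. ?d b x * H b x))"
  proof (rule tangent_local[OF A v f _ W'(1,2)])
    show "(\<lambda>x. f q + (\<Sum>b\<in>Basis. ?d b x * H b x)) \<in> smooth_functions A"
      by (intro smooth_functions_add[OF A] smooth_functions_sum[OF A] dH smooth_functions_const)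
    show "f x = f q + (\<Sum>b\<in>Basis. ?d b x * H b x)" if x: "x \<in> W'" for x
    proof -
      have "x \<in> U" "\<phi> x \<in> ?S" using x W'(3) by auto
      then have "f x = f q + (\<Sum>b\<in>Basis. ((\<phi> x - \<phi> q) \<bullet> b) * G b (\<phi> x))"
        using G(2)[of "\<phi> x"] chart(3) \<open>q \<in> U\<close> by (simp add: inv_into_f_f)
      also have "(\<Sum>b\<in>Basis. ((\<phi> x - \<phi> q) \<bullet> b) * G b (\<phi> x)) = (\<Sum>b\<in>Basis. ?d b x * H b x)"
        using u(2) W'W[OF x] W(3) H_eq[OF x] by (intro sum.cong) (auto simp: inner_diff_left)
      finally show ?thesis .
    qed
  qed
  also have "\<dots> = v (\<lambda>x. \<Sum>b\<in>Basis. ?d b x * H b x)"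
    using tangent_spaceD(1)[OF v smooth_functions_const[of "f q"] smooth_functions_sum[OF A dH]]
    by (simp add: tangent_const[OF v])
  also have "\<dots> = (\<Sum>b\<in>Basis. v (\<lambda>x. ?d b x * H b x))"
    by (rule tangent_sum[OF A v dH])
  also have "\<dots> = (\<Sum>b\<in>Basis. v (u b) * frechet_derivative ?F (at (\<phi> q)) b)"
  proof (rule sum.cong)
    fix b :: 'e assume b: "b \<in> Basis"
    have "v (?d b) = v (u b)"
      using tangent_spaceD(1)[OF v u(1)[OF b] smooth_functions_const[of "- u b q"]]
      unfolding tangent_const[OF v] by simp
    then show "v (\<lambda>x. ?d b x * H b x) = v (u b) * frechet_derivative ?F (at (\<phi> q)) b"
      using tangent_spaceD(3)[OF v d[OF b] H[of b]] H_eq[OF W'(2)] G(3) by simp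
  qed simp
  finally show ?thesis .
qed

lemma local_coordinates:
  fixes A :: "('a::{t2_space, second_countable_topology}, 'e::euclidean_space) atlas"
  assumes "smooth_atlas A" "(U, \<phi>) \<in> A" "p \<in> U"
  obtains W u where "open W" "W \<subseteq> U" "p \<in> W" "\<And>b. u b \<in> smooth_functions A"
    "\<And>b x. x \<in> W \<Longrightarrow> u b x = \<phi> x \<bullet> b"
proof -
  note chart = smooth_atlas_chart[OF assms(1,2)]
  have p': "\<phi> p \<in> \<phi> ` U" using assms(3) by simp
  obtain \<theta> W where "smooth_on UNIV \<theta>" and W: "open W" "p \<in> W" "W \<subseteq> U \<inter> \<phi> -` (\<phi> ` U)" "\<And>x. x \<in> W \<Longrightarrow> \<theta> (\<phi> x) = 1"
    and ext: "\<And>G. smooth_on (\<phi> ` U) G \<Longrightarrow>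
      (\<lambda>x. if x \<in> U \<and> \<phi> x \<in> \<phi> ` U then \<theta> (\<phi> x) * G (\<phi> x) else 0) \<in> smooth_functions A"
    by (rule chart_local_extension[OF assms(1,2) chart(2) order_refl assms(3) p']) blast
  show ?thesis
  proof (rule that[of W "\<lambda>b x. if x \<in> U \<and> \<phi> x \<in> \<phi> ` U then \<theta> (\<phi> x) * (\<phi> x \<bullet> b) else 0"])
    show "(\<lambda>x. if x \<in> U \<and> \<phi> x \<in> \<phi> ` U then \<theta> (\<phi> x) * (\<phi> x \<bullet> b) else 0) \<in> smooth_functions A" for b
      by (intro ext smooth_on_bounded_linear bounded_linear_inner_left chart(2))
  qed (use W in auto)
qed

lemma smooth_function_chart_derivative:
  assumes "f \<in> smooth_functions A" "(U, \<phi>) \<in> A" "q \<in> U"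
  shows "((f \<circ> inv_into U \<phi>) has_derivative frechet_derivative (f \<circ> inv_into U \<phi>) (at (\<phi> q))) (at (\<phi> q))"
  using smooth_on_has_derivative[OF smooth_functionsD[OF assms(1,2)]] assms(3) by blast

text \<open>The fields \<open>E b\<close> are the coordinate fields times a cut-off, hence global.
  The expansion holds on a whole neighbourhood with the same \<open>u\<close> and \<open>E\<close>,
  which the smoothness of pullbacks requires; the duality arguments use it at the single point
  p.\<close>

lemma local_frame:
  fixes A :: "('a::{t2_space, second_countable_topology}, 'e::euclidean_space) atlas"
  assumes A: "smooth_atlas A"
  obtains W and u :: "'e \<Rightarrow> 'a \<Rightarrow> real" and E :: "'e \<Rightarrow> 'a vfield"
    where "open W" "p \<in> W" "\<And>b. u b \<in> smooth_functions A" "\<And>b. E b \<in> vector_fields A"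
      "\<And>q v f. q \<in> W \<Longrightarrow> v \<in> tangent_space A q \<Longrightarrow> v f = (\<Sum>b\<in>Basis. v (u b) * E b q f)"
proof -
  obtain U \<phi> where c: "(U, \<phi>) \<in> A" "p \<in> U" by (rule smooth_atlas_cover[OF A])
  note chart = smooth_atlas_chart[OF A c(1)]
  obtain W u where W: "open W" "W \<subseteq> U" "p \<in> W"
    and u: "\<And>b. u b \<in> smooth_functions A" "\<And>b x. x \<in> W \<Longrightarrow> u b x = \<phi> x \<bullet> b"
    by (rule local_coordinates[OF A c]) (use that in metis)
  have p': "\<phi> p \<in> \<phi> ` U" using c by simp
  obtain \<theta> W' where "smooth_on UNIV \<theta>" and W': "open W'" "p \<in> W'" "W' \<subseteq> U \<inter> \<phi> -` (\<phi> ` U)" "\<And>x. x \<in> W' \<Longrightarrow> \<theta> (\<phi> x) = 1"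
    and ext: "\<And>G. smooth_on (\<phi> ` U) G \<Longrightarrow>
      (\<lambda>x. if x \<in> U \<and> \<phi> x \<in> \<phi> ` U then \<theta> (\<phi> x) * G (\<phi> x) else 0) \<in> smooth_functions A"
    by (rule chart_local_extension[OF A c(1) chart(2) order_refl c(2) p']) blast
  let ?d = "\<lambda>f q. frechet_derivative (f \<circ> inv_into U \<phi>) (at (\<phi> q))"
  \<comment> \<open>The two zero cases: on nonsmooth f it is the convention for tangent vectors,
    outside U it continues the cut-off field.\<close>
  define E where "E = (\<lambda>b q f. if f \<in> smooth_functions A \<and> q \<in> U then \<theta> (\<phi> q) * ?d f q b else 0)"
  have d_add: "?d (\<lambda>x. f x + g x) q b = ?d f q b + ?d g q b"
    if "f \<in> smooth_functions A" "g \<in> smooth_functions A" "q \<in> U" for f g q b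
    using frechet_derivative_at[OF has_derivative_add[OF smooth_function_chart_derivative[OF that(1) c(1) that(3)]
        smooth_function_chart_derivative[OF that(2) c(1) that(3)]]]
    by (simp add: o_def fun_eq_iff)
  have d_mult: "?d (\<lambda>x. f x * g x) q b = f q * ?d g q b + g q * ?d f q b"
    if "f \<in> smooth_functions A" "g \<in> smooth_functions A" "q \<in> U" for f g q b
    using frechet_derivative_at[OF has_derivative_mult[OF smooth_function_chart_derivative[OF that(1) c(1) that(3)]
        smooth_function_chart_derivative[OF that(2) c(1) that(3)]]] chart(3) that(3)
    by (simp add: o_def fun_eq_iff inv_into_f_f mult.commute[of "g q"])
  have E_tangent: "E b q \<in> tangent_space A q" for b q
    unfolding tangent_space_def linear_functional_def
  proof (intro CollectI conjI ballI allI impI)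
    fix f g assume fg: "f \<in> smooth_functions A" "g \<in> smooth_functions A"
    show "E b q (\<lambda>x. f x + g x) = E b q f + E b q g"
      using fg smooth_functions_add[OF A fg] d_add[OF fg] by (simp add: E_def distrib_left)
    show "E b q (\<lambda>x. f x * g x) = f q * E b q g + g q * E b q f"
      using fg smooth_functions_mult[OF A fg] d_mult[OF fg] by (simp add: E_def algebra_simps)
  next
    fix k f assume f: "f \<in> smooth_functions A"
    have "(\<lambda>x. k * f x) \<in> smooth_functions A"
      by (intro smooth_functions_mult[OF A] smooth_functions_const f)
    moreover have "?d (\<lambda>x. k) q b = 0" by (simp add: o_def)
    ultimately show "E b q (\<lambda>x. k * f x) = k * E b q f"
      using f d_mult[OF smooth_functions_const f, of q k b] by (simp add: E_def)
  qed (simp add: E_def)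
  have E_smooth: "(\<lambda>q. E b q f) \<in> smooth_functions A" if f: "f \<in> smooth_functions A" for b f
  proof -
    have "(\<lambda>q. E b q f) = (\<lambda>x. if x \<in> U \<and> \<phi> x \<in> \<phi> ` U then \<theta> (\<phi> x) * ?d f x b else 0)"
      using f by (auto simp: E_def fun_eq_iff)
    then show ?thesis
      using ext[OF smooth_on_frechet_derivative[OF smooth_functionsD[OF f c(1)]], of b] by simp
  qed
  show ?thesis
  proof
    show "open (W \<inter> W')" "p \<in> W \<inter> W'" using W W' by auto
    show "u b \<in> smooth_functions A" for b by (rule u)
    show "E b \<in> vector_fields A" for b
      using E_tangent E_smooth by (auto simp: vector_fields_def)
    show "v f = (\<Sum>b\<in>Basis. v (u b) * E b q f)"
      if q: "q \<in> W \<inter> W'" and v: "v \<in> tangent_space A q" for q v f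
    proof (cases "f \<in> smooth_functions A")
      case True
      then show ?thesis
        using tangent_coordinate_expansion[OF A c(1) W(1,2) _ u v True] q W(2) W'(4)
        by (auto simp: E_def)
    next
      case False
      then show ?thesis using tangent_spaceD(4)[OF v False] by (simp add: E_def)
    qed
  qed
qed

subsection \<open>Covectors and vector fields\<close>

lemma tangent_zero: "(\<lambda>f. 0) \<in> tangent_space A p"
  by (simp add: tangent_space_def linear_functional_def)

lemma tangent_add:
  "v \<in> tangent_space A p \<Longrightarrow> w \<in> tangent_space A p \<Longrightarrow> (\<lambda>f. v f + w f) \<in> tangent_space A p"
  by (simp add: tangent_space_def linear_functional_def algebra_simps)

lemma tangent_scale: "v \<in> tangent_space A p \<Longrightarrow> (\<lambda>f. c * v f) \<in> tangent_space A p"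
  by (simp add: tangent_space_def linear_functional_def algebra_simps)

lemma tangent_linear_combination:
  "(\<And>i. i \<in> I \<Longrightarrow> w i \<in> tangent_space A p) \<Longrightarrow> (\<lambda>f. \<Sum>i\<in>I. c i * w i f) \<in> tangent_space A p"
  by (induction I rule: infinite_finite_induct) (simp_all add: tangent_zero tangent_add tangent_scale)

lemma linear_functional_tangent_zero:
  assumes "linear_functional (tangent_space A p) L"
  shows "L (\<lambda>f. 0) = 0"
  using linear_functionalD(2)[OF assms tangent_zero, of 0] by simp

lemma linear_functional_tangent_combination:
  assumes "linear_functional (tangent_space A p) L" "\<And>i. i \<in> I \<Longrightarrow> w i \<in> tangent_space A p"
  shows "L (\<lambda>f. \<Sum>i\<in>I. c i * w i f) = (\<Sum>i\<in>I. c i * L (w i))"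
  using assms(2)
proof (induction I rule: infinite_finite_induct)
  case (insert i I)
  then have *: "w i \<in> tangent_space A p" "\<And>j. j \<in> I \<Longrightarrow> w j \<in> tangent_space A p" by auto
  have "L (\<lambda>f. c i * w i f + (\<Sum>i\<in>I. c i * w i f)) =
      L (\<lambda>f. c i * w i f) + L (\<lambda>f. \<Sum>i\<in>I. c i * w i f)"
    by (rule linear_functionalD(1)[OF assms(1) tangent_scale[OF *(1)] tangent_linear_combination[OF *(2)]])
  then show ?case
    using insert * linear_functionalD(2)[OF assms(1) *(1)] by simp
qed (simp_all add: linear_functional_tangent_zero[OF assms(1)])

lemma cotangent_spaceD:
  assumes "\<omega> \<in> cotangent_space A p"
  shows "linear_functional (tangent_space A p) \<omega>" "v \<notin> tangent_space A p \<Longrightarrow> \<omega> v = 0"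
  using assms by (auto simp: cotangent_space_def)

lemma cotangent_add:
  "\<omega> \<in> cotangent_space A p \<Longrightarrow> \<eta> \<in> cotangent_space A p \<Longrightarrow> (\<lambda>v. \<omega> v + \<eta> v) \<in> cotangent_space A p"
  by (simp add: cotangent_space_def linear_functional_def algebra_simps)

lemma cotangent_scale: "\<omega> \<in> cotangent_space A p \<Longrightarrow> (\<lambda>v. c * \<omega> v) \<in> cotangent_space A p"
  by (simp add: cotangent_space_def linear_functional_def algebra_simps)

lemma cotangent_diff:
  "\<omega> \<in> cotangent_space A p \<Longrightarrow> \<eta> \<in> cotangent_space A p \<Longrightarrow> (\<lambda>v. \<omega> v - \<eta> v) \<in> cotangent_space A p"
  by (simp add: cotangent_space_def linear_functional_def algebra_simps)

lemma differential_eq: "v \<in> tangent_space A p \<Longrightarrow> differential A f p v = v f"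
  by (simp add: differential_def)

lemma differential_cotangent:
  "f \<in> smooth_functions A \<Longrightarrow> differential A f p \<in> cotangent_space A p"
  by (simp add: cotangent_space_def linear_functional_def differential_def tangent_add tangent_scale)

lemma one_forms_cotangent: "\<alpha> \<in> one_forms A \<Longrightarrow> \<alpha> p \<in> cotangent_space A p"
  by (simp add: one_forms_def)

lemma vector_fields_tangent: "X \<in> vector_fields A \<Longrightarrow> X p \<in> tangent_space A p"
  by (simp add: vector_fields_def)

lemma vector_fields_smooth:
  "X \<in> vector_fields A \<Longrightarrow> f \<in> smooth_functions A \<Longrightarrow> (\<lambda>p. X p f) \<in> smooth_functions A"
  by (simp add: vector_fields_def)

lemma one_forms_smooth:
  "\<alpha> \<in> one_forms A \<Longrightarrow> X \<in> vector_fields A \<Longrightarrow> (\<lambda>p. \<alpha> p (X p)) \<in> smooth_functions A"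
  by (simp add: one_forms_def)

lemma differential_one_form:
  assumes "f \<in> smooth_functions A"
  shows "differential A f \<in> one_forms A"
  using assms
  by (simp add: one_forms_def differential_cotangent differential_eq vector_fields_tangent vector_fields_smooth)

lemma differential_add:
  "f \<in> smooth_functions A \<Longrightarrow> g \<in> smooth_functions A \<Longrightarrow>
    differential A (\<lambda>x. f x + g x) p = (\<lambda>v. differential A f p v + differential A g p v)"
  by (auto simp: differential_def fun_eq_iff tangent_spaceD(1))

lemma differential_mult:
  "f \<in> smooth_functions A \<Longrightarrow> g \<in> smooth_functions A \<Longrightarrow>
    differential A (\<lambda>x. f x * g x) p = (\<lambda>v. f p * differential A g p v + g p * differential A f p v)"
  by (auto simp: differential_def fun_eq_iff tangent_spaceD(3))

lemma differential_const_mult: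
  "f \<in> smooth_functions A \<Longrightarrow> differential A (\<lambda>x. c * f x) p = (\<lambda>v. c * differential A f p v)"
  by (auto simp: differential_def fun_eq_iff tangent_spaceD(2))

text \<open>Since tangent vectors vanish on nonsmooth functions, the frame expansion is an equality
  of HOL functions and can be put under any functional that is linear on the tangent space.\<close>

lemma tangent_eq_frame:
  assumes "\<And>f. v f = (\<Sum>b\<in>Basis. v (u b) * E b q f)" "\<And>b. E b \<in> vector_fields A"
    and "linear_functional (tangent_space A q) L"
  shows "L v = (\<Sum>b\<in>Basis. v (u b) * L (E b q))"
proof -
  have "v = (\<lambda>f. \<Sum>b\<in>Basis. v (u b) * E b q f)" by (rule ext) (rule assms(1))
  then have "L v = L (\<lambda>f. \<Sum>b\<in>Basis. v (u b) * E b q f)" by (rule arg_cong)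
  also have "\<dots> = (\<Sum>b\<in>Basis. v (u b) * L (E b q))"
    by (rule linear_functional_tangent_combination[OF assms(3) vector_fields_tangent[OF assms(2)]])
  finally show ?thesis .
qed

text \<open>At p, \<omega> is the combination of the du_b with the constants \<omega>(E_b) as
  coefficients. Thus each covector is the value of a global 1-form, and a pairing with all covectors
  is the same as the action on all smooth functions.\<close>

lemma cotangent_eq_differential:
  fixes A :: "('a::{t2_space, second_countable_topology}, 'e::euclidean_space) atlas"
  assumes A: "smooth_atlas A" and \<omega>: "\<omega> \<in> cotangent_space A p"
  obtains f where "f \<in> smooth_functions A" "\<omega> = differential A f p"
proof -
  obtain W u and E :: "'e \<Rightarrow> 'a vfield" where "open W" and F: "p \<in> W" "\<And>b. u b \<in> smooth_functions A"
    "\<And>b. E b \<in> vector_fields A"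
    "\<And>q v f. q \<in> W \<Longrightarrow> v \<in> tangent_space A q \<Longrightarrow> v f = (\<Sum>b\<in>Basis. v (u b) * E b q f)"
    by (rule local_frame[OF A, of p]) blast
  define f where "f = (\<lambda>x. \<Sum>b\<in>Basis. \<omega> (E b p) * u b x)"
  have tm: "(\<lambda>x. \<omega> (E b p) * u b x) \<in> smooth_functions A" for b
    by (intro smooth_functions_mult[OF A] smooth_functions_const F(2))
  show ?thesis
  proof
    show "f \<in> smooth_functions A" unfolding f_def by (rule smooth_functions_sum[OF A tm])
    show "\<omega> = differential A f p"
    proof
      fix v
      show "\<omega> v = differential A f p v"
      proof (cases "v \<in> tangent_space A p")
        case True
        have "\<omega> v = (\<Sum>b\<in>Basis. v (u b) * \<omega> (E b p))"
          by (rule tangent_eq_frame[OF F(4)[OF F(1) True] F(3) cotangent_spaceD(1)[OF \<omega>]])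
        also have "\<dots> = (\<Sum>b\<in>Basis. v (\<lambda>x. \<omega> (E b p) * u b x))"
          by (intro sum.cong) (simp_all add: tangent_spaceD(2)[OF True F(2)])
        also have "\<dots> = v f" unfolding f_def by (rule tangent_sum[OF A True tm, symmetric])
        finally show ?thesis using True by (simp add: differential_eq)
      qed (simp add: differential_def cotangent_spaceD(2)[OF \<omega>])
    qed
  qed
qed

lemma tangent_eqI:
  assumes "v \<in> tangent_space A p" "w \<in> tangent_space A p"
    and "\<And>f. f \<in> smooth_functions A \<Longrightarrow> v f = w f"
  shows "v = w"
proof
  show "v f = w f" for f
    using assms(3) tangent_spaceD(4)[OF assms(1)] tangent_spaceD(4)[OF assms(2)]
    by (cases "f \<in> smooth_functions A") auto
qed

lemma bilinear_formD:
  assumes "bilinear_form V B" "u \<in> V"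
  shows "linear_functional V (B u)" "linear_functional V (\<lambda>v. B v u)"
  using assms by (auto simp: bilinear_form_def)

lemma smooth_cotensor2_bilinear:
  "smooth_cotensor2 A B \<Longrightarrow> bilinear_form (cotangent_space A p) (B p)"
  by (simp add: smooth_cotensor2_def)

lemma smooth_cotensor2_smooth:
  "smooth_cotensor2 A B \<Longrightarrow> \<alpha> \<in> one_forms A \<Longrightarrow> \<beta> \<in> one_forms A \<Longrightarrow> on_forms B \<alpha> \<beta> \<in> smooth_functions A"
  by (simp add: smooth_cotensor2_def)

text \<open>Besides the anchor map of a bivector field, the next lemmas also cover the vector field
  dual to a 1-form with respect to a cometric, which is the anchor of the cometric.\<close>

lemma anchor_properties:
  fixes A :: "('a::{t2_space, second_countable_topology}, 'e::euclidean_space) atlas"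
  assumes A: "smooth_atlas A" and B: "bilinear_form (cotangent_space A p) (B p)"
    and \<alpha>: "\<alpha> p \<in> cotangent_space A p"
  shows anchor_tangent: "anchor A B \<alpha> p \<in> tangent_space A p"
    and anchor_pairing: "\<beta> \<in> cotangent_space A p \<Longrightarrow> \<beta> (anchor A B \<alpha> p) = B p (\<alpha> p) \<beta>"
proof -
  note lin = bilinear_formD(1)[OF B \<alpha>]
  \<comment> \<open>The double dual of the tangent space is the tangent space: this functional on
    functions is a derivation because d satisfies the Leibniz rule.\<close>
  define v where "v = (\<lambda>f. if f \<in> smooth_functions A then B p (\<alpha> p) (differential A f p) else 0)"
  have v: "v \<in> tangent_space A p"
    unfolding tangent_space_def linear_functional_def
  proof (intro CollectI conjI ballI allI impI)
    fix f g assume fg: "f \<in> smooth_functions A" "g \<in> smooth_functions A"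
    show "v (\<lambda>x. f x + g x) = v f + v g"
      using fg smooth_functions_add[OF A fg] linear_functionalD(1)[OF lin fg[THEN differential_cotangent]]
      by (simp add: v_def differential_add)
    have "B p (\<alpha> p) (\<lambda>v. f p * differential A g p v + g p * differential A f p v) =
        f p * B p (\<alpha> p) (differential A g p) + g p * B p (\<alpha> p) (differential A f p)"
      using fg by (simp add: linear_functionalD[OF lin] cotangent_scale differential_cotangent)
    then show "v (\<lambda>x. f x * g x) = f p * v g + g p * v f"
      using fg smooth_functions_mult[OF A fg] by (simp add: v_def differential_mult)
  next
    fix c f assume f: "f \<in> smooth_functions A"
    have "(\<lambda>x. c * f x) \<in> smooth_functions A"
      by (intro smooth_functions_mult[OF A] smooth_functions_const f)
    then show "v (\<lambda>x. c * f x) = c * v f"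
      using f linear_functionalD(2)[OF lin differential_cotangent[OF f]]
      by (simp add: v_def differential_const_mult)
  qed (simp add: v_def)
  \<comment> \<open>By definition v pairs correctly with differentials, and these exhaust the
    covectors at p.\<close>
  have pair: "\<beta> v = B p (\<alpha> p) \<beta>" if b: "\<beta> \<in> cotangent_space A p" for \<beta>
  proof -
    obtain f where f: "f \<in> smooth_functions A" "\<beta> = differential A f p"
      using cotangent_eq_differential[OF A b] by blast
    then show ?thesis using v by (simp add: differential_eq v_def)
  qed
  have uniq: "w = v" if w: "w \<in> tangent_space A p" "\<forall>\<beta>\<in>cotangent_space A p. \<beta> w = B p (\<alpha> p) \<beta>" for w
  proof (rule tangent_eqI[OF w(1) v])
    fix f assume f: "f \<in> smooth_functions A"
    have "w f = differential A f p w" by (simp add: differential_eq[OF w(1)])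
    also have "\<dots> = B p (\<alpha> p) (differential A f p)"
      using w(2) differential_cotangent[OF f] by blast
    also have "\<dots> = v f" using f by (simp add: v_def)
    finally show "w f = v f" .
  qed
  have "anchor A B \<alpha> p = v"
    unfolding anchor_def
    by (rule the_equality) (intro conjI ballI v pair, assumption, elim conjE, rule uniq)
  then show "anchor A B \<alpha> p \<in> tangent_space A p"
    and "\<beta> \<in> cotangent_space A p \<Longrightarrow> \<beta> (anchor A B \<alpha> p) = B p (\<alpha> p) \<beta>"
    using v pair by auto
qed

lemma anchor_apply:
  assumes "smooth_atlas A" "smooth_cotensor2 A B" "\<alpha> \<in> one_forms A" "f \<in> smooth_functions A"
  shows "anchor A B \<alpha> p f = B p (\<alpha> p) (differential A f p)"
  using anchor_properties[where B = B and \<alpha> = \<alpha> and p = p, OF assms(1)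
      smooth_cotensor2_bilinear[OF assms(2)] one_forms_cotangent[OF assms(3)]]
    differential_cotangent[OF assms(4)] differential_eq by metis

lemma anchor_on_form:
  assumes "smooth_atlas A" "smooth_cotensor2 A B" "\<alpha> \<in> one_forms A" "\<beta> \<in> one_forms A"
  shows "\<beta> p (anchor A B \<alpha> p) = on_forms B \<alpha> \<beta> p"
  using anchor_pairing[where B = B and \<alpha> = \<alpha> and p = p, OF assms(1) smooth_cotensor2_bilinear[OF assms(2)] one_forms_cotangent[OF assms(3)]
      one_forms_cotangent[OF assms(4)]]
  by (simp add: on_forms_def)

lemma anchor_vector_field:
  assumes A: "smooth_atlas A" and B: "smooth_cotensor2 A B" and \<alpha>: "\<alpha> \<in> one_forms A"
  shows "anchor A B \<alpha> \<in> vector_fields A"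
  unfolding vector_fields_def
proof (intro CollectI conjI allI ballI)
  show "anchor A B \<alpha> p \<in> tangent_space A p" for p
    by (rule anchor_tangent[where B = B and \<alpha> = \<alpha>, OF A smooth_cotensor2_bilinear[OF B] one_forms_cotangent[OF \<alpha>]])
  fix f assume f: "f \<in> smooth_functions A"
  have "(\<lambda>p. anchor A B \<alpha> p f) = on_forms B \<alpha> (differential A f)"
    by (simp add: fun_eq_iff on_forms_def anchor_apply[OF A B \<alpha> f])
  then show "(\<lambda>p. anchor A B \<alpha> p f) \<in> smooth_functions A"
    using smooth_cotensor2_smooth[OF B \<alpha> differential_one_form[OF f]] by simp
qed

lemma lie_bracket_tangent:
  assumes A: "smooth_atlas A" and X: "X \<in> vector_fields A" and Y: "Y \<in> vector_fields A"
  shows "lie_bracket X Y p \<in> tangent_space A p"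
  unfolding tangent_space_def linear_functional_def
proof (intro CollectI conjI ballI allI impI)
  note t = tangent_spaceD[OF vector_fields_tangent[OF X]] tangent_spaceD[OF vector_fields_tangent[OF Y]]
  note sm = vector_fields_smooth[OF X] vector_fields_smooth[OF Y]
  fix f g assume fg: "f \<in> smooth_functions A" "g \<in> smooth_functions A"
  show "lie_bracket X Y p (\<lambda>x. f x + g x) = lie_bracket X Y p f + lie_bracket X Y p g"
    using fg by (simp add: lie_bracket_def t(1,5) sm)
  have "(\<lambda>x. f x * Y x g) \<in> smooth_functions A" "(\<lambda>x. g x * Y x f) \<in> smooth_functions A"
    "(\<lambda>x. f x * X x g) \<in> smooth_functions A" "(\<lambda>x. g x * X x f) \<in> smooth_functions A"
    using fg by (auto intro!: smooth_functions_mult[OF A] sm)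
  then show "lie_bracket X Y p (\<lambda>x. f x * g x) = f p * lie_bracket X Y p g + g p * lie_bracket X Y p f"
    using fg by (simp add: lie_bracket_def t(1,3,5,7) sm algebra_simps)
next
  note t = tangent_spaceD[OF vector_fields_tangent[OF X]] tangent_spaceD[OF vector_fields_tangent[OF Y]]
  note sm = vector_fields_smooth[OF X] vector_fields_smooth[OF Y]
  fix c f assume f: "f \<in> smooth_functions A"
  show "lie_bracket X Y p (\<lambda>x. c * f x) = c * lie_bracket X Y p f"
    using f by (simp add: lie_bracket_def t(2,6) sm algebra_simps)
next
  fix f assume "f \<notin> smooth_functions A"
  \<comment> \<open>On a nonsmooth f both inner functions are identically 0, and a tangent vector
    kills constants.\<close>
  then show "lie_bracket X Y p f = 0"
    by (simp add: lie_bracket_def tangent_spaceD(4)[OF vector_fields_tangent[OF X]]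
        tangent_spaceD(4)[OF vector_fields_tangent[OF Y]]
        tangent_const[OF vector_fields_tangent[OF X]] tangent_const[OF vector_fields_tangent[OF Y]])
qed

subsection \<open>Cometrics\<close>

lemma pseudo_riemannian_metricD:
  assumes "pseudo_riemannian_metric A h"
  shows "bilinear_form (tangent_space A p) (h p)"
    and "v \<in> tangent_space A p \<Longrightarrow> w \<in> tangent_space A p \<Longrightarrow> h p v w = h p w v"
    and "v \<in> tangent_space A p \<Longrightarrow> (\<And>w. w \<in> tangent_space A p \<Longrightarrow> h p v w = 0) \<Longrightarrow> v = (\<lambda>f. 0)"
  using assms unfolding pseudo_riemannian_metric_def by blast+

text \<open>Linear algebra in the space of frame coefficients. \<open>V\<close> maps coefficients
  onto the tangent space, \<open>M\<close> is the Gram map of h, and \<open>w0\<close> represents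
  \<omega>; what is wanted is a solution of M c = w0. Symmetry of h makes the orthogonal complement
  of the range of M consist of coefficients of vectors in the radical, which is trivial.\<close>

lemma metric_dual_exists:
  fixes A :: "('a::{t2_space, second_countable_topology}, 'e::euclidean_space) atlas"
  assumes A: "smooth_atlas A" and h: "pseudo_riemannian_metric A h" and \<omega>: "\<omega> \<in> cotangent_space A p"
  obtains v where "v \<in> tangent_space A p" "\<And>w. w \<in> tangent_space A p \<Longrightarrow> h p v w = \<omega> w"
proof -
  obtain W u and E :: "'e \<Rightarrow> 'a vfield" where "open W" and F: "p \<in> W" and "\<And>b. u b \<in> smooth_functions A"
    and F': "\<And>b. E b \<in> vector_fields A"
    "\<And>q v f. q \<in> W \<Longrightarrow> v \<in> tangent_space A q \<Longrightarrow> v f = (\<Sum>b\<in>Basis. v (u b) * E b q f)"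
    by (rule local_frame[OF A, of p]) blast
  note E = vector_fields_tangent[OF F'(1), of _ p]
  define V where "V = (\<lambda>c::'e. \<lambda>f. \<Sum>b\<in>Basis. (c \<bullet> b) * E b p f)"
  have V: "V c \<in> tangent_space A p" for c
    unfolding V_def by (rule tangent_linear_combination[OF E])
  have V_lin: "L (V c) = (\<Sum>b\<in>Basis. (c \<bullet> b) * L (E b p))"
    if "linear_functional (tangent_space A p) L" for L c
    unfolding V_def by (rule linear_functional_tangent_combination[OF that E])
  have V_surj: "\<exists>c. w = V c" if w: "w \<in> tangent_space A p" for w
  proof
    show "w = V (\<Sum>b\<in>Basis. w (u b) *\<^sub>R b)"
    proof
      show "w f = V (\<Sum>b\<in>Basis. w (u b) *\<^sub>R b) f" for f
        using F'(2)[OF F(1) w, of f] by (simp add: V_def)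
    qed
  qed
  note hlin = bilinear_formD[OF pseudo_riemannian_metricD(1)[OF h] V]
  define M where "M = (\<lambda>c. \<Sum>b\<in>Basis. h p (V c) (E b p) *\<^sub>R b)"
  have M: "h p (V c) (V d) = M c \<bullet> d" for c d
    by (simp add: V_lin[OF hlin(1)] M_def inner_sum_left inner_commute[of d] mult.commute)
  have M': "h p (V c) (E b p) = (\<Sum>i\<in>Basis. (c \<bullet> i) * h p (E i p) (E b p))" for b c
    by (rule V_lin[OF bilinear_formD(2)[OF pseudo_riemannian_metricD(1)[OF h] E]])
  have linM: "linear M"
    unfolding M_def M'
    by (intro linear_compose_sum ballI linearI)
      (simp_all add: inner_add_left distrib_right scaleR_add_left sum.distrib sum_distrib_left mult.assoc)
  define w0 where "w0 = (\<Sum>b\<in>Basis. \<omega> (E b p) *\<^sub>R b)"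
  have w0: "\<omega> (V d) = w0 \<bullet> d" for d
    by (simp add: V_lin[OF cotangent_spaceD(1)[OF \<omega>]] w0_def inner_sum_left inner_commute[of d] mult.commute)
  \<comment> \<open>z is the part of w0 that M cannot reach; the rest of the argument shows z =
    0.\<close>
  obtain y z where yz: "y \<in> span (range M)" "\<And>w. w \<in> span (range M) \<Longrightarrow> orthogonal z w" "w0 = y + z"
    using orthogonal_subspace_decomp_exists[of "range M" w0] by metis
  have span: "span (range M) = range M"
    using linM by (simp add: linear_subspace_image)
  have "V z = (\<lambda>f. 0)"
  proof (rule pseudo_riemannian_metricD(3)[OF h V])
    fix w assume w: "w \<in> tangent_space A p"
    then obtain c where c: "w = V c" using V_surj by blast
    have "h p (V z) w = h p w (V z)"
      by (rule pseudo_riemannian_metricD(2)[OF h V w])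
    also have "\<dots> = M c \<bullet> z" unfolding c by (rule M)
    also have "\<dots> = 0" using yz(2)[of "M c"] span by (simp add: orthogonal_def inner_commute)
    finally show "h p (V z) w = 0" .
  qed
  \<comment> \<open>The product of w0 and z is \<omega>(V z), and V z = 0.\<close>
  then have "w0 \<bullet> z = 0"
    using w0[of z] linear_functional_tangent_zero[OF cotangent_spaceD(1)[OF \<omega>]] by simp
  moreover have "y \<bullet> z = 0"
    using yz(1,2) by (simp add: orthogonal_def inner_commute)
  ultimately have "z = 0" using yz(3) by (simp add: inner_add_left)
  then obtain c where c: "w0 = M c" using yz(1,3) span by auto
  show ?thesis
  proof
    show "V c \<in> tangent_space A p" by (rule V)
    show "h p (V c) w = \<omega> w" if "w \<in> tangent_space A p" for w
      using V_surj[OF that] M w0 c by auto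
  qed
qed

lemma metric_dual_properties:
  fixes A :: "('a::{t2_space, second_countable_topology}, 'e::euclidean_space) atlas"
  assumes A: "smooth_atlas A" and h: "pseudo_riemannian_metric A h" and \<omega>: "\<omega> \<in> cotangent_space A p"
  shows metric_dual_tangent: "metric_dual A h p \<omega> \<in> tangent_space A p"
    and metric_dual_pairing: "w \<in> tangent_space A p \<Longrightarrow> h p (metric_dual A h p \<omega>) w = \<omega> w"
    and metric_dual_unique: "v \<in> tangent_space A p \<Longrightarrow>
      (\<And>w. w \<in> tangent_space A p \<Longrightarrow> h p v w = \<omega> w) \<Longrightarrow> metric_dual A h p \<omega> = v"
proof -
  have uniq: "v = v'" if "v \<in> tangent_space A p" "v' \<in> tangent_space A p"
    "\<And>w. w \<in> tangent_space A p \<Longrightarrow> h p v w = h p v' w" for v v'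
  proof -
    have m: "(\<lambda>f. - 1 * v' f) \<in> tangent_space A p" by (rule tangent_scale[OF that(2)])
    have "(\<lambda>f. v f + - 1 * v' f) = (\<lambda>f. 0)"
    proof (rule pseudo_riemannian_metricD(3)[OF h tangent_add[OF that(1) m]])
      fix w assume w: "w \<in> tangent_space A p"
      note lin = linear_functionalD[OF bilinear_formD(2)[OF pseudo_riemannian_metricD(1)[OF h] w]]
      show "h p (\<lambda>f. v f + - 1 * v' f) w = 0"
        unfolding lin(1)[OF that(1) m] lin(2)[OF that(2)] using that(3)[OF w] by simp
    qed
    then show ?thesis by (simp add: fun_eq_iff)
  qed
  obtain v where v: "v \<in> tangent_space A p" "\<And>w. w \<in> tangent_space A p \<Longrightarrow> h p v w = \<omega> w"
    using metric_dual_exists[OF A h \<omega>] by metis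
  have eq: "metric_dual A h p \<omega> = v'" if v': "v' \<in> tangent_space A p"
    "\<And>w. w \<in> tangent_space A p \<Longrightarrow> h p v' w = \<omega> w" for v'
    unfolding metric_dual_def
  proof (rule the_equality)
    show "v = v'" if "v \<in> tangent_space A p \<and> (\<forall>w\<in>tangent_space A p. h p v w = \<omega> w)" for v
      using uniq[of v v'] that v' by simp
  qed (use v' in blast)
  show "metric_dual A h p \<omega> \<in> tangent_space A p"
    and "w \<in> tangent_space A p \<Longrightarrow> h p (metric_dual A h p \<omega>) w = \<omega> w"
    using v eq[OF v] by auto
  show "v \<in> tangent_space A p \<Longrightarrow>
      (\<And>w. w \<in> tangent_space A p \<Longrightarrow> h p v w = \<omega> w) \<Longrightarrow> metric_dual A h p \<omega> = v" for v
    by (rule eq)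
qed

lemma cometric_eq:
  assumes "smooth_atlas A" "pseudo_riemannian_metric A h"
    and "\<alpha> \<in> cotangent_space A p" "\<beta> \<in> cotangent_space A p"
  shows "cometric A h p \<alpha> \<beta> = \<alpha> (metric_dual A h p \<beta>)" "cometric A h p \<alpha> \<beta> = cometric A h p \<beta> \<alpha>"
  unfolding cometric_def
  by (rule metric_dual_pairing[OF assms(1-3)] pseudo_riemannian_metricD(2)[OF assms(2)]
      metric_dual_tangent[OF assms(1-3)] metric_dual_tangent[OF assms(1,2,4)])+

lemma cometric_bilinear:
  assumes "smooth_atlas A" "pseudo_riemannian_metric A h"
  shows "bilinear_form (cotangent_space A p) (cometric A h p)"
proof -
  have lin: "linear_functional (cotangent_space A p) (\<lambda>\<beta>. cometric A h p \<beta> \<alpha>)"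
    if "\<alpha> \<in> cotangent_space A p" for \<alpha>
    using that
    by (simp add: linear_functional_def cometric_eq(1)[OF assms] cotangent_add cotangent_scale)
  moreover have "linear_functional (cotangent_space A p) (cometric A h p \<alpha>)"
    if \<alpha>: "\<alpha> \<in> cotangent_space A p" for \<alpha>
    using lin[OF that] unfolding linear_functional_def
    by (auto simp: cometric_eq(2)[OF assms \<alpha>] cotangent_add cotangent_scale)
  ultimately show ?thesis by (simp add: bilinear_form_def)
qed

lemma metric_flat:
  fixes A :: "('a::{t2_space, second_countable_topology}, 'e::euclidean_space) atlas"
  assumes A: "smooth_atlas A" and h: "pseudo_riemannian_metric A h" and w: "w \<in> tangent_space A p"
  obtains \<beta> where "\<beta> \<in> cotangent_space A p" "metric_dual A h p \<beta> = w"
    "\<And>v. v \<in> tangent_space A p \<Longrightarrow> \<beta> v = h p w v"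
proof -
  define \<beta> where "\<beta> = (\<lambda>v. if v \<in> tangent_space A p then h p w v else 0)"
  have \<beta>: "\<beta> \<in> cotangent_space A p"
    using bilinear_formD(1)[OF pseudo_riemannian_metricD(1)[OF h] w]
    by (simp add: cotangent_space_def linear_functional_def \<beta>_def tangent_add tangent_scale)
  show ?thesis
  proof
    show "metric_dual A h p \<beta> = w"
      by (rule metric_dual_unique[OF A h \<beta> w]) (simp add: \<beta>_def)
  qed (use \<beta> in \<open>auto simp: \<beta>_def\<close>)
qed

text \<open>Each tangent vector w is the dual of some covector \<beta>, and then \<alpha>(w) is the
  cometric of \<alpha> and \<beta>.\<close>

lemma cometric_nondegenerate:
  assumes A: "smooth_atlas A" and h: "pseudo_riemannian_metric A h" and \<alpha>: "\<alpha> \<in> cotangent_space A p"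
    and "\<And>\<beta>. \<beta> \<in> cotangent_space A p \<Longrightarrow> cometric A h p \<alpha> \<beta> = 0"
  shows "\<alpha> = (\<lambda>v. 0)"
proof
  fix w
  show "\<alpha> w = 0"
  proof (cases "w \<in> tangent_space A p")
    case True
    then obtain \<beta> where "\<beta> \<in> cotangent_space A p" "metric_dual A h p \<beta> = w"
      using metric_flat[OF A h] by metis
    then show ?thesis using assms(4) cometric_eq(1)[OF A h \<alpha>] by metis
  qed (use cotangent_spaceD(2)[OF \<alpha>] in auto)
qed

lemma J_field_properties:
  fixes A :: "('a::{t2_space, second_countable_topology}, 'e::euclidean_space) atlas"
  assumes A: "smooth_atlas A" and h: "pseudo_riemannian_metric A h"
    and P: "bilinear_form (cotangent_space A p) (P p)" and \<alpha>: "\<alpha> p \<in> cotangent_space A p"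
  shows "J_field A (cometric A h) P \<alpha> p \<in> cotangent_space A p"
    and "\<beta> \<in> cotangent_space A p \<Longrightarrow>
      cometric A h p (J_field A (cometric A h) P \<alpha> p) \<beta> = P p (\<alpha> p) \<beta>"
proof -
  let ?T = "tangent_space A p" and ?C = "cotangent_space A p"
  \<comment> \<open>The flat map, inverse to \<open>metric_dual\<close>, as an explicit function so
    that its linearity can be stated.\<close>
  define lower where "lower = (\<lambda>w v. if v \<in> ?T then h p w v else 0)"
  note hl = pseudo_riemannian_metricD(1)[OF h, of p]
  have lower: "lower w \<in> ?C" if "w \<in> ?T" for w
    using bilinear_formD(1)[OF hl that]
    by (simp add: cotangent_space_def linear_functional_def lower_def tangent_add tangent_scale)
  have lower_add: "lower (\<lambda>f. v f + w f) = (\<lambda>u. lower v u + lower w u)" if "v \<in> ?T" "w \<in> ?T" for v w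
    using linear_functionalD(1)[OF bilinear_formD(2)[OF hl]] that by (auto simp: lower_def fun_eq_iff)
  have lower_scale: "lower (\<lambda>f. c * v f) = (\<lambda>u. c * lower v u)" if "v \<in> ?T" for v c
    using linear_functionalD(2)[OF bilinear_formD(2)[OF hl]] that by (auto simp: lower_def fun_eq_iff)
  have lower_dual: "lower (metric_dual A h p \<beta>) = \<beta>" if "\<beta> \<in> ?C" for \<beta>
    using metric_dual_pairing[OF A h that] cotangent_spaceD(2)[OF that] by (auto simp: lower_def fun_eq_iff)
  note lin = linear_functionalD[OF bilinear_formD(1)[OF P \<alpha>]]
  \<comment> \<open>The requirement g(\<gamma>, \<beta>) = P(\<alpha>, \<beta>) says that \<gamma>
    takes the value P(\<alpha>, \<beta>) on the dual vector of \<beta>. This forces \<gamma>(w) =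
    P(\<alpha>, \<open>lower w\<close>).\<close>
  define \<gamma> where "\<gamma> = (\<lambda>w. if w \<in> ?T then P p (\<alpha> p) (lower w) else 0)"
  have \<gamma>: "\<gamma> \<in> ?C"
    unfolding cotangent_space_def linear_functional_def
  proof (intro CollectI conjI ballI allI impI)
    fix v w assume vw: "v \<in> ?T" "w \<in> ?T"
    show "\<gamma> (\<lambda>f. v f + w f) = \<gamma> v + \<gamma> w"
      using lin(1)[OF lower[OF vw(1)] lower[OF vw(2)]] vw by (simp add: \<gamma>_def tangent_add lower_add)
  next
    fix c v assume v: "v \<in> ?T"
    show "\<gamma> (\<lambda>f. c * v f) = c * \<gamma> v"
      using lin(2)[OF lower[OF v], of c] v by (simp add: \<gamma>_def tangent_scale lower_scale)
  qed (simp add: \<gamma>_def)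
  have pair: "cometric A h p \<gamma> \<beta> = P p (\<alpha> p) \<beta>" if "\<beta> \<in> ?C" for \<beta>
    using cometric_eq(1)[OF A h \<gamma> that] metric_dual_tangent[OF A h that] lower_dual[OF that]
    by (simp add: \<gamma>_def)
  have uniq: "\<gamma>' = \<gamma>" if g': "\<gamma>' \<in> ?C" "\<forall>\<beta>\<in>?C. cometric A h p \<gamma>' \<beta> = P p (\<alpha> p) \<beta>" for \<gamma>'
  proof -
    have "(\<lambda>v. \<gamma>' v - \<gamma> v) = (\<lambda>v. 0)"
    proof (rule cometric_nondegenerate[OF A h cotangent_diff[OF g'(1) \<gamma>]])
      fix \<beta> assume b: "\<beta> \<in> ?C"
      show "cometric A h p (\<lambda>v. \<gamma>' v - \<gamma> v) \<beta> = 0"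
        using g'(2) b pair[OF b] cometric_eq(1)[OF A h cotangent_diff[OF g'(1) \<gamma>] b]
          cometric_eq(1)[OF A h g'(1) b] cometric_eq(1)[OF A h \<gamma> b] by simp
    qed
    then show ?thesis by (simp add: fun_eq_iff)
  qed
  have "J_field A (cometric A h) P \<alpha> p = \<gamma>"
    unfolding J_field_def
    by (rule the_equality) (intro conjI ballI \<gamma> pair, assumption, elim conjE, rule uniq)
  then show "J_field A (cometric A h) P \<alpha> p \<in> ?C"
    and "\<beta> \<in> ?C \<Longrightarrow> cometric A h p (J_field A (cometric A h) P \<alpha> p) \<beta> = P p (\<alpha> p) \<beta>"
    using \<gamma> pair by auto
qed

subsection \<open>Pullbacks\<close>

lemma pushforward_tangent:
  assumes B: "smooth_atlas B" and \<sigma>: "\<And>f. f \<in> smooth_functions B \<Longrightarrow> f \<circ> \<sigma> \<in> smooth_functions A"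
    and v: "v \<in> tangent_space A p"
  shows "pushforward B \<sigma> v \<in> tangent_space B (\<sigma> p)"
  unfolding tangent_space_def linear_functional_def
proof (intro CollectI conjI ballI allI impI)
  fix f g assume fg: "f \<in> smooth_functions B" "g \<in> smooth_functions B"
  note s = fg[THEN \<sigma>, unfolded o_def]
  show "pushforward B \<sigma> v (\<lambda>x. f x + g x) = pushforward B \<sigma> v f + pushforward B \<sigma> v g"
    using tangent_spaceD(1)[OF v s] fg smooth_functions_add[OF B fg] by (simp add: pushforward_def o_def)
  show "pushforward B \<sigma> v (\<lambda>x. f x * g x) = f (\<sigma> p) * pushforward B \<sigma> v g + g (\<sigma> p) * pushforward B \<sigma> v f"
    using tangent_spaceD(3)[OF v s] fg smooth_functions_mult[OF B fg] by (simp add: pushforward_def o_def)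
next
  fix c f assume f: "f \<in> smooth_functions B"
  show "pushforward B \<sigma> v (\<lambda>x. c * f x) = c * pushforward B \<sigma> v f"
    using tangent_spaceD(2)[OF v \<sigma>[OF f, unfolded o_def], of c] f
      smooth_functions_mult[OF B smooth_functions_const f, of c] by (simp add: pushforward_def o_def)
qed (simp add: pushforward_def)

lemma pushforward_apply: "f \<in> smooth_functions B \<Longrightarrow> pushforward B \<sigma> v f = v (f \<circ> \<sigma>)"
  by (simp add: pushforward_def)

lemma pullback_apply:
  "v \<in> tangent_space A p \<Longrightarrow> pullback A B \<sigma> \<omega> p v = \<omega> (\<sigma> p) (pushforward B \<sigma> v)"
  by (simp add: pullback_def)

lemma pullback_cotangent:
  assumes B: "smooth_atlas B" and \<sigma>: "\<And>f. f \<in> smooth_functions B \<Longrightarrow> f \<circ> \<sigma> \<in> smooth_functions A"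
    and \<omega>: "\<omega> (\<sigma> p) \<in> cotangent_space B (\<sigma> p)"
  shows "pullback A B \<sigma> \<omega> p \<in> cotangent_space A p"
  unfolding cotangent_space_def linear_functional_def
proof (intro CollectI conjI ballI allI impI)
  note lin = linear_functionalD[OF cotangent_spaceD(1)[OF \<omega>]]
  have add: "pushforward B \<sigma> (\<lambda>f. v f + w f) = (\<lambda>f. pushforward B \<sigma> v f + pushforward B \<sigma> w f)" for v w
    by (auto simp: pushforward_def)
  have scale: "pushforward B \<sigma> (\<lambda>f. c * v f) = (\<lambda>f. c * pushforward B \<sigma> v f)" for c v
    by (auto simp: pushforward_def)
  {
    fix v w assume vw: "v \<in> tangent_space A p" "w \<in> tangent_space A p"
    show "pullback A B \<sigma> \<omega> p (\<lambda>f. v f + w f) = pullback A B \<sigma> \<omega> p v + pullback A B \<sigma> \<omega> p w"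
      using lin(1)[OF pushforward_tangent[OF B \<sigma> vw(1)] pushforward_tangent[OF B \<sigma> vw(2)]]
      by (simp add: pullback_apply vw tangent_add add)
  next
    fix c v assume v: "v \<in> tangent_space A p"
    show "pullback A B \<sigma> \<omega> p (\<lambda>f. c * v f) = c * pullback A B \<sigma> \<omega> p v"
      using lin(2)[OF pushforward_tangent[OF B \<sigma> v], of c]
      by (simp add: pullback_apply v tangent_scale scale)
  }
qed (simp add: pullback_def)

lemma pullback_differential:
  assumes B: "smooth_atlas B" and \<sigma>: "\<And>f. f \<in> smooth_functions B \<Longrightarrow> f \<circ> \<sigma> \<in> smooth_functions A"
    and f: "f \<in> smooth_functions B"
  shows "pullback A B \<sigma> (differential B f) = differential A (f \<circ> \<sigma>)"
  by (intro ext)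
    (simp add: pullback_def differential_def pushforward_tangent[OF B \<sigma>] pushforward_apply[OF f])

text \<open>The pushforward of X along \<sigma> need not be a vector field on the target, so
  smoothness of \<alpha> cannot be applied to it. Near p it is expanded in a frame around \<sigma> p
  by global fields: the value is the sum of X(u_b o \<sigma>) times \<alpha>(E_b) o \<sigma>, a
  smooth function.\<close>

lemma pullback_one_form:
  fixes A :: "('a::{t2_space, second_countable_topology}, 'e::euclidean_space) atlas"
    and B :: "('b::{t2_space, second_countable_topology}, 'd::euclidean_space) atlas"
  assumes A: "smooth_atlas A" and B: "smooth_atlas B"
    and \<sigma>: "\<And>f. f \<in> smooth_functions B \<Longrightarrow> f \<circ> \<sigma> \<in> smooth_functions A"
    and cont: "continuous_on UNIV \<sigma>" and \<alpha>: "\<alpha> \<in> one_forms B"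
  shows "pullback A B \<sigma> \<alpha> \<in> one_forms A"
  unfolding one_forms_def
proof (intro CollectI conjI allI ballI)
  show "pullback A B \<sigma> \<alpha> p \<in> cotangent_space A p" for p
    by (rule pullback_cotangent[OF B \<sigma>], assumption, rule one_forms_cotangent[OF \<alpha>])
  fix X assume X: "X \<in> vector_fields A"
  show "(\<lambda>p. pullback A B \<sigma> \<alpha> p (X p)) \<in> smooth_functions A"
  proof (rule smooth_functions_local[OF A])
    fix p
    obtain W u and E :: "'d \<Rightarrow> 'b vfield" where W: "open W" "\<sigma> p \<in> W"
      and u: "\<And>b. u b \<in> smooth_functions B" and E: "\<And>b. E b \<in> vector_fields B"
      and frame: "\<And>q v f. q \<in> W \<Longrightarrow> v \<in> tangent_space B q \<Longrightarrow> v f = (\<Sum>b\<in>Basis. v (u b) * E b q f)"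
      by (rule local_frame[OF B, of "\<sigma> p"]) blast
    let ?g = "\<lambda>x. \<Sum>b\<in>Basis. X x (u b \<circ> \<sigma>) * ((\<lambda>q. \<alpha> q (E b q)) \<circ> \<sigma>) x"
    show "\<exists>W g. open W \<and> p \<in> W \<and> g \<in> smooth_functions A \<and>
        (\<forall>x\<in>W. pullback A B \<sigma> \<alpha> x (X x) = g x)"
    proof (intro exI conjI ballI)
      show "open (\<sigma> -` W)" using cont W(1) by (simp add: open_vimage)
      show "p \<in> \<sigma> -` W" using W(2) by simp
      show "?g \<in> smooth_functions A"
        by (intro smooth_functions_sum[OF A] smooth_functions_mult[OF A] vector_fields_smooth[OF X] \<sigma> u
            one_forms_smooth[OF \<alpha>] E)
      fix x assume x: "x \<in> \<sigma> -` W"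
      let ?v = "pushforward B \<sigma> (X x)"
      have v: "?v \<in> tangent_space B (\<sigma> x)"
        by (rule pushforward_tangent[OF B \<sigma> vector_fields_tangent[OF X]])
      have "\<sigma> x \<in> W" using x by simp
      have "\<alpha> (\<sigma> x) ?v = (\<Sum>b\<in>Basis. ?v (u b) * \<alpha> (\<sigma> x) (E b (\<sigma> x)))"
        by (rule tangent_eq_frame[OF frame[OF \<open>\<sigma> x \<in> W\<close> v] E
              cotangent_spaceD(1)[OF one_forms_cotangent[OF \<alpha>]]])
      then show "pullback A B \<sigma> \<alpha> x (X x) = ?g x"
        by (simp add: pullback_apply[OF vector_fields_tangent[OF X]] pushforward_apply[OF u])
    qed
  qed
qed

subsection \<open>Products\<close>

lemma prod_atlasE:
  assumes "c \<in> prod_atlas A1 A2"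
  obtains U \<phi> V \<psi> where "c = (U \<times> V, map_prod \<phi> \<psi>)" "(U, \<phi>) \<in> A1" "(V, \<psi>) \<in> A2"
  using assms unfolding prod_atlas_def by blast

lemma prod_atlasI: "(U, \<phi>) \<in> A1 \<Longrightarrow> (V, \<psi>) \<in> A2 \<Longrightarrow> (U \<times> V, map_prod \<phi> \<psi>) \<in> prod_atlas A1 A2"
  unfolding prod_atlas_def by blast

lemma map_prod_image: "map_prod \<phi> \<psi> ` (U \<times> V) = \<phi> ` U \<times> \<psi> ` V"
  by auto

lemma inv_into_map_prod:
  assumes "inj_on \<phi> U" "inj_on \<psi> V" "z \<in> \<phi> ` U \<times> \<psi> ` V"
  shows "inv_into (U \<times> V) (map_prod \<phi> \<psi>) z = (inv_into U \<phi> (fst z), inv_into V \<psi> (snd z))"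
proof (rule inv_into_f_eq)
  show "inj_on (map_prod \<phi> \<psi>) (U \<times> V)" using assms(1,2) by (rule map_prod_inj_on)
qed (use assms in \<open>auto simp: inv_into_into f_inv_into_f mem_Times_iff prod_eq_iff\<close>)

lemma smooth_on_fst:
  fixes f :: "'e::euclidean_space \<Rightarrow> 'c::real_normed_vector"
  assumes "open S" "open (T :: 'd::euclidean_space set)" "smooth_on S f"
  shows "smooth_on (S \<times> T) (\<lambda>z. f (fst z))"
proof -
  have op: "open (S \<times> T)" using assms by (intro open_Times)
  have "fst ` (S \<times> T) \<subseteq> S" by auto
  then show ?thesis
    by (rule smooth_on_compose[OF op _ smooth_on_bounded_linear[OF bounded_linear_fst op] assms(3)])
qed

lemma smooth_on_snd:
  fixes f :: "'d::euclidean_space \<Rightarrow> 'c::real_normed_vector"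
  assumes "open (S :: 'e::euclidean_space set)" "open T" "smooth_on T f"
  shows "smooth_on (S \<times> T) (\<lambda>z. f (snd z))"
proof -
  have op: "open (S \<times> T)" using assms by (intro open_Times)
  have "snd ` (S \<times> T) \<subseteq> T" by auto
  then show ?thesis
    by (rule smooth_on_compose[OF op _ smooth_on_bounded_linear[OF bounded_linear_snd op] assms(3)])
qed

lemma smooth_atlas_prod:
  fixes A1 :: "('a::{t2_space, second_countable_topology}, 'e::euclidean_space) atlas"
    and A2 :: "('b::{t2_space, second_countable_topology}, 'd::euclidean_space) atlas"
  assumes A1: "smooth_atlas A1" and A2: "smooth_atlas A2"
  shows "smooth_atlas (prod_atlas A1 A2)"
proof -
  have cover: "\<exists>c\<in>prod_atlas A1 A2. z \<in> fst c" for z :: "'a \<times> 'b"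
  proof -
    obtain U \<phi> where U: "(U, \<phi>) \<in> A1" "fst z \<in> U" by (rule smooth_atlas_cover[OF A1])
    obtain V \<psi> where V: "(V, \<psi>) \<in> A2" "snd z \<in> V" by (rule smooth_atlas_cover[OF A2])
    show ?thesis
      using prod_atlasI[OF U(1) V(1)] U(2) V(2) by (intro bexI) (auto simp: mem_Times_iff)
  qed
  have chart: "open W \<and> open (\<chi>' ` W) \<and> homeomorphism W (\<chi>' ` W) \<chi>' (inv_into W \<chi>')"
    if m: "(W, \<chi>') \<in> prod_atlas A1 A2" for W \<chi>'
  proof -
    obtain U \<phi> V \<psi> where W: "W = U \<times> V" "\<chi>' = map_prod \<phi> \<psi>" and c: "(U, \<phi>) \<in> A1" "(V, \<psi>) \<in> A2"
      by (rule prod_atlasE[OF m]) auto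
    note c1 = smooth_atlas_chart[OF A1 c(1)] and c2 = smooth_atlas_chart[OF A2 c(2)]
    have inj: "inj_on (map_prod \<phi> \<psi>) (U \<times> V)" using c1(3) c2(3) by (rule map_prod_inj_on)
    have "continuous_on (U \<times> V) (\<lambda>z. (\<phi> (fst z), \<psi> (snd z)))"
      by (intro continuous_on_Pair continuous_on_compose2[OF c1(4)] continuous_on_compose2[OF c2(4)]
          continuous_on_fst continuous_on_snd continuous_on_id) auto
    then have 1: "continuous_on (U \<times> V) (map_prod \<phi> \<psi>)"
      by (simp add: map_prod_def split_beta)
    have "continuous_on (\<phi> ` U \<times> \<psi> ` V) (\<lambda>z. (inv_into U \<phi> (fst z), inv_into V \<psi> (snd z)))"
      by (intro continuous_on_Pair continuous_on_compose2[OF c1(5)] continuous_on_compose2[OF c2(5)]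
          continuous_on_fst continuous_on_snd continuous_on_id) auto
    then have 2: "continuous_on (\<phi> ` U \<times> \<psi> ` V) (inv_into (U \<times> V) (map_prod \<phi> \<psi>))"
      by (rule continuous_on_eq) (simp add: inv_into_map_prod[OF c1(3) c2(3)])
    have "homeomorphism (U \<times> V) (map_prod \<phi> \<psi> ` (U \<times> V)) (map_prod \<phi> \<psi>) (inv_into (U \<times> V) (map_prod \<phi> \<psi>))"
      by (rule homeomorphismI)
        (use 1 2[folded map_prod_image] inj in \<open>auto simp: inv_into_f_f f_inv_into_f inv_into_into simp del: map_prod_simp\<close>)
    then show ?thesis
      unfolding W using c1 c2 by (simp add: open_Times map_prod_image)
  qed
  have transition: "smooth_on (\<chi>' ` (W \<inter> W')) (\<eta> \<circ> inv_into W \<chi>')"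
    if m: "(W, \<chi>') \<in> prod_atlas A1 A2" and m': "(W', \<eta>) \<in> prod_atlas A1 A2" for W \<chi>' W' \<eta>
  proof -
    obtain U \<phi> V \<psi> where W: "W = U \<times> V" "\<chi>' = map_prod \<phi> \<psi>" and c: "(U, \<phi>) \<in> A1" "(V, \<psi>) \<in> A2"
      by (rule prod_atlasE[OF m]) auto
    obtain U' \<phi>' V' \<psi>' where W': "W' = U' \<times> V'" "\<eta> = map_prod \<phi>' \<psi>'" and c': "(U', \<phi>') \<in> A1" "(V', \<psi>') \<in> A2"
      by (rule prod_atlasE[OF m']) auto
    note c1 = smooth_atlas_chart[OF A1 c(1)] and c2 = smooth_atlas_chart[OF A2 c(2)]
    let ?S = "\<phi> ` (U \<inter> U')" and ?T = "\<psi> ` (V \<inter> V')"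
    have op: "open ?S" "open ?T"
      using chart_open_image[OF A1 c(1)] chart_open_image[OF A2 c(2)]
        smooth_atlas_chart(1)[OF A1 c'(1)] smooth_atlas_chart(1)[OF A2 c'(2)] by auto
    have opST: "open (?S \<times> ?T)" using op by (rule open_Times)
    have "smooth_on (?S \<times> ?T) (\<lambda>z. ((\<phi>' \<circ> inv_into U \<phi>) (fst z), (\<psi>' \<circ> inv_into V \<psi>) (snd z)))"
      by (intro smooth_on_Pair[OF opST] smooth_on_fst[OF op] smooth_on_snd[OF op]
          smooth_atlas_transition[OF A1 c(1) c'(1)] smooth_atlas_transition[OF A2 c(2) c'(2)])
    moreover have "((\<phi>' \<circ> inv_into U \<phi>) (fst z), (\<psi>' \<circ> inv_into V \<psi>) (snd z)) = (\<eta> \<circ> inv_into W \<chi>') z"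
      if "z \<in> ?S \<times> ?T" for z
    proof -
      have "z \<in> \<phi> ` U \<times> \<psi> ` V" using that by auto
      then show ?thesis unfolding W W' by (simp add: inv_into_map_prod[OF c1(3) c2(3)])
    qed
    ultimately have "smooth_on (?S \<times> ?T) (\<eta> \<circ> inv_into W \<chi>')"
      by (rule smooth_on_eq[OF opST])
    moreover have "\<chi>' ` (W \<inter> W') = ?S \<times> ?T"
      unfolding W W' Times_Int_Times by (rule map_prod_image)
    ultimately show ?thesis by simp
  qed
  have "(\<Union>(U, \<phi>)\<in>prod_atlas A1 A2. U) = UNIV"
    using cover by fastforce
  then show ?thesis
    unfolding smooth_atlas_def using chart transition by blast
qed

lemma smooth_functions_fst:
  fixes A1 :: "('a::{t2_space, second_countable_topology}, 'e::euclidean_space) atlas"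
    and A2 :: "('b::{t2_space, second_countable_topology}, 'd::euclidean_space) atlas"
  assumes A1: "smooth_atlas A1" and A2: "smooth_atlas A2" and f: "f \<in> smooth_functions A1"
  shows "f \<circ> fst \<in> smooth_functions (prod_atlas A1 A2)"
  unfolding smooth_functions_def
proof (intro CollectI ballI, elim prod_atlasE, clarify)
  fix U \<phi> V \<psi> assume c: "(U, \<phi>) \<in> A1" "(V, \<psi>) \<in> A2"
  note c1 = smooth_atlas_chart[OF A1 c(1)] and c2 = smooth_atlas_chart[OF A2 c(2)]
  have op: "open (\<phi> ` U \<times> \<psi> ` V)" using c1 c2 by (intro open_Times)
  have "smooth_on (\<phi> ` U \<times> \<psi> ` V) (\<lambda>z. (f \<circ> inv_into U \<phi>) (fst z))"
    by (rule smooth_on_fst[OF c1(2) c2(2) smooth_functionsD[OF f c(1)]])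
  moreover have "(f \<circ> inv_into U \<phi>) (fst z) = (f \<circ> fst \<circ> inv_into (U \<times> V) (map_prod \<phi> \<psi>)) z"
    if "z \<in> \<phi> ` U \<times> \<psi> ` V" for z
    using inv_into_map_prod[OF c1(3) c2(3) that] by simp
  ultimately show "smooth_on (map_prod \<phi> \<psi> ` (U \<times> V)) (f \<circ> fst \<circ> inv_into (U \<times> V) (map_prod \<phi> \<psi>))"
    unfolding map_prod_image by (rule smooth_on_eq[OF op])
qed

lemma smooth_functions_snd:
  fixes A1 :: "('a::{t2_space, second_countable_topology}, 'e::euclidean_space) atlas"
    and A2 :: "('b::{t2_space, second_countable_topology}, 'd::euclidean_space) atlas"
  assumes A1: "smooth_atlas A1" and A2: "smooth_atlas A2" and f: "f \<in> smooth_functions A2"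
  shows "f \<circ> snd \<in> smooth_functions (prod_atlas A1 A2)"
  unfolding smooth_functions_def
proof (intro CollectI ballI, elim prod_atlasE, clarify)
  fix U \<phi> V \<psi> assume c: "(U, \<phi>) \<in> A1" "(V, \<psi>) \<in> A2"
  note c1 = smooth_atlas_chart[OF A1 c(1)] and c2 = smooth_atlas_chart[OF A2 c(2)]
  have op: "open (\<phi> ` U \<times> \<psi> ` V)" using c1 c2 by (intro open_Times)
  have "smooth_on (\<phi> ` U \<times> \<psi> ` V) (\<lambda>z. (f \<circ> inv_into V \<psi>) (snd z))"
    by (rule smooth_on_snd[OF c1(2) c2(2) smooth_functionsD[OF f c(2)]])
  moreover have "(f \<circ> inv_into V \<psi>) (snd z) = (f \<circ> snd \<circ> inv_into (U \<times> V) (map_prod \<phi> \<psi>)) z"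
    if "z \<in> \<phi> ` U \<times> \<psi> ` V" for z
    using inv_into_map_prod[OF c1(3) c2(3) that] by simp
  ultimately show "smooth_on (map_prod \<phi> \<psi> ` (U \<times> V)) (f \<circ> snd \<circ> inv_into (U \<times> V) (map_prod \<phi> \<psi>))"
    unfolding map_prod_image by (rule smooth_on_eq[OF op])
qed

text \<open>Brings smoothness from the product back to a factor; the cometrics of the factors get
  their smoothness from the warped metric in this way.\<close>

lemma smooth_functions_slice_fst:
  fixes A1 :: "('a::{t2_space, second_countable_topology}, 'e::euclidean_space) atlas"
    and A2 :: "('b::{t2_space, second_countable_topology}, 'd::euclidean_space) atlas"
  assumes A1: "smooth_atlas A1" and A2: "smooth_atlas A2" and F: "F \<in> smooth_functions (prod_atlas A1 A2)"
  shows "(\<lambda>x. F (x, y)) \<in> smooth_functions A1"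
  unfolding smooth_functions_def
proof safe
  fix U \<phi> assume c: "(U, \<phi>) \<in> A1"
  obtain V \<psi> where V: "(V, \<psi>) \<in> A2" "y \<in> V" by (rule smooth_atlas_cover[OF A2])
  note c1 = smooth_atlas_chart[OF A1 c] and c2 = smooth_atlas_chart[OF A2 V(1)]
  have "(\<lambda>e. (e, \<psi> y)) ` \<phi> ` U \<subseteq> map_prod \<phi> \<psi> ` (U \<times> V)" using V(2) by (auto simp: map_prod_image)
  then have "smooth_on (\<phi> ` U) (\<lambda>e. (F \<circ> inv_into (U \<times> V) (map_prod \<phi> \<psi>)) (e, \<psi> y))"
    by (rule smooth_on_compose[OF c1(2) _ _ smooth_functionsD[OF F prod_atlasI[OF c V(1)]]])
      (intro smooth_on_Pair smooth_on_bounded_linear bounded_linear_ident c1(2) smooth_on_const)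
  moreover have "(F \<circ> inv_into (U \<times> V) (map_prod \<phi> \<psi>)) (e, \<psi> y) = ((\<lambda>x. F (x, y)) \<circ> inv_into U \<phi>) e"
    if "e \<in> \<phi> ` U" for e
    using inv_into_map_prod[OF c1(3) c2(3), of "(e, \<psi> y)"] that V(2) c2(3) by simp
  ultimately show "smooth_on (\<phi> ` U) ((\<lambda>x. F (x, y)) \<circ> inv_into U \<phi>)"
    by (rule smooth_on_eq[OF c1(2)])
qed

lemma smooth_functions_slice_snd:
  fixes A1 :: "('a::{t2_space, second_countable_topology}, 'e::euclidean_space) atlas"
    and A2 :: "('b::{t2_space, second_countable_topology}, 'd::euclidean_space) atlas"
  assumes A1: "smooth_atlas A1" and A2: "smooth_atlas A2" and F: "F \<in> smooth_functions (prod_atlas A1 A2)"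
  shows "(\<lambda>y. F (x, y)) \<in> smooth_functions A2"
  unfolding smooth_functions_def
proof safe
  fix V \<psi> assume c: "(V, \<psi>) \<in> A2"
  obtain U \<phi> where U: "(U, \<phi>) \<in> A1" "x \<in> U" by (rule smooth_atlas_cover[OF A1])
  note c1 = smooth_atlas_chart[OF A1 U(1)] and c2 = smooth_atlas_chart[OF A2 c]
  have "(\<lambda>e. (\<phi> x, e)) ` \<psi> ` V \<subseteq> map_prod \<phi> \<psi> ` (U \<times> V)" using U(2) by (auto simp: map_prod_image)
  then have "smooth_on (\<psi> ` V) (\<lambda>e. (F \<circ> inv_into (U \<times> V) (map_prod \<phi> \<psi>)) (\<phi> x, e))"
    by (rule smooth_on_compose[OF c2(2) _ _ smooth_functionsD[OF F prod_atlasI[OF U(1) c]]])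
      (intro smooth_on_Pair smooth_on_bounded_linear bounded_linear_ident c2(2) smooth_on_const)
  moreover have "(F \<circ> inv_into (U \<times> V) (map_prod \<phi> \<psi>)) (\<phi> x, e) = ((\<lambda>y. F (x, y)) \<circ> inv_into V \<psi>) e"
    if "e \<in> \<psi> ` V" for e
    using inv_into_map_prod[OF c1(3) c2(3), of "(\<phi> x, e)"] that U(2) c1(3) by simp
  ultimately show "smooth_on (\<psi> ` V) ((\<lambda>y. F (x, y)) \<circ> inv_into V \<psi>)"
    by (rule smooth_on_eq[OF c2(2)])
qed

section \<open>Lifts of forms and the splitting of covectors on the product\<close>

locale manifold_product =
  fixes A1 :: "('a::{t2_space, second_countable_topology}, 'e::euclidean_space) atlas"
    and A2 :: "('b::{t2_space, second_countable_topology}, 'd::euclidean_space) atlas"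
  assumes A1: "smooth_atlas A1" and A2: "smooth_atlas A2"
begin

abbreviation "N \<equiv> prod_atlas A1 A2"
abbreviation "H \<equiv> hlift A1 A2"
abbreviation "V \<equiv> vlift A1 A2"

lemmas AN = smooth_atlas_prod[OF A1 A2]
lemmas smooth_fst = smooth_functions_fst[OF A1 A2]
lemmas smooth_snd = smooth_functions_snd[OF A1 A2]

lemma H_one_form: "\<alpha> \<in> one_forms A1 \<Longrightarrow> H \<alpha> \<in> one_forms N"
  unfolding hlift_def by (intro pullback_one_form[OF AN A1 smooth_fst] continuous_on_fst continuous_on_id)

lemma V_one_form: "\<alpha> \<in> one_forms A2 \<Longrightarrow> V \<alpha> \<in> one_forms N"
  unfolding vlift_def by (intro pullback_one_form[OF AN A2 smooth_snd] continuous_on_snd continuous_on_id)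

lemma H_cotangent: "\<omega> (fst z) \<in> cotangent_space A1 (fst z) \<Longrightarrow> H \<omega> z \<in> cotangent_space N z"
  unfolding hlift_def by (rule pullback_cotangent[OF A1 smooth_fst])

lemma V_cotangent: "\<omega> (snd z) \<in> cotangent_space A2 (snd z) \<Longrightarrow> V \<omega> z \<in> cotangent_space N z"
  unfolding vlift_def by (rule pullback_cotangent[OF A2 smooth_snd])

lemma H_differential: "f \<in> smooth_functions A1 \<Longrightarrow> H (differential A1 f) = differential N (f \<circ> fst)"
  unfolding hlift_def by (rule pullback_differential[OF A1 smooth_fst])

lemma V_differential: "f \<in> smooth_functions A2 \<Longrightarrow> V (differential A2 f) = differential N (f \<circ> snd)"
  unfolding vlift_def by (rule pullback_differential[OF A2 smooth_snd])

lemma H_cong: "\<omega> (fst z) = \<eta> (fst z) \<Longrightarrow> H \<omega> z = H \<eta> z"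
  by (auto simp: hlift_def pullback_def)

lemma V_cong: "\<omega> (snd z) = \<eta> (snd z) \<Longrightarrow> V \<omega> z = V \<eta> z"
  by (auto simp: vlift_def pullback_def)

text \<open>Every coordinate of a product chart is a function of one factor only. Hence the linear
  part of F at z separates into a function f1 of the first and a function f2 of the second factor,
  whose differentials are lifted.\<close>

lemma cotangent_split:
  assumes \<omega>: "\<omega> \<in> cotangent_space N z"
  obtains \<alpha> \<beta> where "\<alpha> \<in> one_forms A1" "\<beta> \<in> one_forms A2" "\<omega> = (\<lambda>v. H \<alpha> z v + V \<beta> z v)"
proof -
  obtain x y where z: "z = (x, y)" by fastforce
  obtain F where F: "F \<in> smooth_functions N" "\<omega> = differential N F z"
    by (rule cotangent_eq_differential[OF AN \<omega>])
  obtain U1 \<phi> where c1: "(U1, \<phi>) \<in> A1" "x \<in> U1" by (rule smooth_atlas_cover[OF A1])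
  obtain U2 \<psi> where c2: "(U2, \<psi>) \<in> A2" "y \<in> U2" by (rule smooth_atlas_cover[OF A2])
  obtain W1 u1 where W1: "open W1" "W1 \<subseteq> U1" "x \<in> W1" and u1: "\<And>b. u1 b \<in> smooth_functions A1"
    "\<And>b x. x \<in> W1 \<Longrightarrow> u1 b x = \<phi> x \<bullet> b"
    by (rule local_coordinates[OF A1 c1]) blast
  obtain W2 u2 where W2: "open W2" "W2 \<subseteq> U2" "y \<in> W2" and u2: "\<And>b. u2 b \<in> smooth_functions A2"
    "\<And>b y. y \<in> W2 \<Longrightarrow> u2 b y = \<psi> y \<bullet> b"
    by (rule local_coordinates[OF A2 c2]) blast
  \<comment> \<open>For b in the basis of the product, one of \<open>fst b\<close> and
    \<open>snd b\<close> is 0 and its summand vanishes near z. As \<open>u1\<close> and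
    \<open>u2\<close> are available for every vector, both kinds of coordinate are one
    formula.\<close>
  define u where "u = (\<lambda>b z. (u1 (fst b) \<circ> fst) z + (u2 (snd b) \<circ> snd) z)"
  define d where "d = frechet_derivative (F \<circ> inv_into (U1 \<times> U2) (map_prod \<phi> \<psi>)) (at (map_prod \<phi> \<psi> z))"
  have "u b \<in> smooth_functions N" for b
    unfolding u_def by (intro smooth_functions_add[OF AN] smooth_fst smooth_snd u1(1) u2(1))
  have expand: "v F = (\<Sum>b\<in>Basis. v (u b) * d b)" if v: "v \<in> tangent_space N z" for v
    unfolding d_def
  proof (rule tangent_coordinate_expansion[OF AN prod_atlasI[OF c1(1) c2(1)], of "W1 \<times> W2"])
    show "u b w = map_prod \<phi> \<psi> w \<bullet> b" if "w \<in> W1 \<times> W2" for b w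
      using that u1(2) u2(2) by (cases b) (auto simp: u_def inner_Pair)
  qed (use W1 W2 z v F \<open>\<And>b. u b \<in> smooth_functions N\<close> in \<open>auto intro: open_Times\<close>)
  have vu: "v (u b) = v (u1 (fst b) \<circ> fst) + v (u2 (snd b) \<circ> snd)" if v: "v \<in> tangent_space N z" for v b
    unfolding u_def by (rule tangent_spaceD(1)[OF v smooth_fst[OF u1(1)] smooth_snd[OF u2(1)]])
  define f1 where "f1 = (\<lambda>x. \<Sum>b\<in>Basis. d b * u1 (fst b) x)"
  define f2 where "f2 = (\<lambda>y. \<Sum>b\<in>Basis. d b * u2 (snd b) y)"
  have t1: "(\<lambda>x. d b * u1 (fst b) x) \<in> smooth_functions A1" for b
    by (intro smooth_functions_mult[OF A1] u1(1) smooth_functions_const)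
  have t2: "(\<lambda>x. d b * u2 (snd b) x) \<in> smooth_functions A2" for b
    by (intro smooth_functions_mult[OF A2] u2(1) smooth_functions_const)
  have f1: "f1 \<in> smooth_functions A1" unfolding f1_def by (rule smooth_functions_sum[OF A1 t1])
  have f2: "f2 \<in> smooth_functions A2" unfolding f2_def by (rule smooth_functions_sum[OF A2 t2])
  show ?thesis
  proof (rule that[OF differential_one_form[OF f1] differential_one_form[OF f2]])
    show "\<omega> = (\<lambda>v. H (differential A1 f1) z v + V (differential A2 f2) z v)"
      unfolding H_differential[OF f1] V_differential[OF f2] F(2)
    proof
      fix v
      show "differential N F z v = differential N (f1 \<circ> fst) z v + differential N (f2 \<circ> snd) z v"
      proof (cases "v \<in> tangent_space N z")
        case True
        have "v (f1 \<circ> fst) = (\<Sum>b\<in>Basis. v (\<lambda>z. d b * (u1 (fst b) \<circ> fst) z))"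
          using tangent_sum[OF AN True, of Basis "\<lambda>b. (\<lambda>x. d b * u1 (fst b) x) \<circ> fst",
            OF smooth_fst[OF t1]] by (simp add: f1_def o_def)
        also have "\<dots> = (\<Sum>b\<in>Basis. d b * v (u1 (fst b) \<circ> fst))"
          by (intro sum.cong refl tangent_spaceD(2)[OF True] smooth_fst u1(1))
        finally have 1: "v (f1 \<circ> fst) = (\<Sum>b\<in>Basis. d b * v (u1 (fst b) \<circ> fst))" .
        have "v (f2 \<circ> snd) = (\<Sum>b\<in>Basis. v (\<lambda>z. d b * (u2 (snd b) \<circ> snd) z))"
          using tangent_sum[OF AN True, of Basis "\<lambda>b. (\<lambda>x. d b * u2 (snd b) x) \<circ> snd",
            OF smooth_snd[OF t2]] by (simp add: f2_def o_def)
        also have "\<dots> = (\<Sum>b\<in>Basis. d b * v (u2 (snd b) \<circ> snd))"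
          by (intro sum.cong refl tangent_spaceD(2)[OF True] smooth_snd u2(1))
        finally have 2: "v (f2 \<circ> snd) = (\<Sum>b\<in>Basis. d b * v (u2 (snd b) \<circ> snd))" .
        show ?thesis
          unfolding differential_eq[OF True] expand[OF True] vu[OF True] 1 2
          by (simp add: distrib_left distrib_right sum.distrib mult.commute)
      qed (simp add: differential_def)
    qed
  qed
qed

end

subsection \<open>The Koszul formula\<close>

text \<open>Three instances of metricity and three of vanishing torsion, combined linearly. The plus
  signs of the last two brackets come from writing them with \<gamma> as first argument.\<close>

lemma koszul_formula:
  assumes A: "smooth_atlas A" and g: "smooth_cotensor2 A g"
    and sym: "\<And>\<alpha> \<beta>. \<alpha> \<in> cotangent_space A p \<Longrightarrow> \<beta> \<in> cotangent_space A p \<Longrightarrow> g p \<alpha> \<beta> = g p \<beta> \<alpha>"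
    and LC: "levi_civita A g P D"
    and forms: "\<alpha> \<in> one_forms A" "\<beta> \<in> one_forms A" "\<gamma> \<in> one_forms A"
  shows "2 * on_forms g (D \<alpha> \<beta>) \<gamma> p =
      anchor A P \<alpha> p (on_forms g \<beta> \<gamma>) + anchor A P \<beta> p (on_forms g \<alpha> \<gamma>) - anchor A P \<gamma> p (on_forms g \<alpha> \<beta>)
      + koszul_bracket A P \<alpha> \<beta> (anchor A g \<gamma>) p + koszul_bracket A P \<gamma> \<alpha> (anchor A g \<beta>) p
      + koszul_bracket A P \<gamma> \<beta> (anchor A g \<alpha>) p"
proof -
  have D: "D a b \<in> one_forms A" if "a \<in> one_forms A" "b \<in> one_forms A" for a b
    using LC that unfolding levi_civita_def contravariant_connection_def by blast
  have gsym: "on_forms g a b p = on_forms g b a p" if "a \<in> one_forms A" "b \<in> one_forms A" for a b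
    unfolding on_forms_def by (intro sym one_forms_cotangent that)
  have metric: "anchor A P a p (on_forms g b c) = on_forms g (D a b) c p + on_forms g b (D a c) p"
    if "a \<in> one_forms A" "b \<in> one_forms A" "c \<in> one_forms A" for a b c
    using LC that unfolding levi_civita_def by blast
  \<comment> \<open>The torsion identity is given on vector fields; at the dual of c the value of a
    form is its product with c under g.\<close>
  have torsion: "koszul_bracket A P a b (anchor A g c) p = on_forms g (D a b) c p - on_forms g (D b a) c p"
    if abc: "a \<in> one_forms A" "b \<in> one_forms A" "c \<in> one_forms A" for a b c
  proof -
    have "koszul_bracket A P a b (anchor A g c) p = D a b p (anchor A g c p) - D b a p (anchor A g c p)"
      using LC abc(1,2) anchor_vector_field[OF A g abc(3)] unfolding levi_civita_def by metis
    then show ?thesis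
      using gsym[OF abc(3) D[OF abc(1,2)]] gsym[OF abc(3) D[OF abc(2,1)]]
      by (simp add: anchor_on_form[OF A g abc(3) D[OF abc(1,2)]] anchor_on_form[OF A g abc(3) D[OF abc(2,1)]])
  qed
  show ?thesis
    using metric[OF forms(1,2,3)] metric[OF forms(2,1,3)] metric[OF forms(3,1,2)]
      torsion[OF forms(1,2,3)] torsion[OF forms(3,1,2)] torsion[OF forms(3,2,1)]
      gsym[OF forms(2) D[OF forms(1,3)]] gsym[OF forms(1) D[OF forms(2,3)]] gsym[OF forms(1) D[OF forms(3,2)]]
    by linarith
qed

lemma zero_vector_field: "(\<lambda>p f. 0) \<in> vector_fields A"
  by (simp add: vector_fields_def tangent_zero)

lemma lie_derivative_zero:
  assumes "X \<in> vector_fields A" "\<beta> \<in> one_forms A"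
  shows lie_derivative_zero_left: "lie_derivative (\<lambda>p f. 0) \<beta> X p = 0"
    and lie_derivative_zero_right: "lie_derivative X \<beta> (\<lambda>p f. 0) p = 0"
proof -
  have "lie_bracket (\<lambda>p f. 0) X p = (\<lambda>f. 0)" "lie_bracket X (\<lambda>p f. 0) p = (\<lambda>f. 0)"
    by (intro ext; simp add: lie_bracket_def tangent_const[OF vector_fields_tangent[OF assms(1)]])+
  then show "lie_derivative (\<lambda>p f. 0) \<beta> X p = 0" "lie_derivative X \<beta> (\<lambda>p f. 0) p = 0"
    by (simp_all add: lie_derivative_def tangent_const[OF vector_fields_tangent[OF assms(1)]]
      linear_functional_tangent_zero[OF cotangent_spaceD(1)[OF one_forms_cotangent[OF assms(2)]]])
qed

text \<open>The metric dual of a vertical lift has zero horizontal part, so the bracket of two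
  horizontal lifts paired with a vertical one ends up here.\<close>

lemma koszul_bracket_zero:
  assumes "smooth_atlas A" "smooth_cotensor2 A P" "\<alpha> \<in> one_forms A" "\<beta> \<in> one_forms A"
  shows "koszul_bracket A P \<alpha> \<beta> (\<lambda>p f. 0) p = 0"
  using anchor_vector_field[OF assms(1-3)] anchor_vector_field[OF assms(1,2,4)] assms(3,4)
  by (simp add: koszul_bracket_def lie_derivative_zero_right differential_eq[OF tangent_zero])

subsection \<open>Lifts on a product\<close>

context manifold_product
begin

text \<open>The horizontal part of \<open>X\<close> is the lift of \<open>X1\<close>; its vertical part is \<open>b\<close> times the lift of \<open>X2\<close>.\<close>

definition splits :: "('a \<times> 'b) vfield \<Rightarrow> 'a vfield \<Rightarrow> ('a \<Rightarrow> real) \<Rightarrow> 'b vfield \<Rightarrow> bool" where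
  "splits X X1 b X2 \<longleftrightarrow> X \<in> vector_fields N \<and> X1 \<in> vector_fields A1 \<and> X2 \<in> vector_fields A2 \<and>
    b \<in> smooth_functions A1 \<and>
    (\<forall>h\<in>smooth_functions A1. \<forall>z. X z (h \<circ> fst) = X1 (fst z) h) \<and>
    (\<forall>k\<in>smooth_functions A2. \<forall>z. X z (k \<circ> snd) = b (fst z) * X2 (snd z) k)"

lemma splitsD:
  assumes "splits X X1 b X2"
  shows "X \<in> vector_fields N" "X1 \<in> vector_fields A1" "X2 \<in> vector_fields A2" "b \<in> smooth_functions A1"
    and "h \<in> smooth_functions A1 \<Longrightarrow> X z (h \<circ> fst) = X1 (fst z) h"
    and "k \<in> smooth_functions A2 \<Longrightarrow> X z (k \<circ> snd) = b (fst z) * X2 (snd z) k"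
  using assms unfolding splits_def by blast+

lemma splits_mult:
  assumes X: "splits X X1 b X2" and h: "h \<in> smooth_functions A1" and k: "k \<in> smooth_functions A2"
  shows "X z (\<lambda>x. h (fst x) * k (snd x)) = h (fst z) * (b (fst z) * X2 (snd z) k) + k (snd z) * X1 (fst z) h"
  using tangent_spaceD(3)[OF vector_fields_tangent[OF splitsD(1)[OF X]] smooth_fst[OF h] smooth_snd[OF k], of z]
  by (simp add: splitsD(5)[OF X h] splitsD(6)[OF X k])

section \<open>Lifts and their Lie derivatives along split vector fields\<close>

lemma H_apply:
  assumes X: "splits X X1 b X2"
  shows "H \<alpha> z (X z) = \<alpha> (fst z) (X1 (fst z))"
proof -
  have "pushforward A1 fst (X z) h = X1 (fst z) h" for h
    using splitsD(5)[OF X] tangent_spaceD(4)[OF vector_fields_tangent[OF splitsD(2)[OF X]]]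
    by (simp add: pushforward_def)
  then have "pushforward A1 fst (X z) = X1 (fst z)" ..
  then show ?thesis
    unfolding hlift_def pullback_apply[OF vector_fields_tangent[OF splitsD(1)[OF X]]] by simp
qed

lemma V_apply:
  assumes X: "splits X X1 b X2" and \<beta>: "\<beta> \<in> one_forms A2"
  shows "V \<beta> z (X z) = b (fst z) * \<beta> (snd z) (X2 (snd z))"
proof -
  have "pushforward A2 snd (X z) k = b (fst z) * X2 (snd z) k" for k
    using splitsD(6)[OF X] tangent_spaceD(4)[OF vector_fields_tangent[OF splitsD(3)[OF X]]]
    by (simp add: pushforward_def)
  then have "pushforward A2 snd (X z) = (\<lambda>k. b (fst z) * X2 (snd z) k)" ..
  then show ?thesis
    unfolding vlift_def pullback_apply[OF vector_fields_tangent[OF splitsD(1)[OF X]]]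
    using linear_functionalD(2)[OF cotangent_spaceD(1)[OF one_forms_cotangent[OF \<beta>]]
        vector_fields_tangent[OF splitsD(3)[OF X]]] by simp
qed

text \<open>X and Y project to X1 and Y1, hence [X, Y] projects to [X1, Y1], and all ingredients of
  the Lie derivative of a horizontal lift come from the first factor.\<close>

lemma lie_derivative_H:
  assumes X: "splits X X1 b X2" and Y: "splits Y Y1 c Y2" and \<alpha>: "\<alpha> \<in> one_forms A1"
  shows "lie_derivative X (H \<alpha>) Y z = lie_derivative X1 \<alpha> Y1 (fst z)"
proof -
  note t = lie_bracket_tangent[OF AN splitsD(1)[OF X] splitsD(1)[OF Y], of z]
  have "pushforward A1 fst (lie_bracket X Y z) h = lie_bracket X1 Y1 (fst z) h" for h
  proof (cases "h \<in> smooth_functions A1")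
    case True
    have Yh: "(\<lambda>x. Y x (h \<circ> fst)) = (\<lambda>q. Y1 q h) \<circ> fst" and Xh: "(\<lambda>x. X x (h \<circ> fst)) = (\<lambda>q. X1 q h) \<circ> fst"
      using splitsD(5)[OF X True] splitsD(5)[OF Y True] by auto
    have "lie_bracket X Y z (h \<circ> fst) = lie_bracket X1 Y1 (fst z) h"
      unfolding lie_bracket_def Yh Xh
      by (simp only: splitsD(5)[OF X vector_fields_smooth[OF splitsD(2)[OF Y] True]]
          splitsD(5)[OF Y vector_fields_smooth[OF splitsD(2)[OF X] True]])
    then show ?thesis using True by (simp add: pushforward_def)
  next
    case False
    then show ?thesis
      using tangent_spaceD(4)[OF lie_bracket_tangent[OF A1 splitsD(2)[OF X] splitsD(2)[OF Y]]]
      by (simp add: pushforward_def)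
  qed
  then have "pushforward A1 fst (lie_bracket X Y z) = lie_bracket X1 Y1 (fst z)" ..
  then have 1: "H \<alpha> z (lie_bracket X Y z) = \<alpha> (fst z) (lie_bracket X1 Y1 (fst z))"
    unfolding hlift_def pullback_apply[OF t] by simp
  have "(\<lambda>x. H \<alpha> x (Y x)) = (\<lambda>q. \<alpha> q (Y1 q)) \<circ> fst"
    using H_apply[OF Y] by auto
  then have "X z (\<lambda>x. H \<alpha> x (Y x)) = X1 (fst z) (\<lambda>q. \<alpha> q (Y1 q))"
    by (simp only: splitsD(5)[OF X one_forms_smooth[OF \<alpha> splitsD(2)[OF Y]]])
  with 1 show ?thesis by (simp add: lie_derivative_def)
qed

text \<open>The vertical part of [X, Y] is b c [X2, Y2] + X1(c) Y2 - Y1(b) X2, since b and c live on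
  the first factor. Its X1(c) term cancels against the derivative of c in X(c \<beta>(Y2)). The term
  with Y1(b) survives; for the anchor of P, where b = \<mu>, it is the source of d\<mu>.\<close>

lemma lie_derivative_V:
  assumes X: "splits X X1 b X2" and Y: "splits Y Y1 c Y2" and \<beta>: "\<beta> \<in> one_forms A2"
  shows "lie_derivative X (V \<beta>) Y z =
    b (fst z) * c (fst z) * lie_derivative X2 \<beta> Y2 (snd z) + Y1 (fst z) b * \<beta> (snd z) (X2 (snd z))"
proof -
  note t = lie_bracket_tangent[OF AN splitsD(1)[OF X] splitsD(1)[OF Y], of z]
  note tX = vector_fields_tangent[OF splitsD(3)[OF X], of "snd z"]
    and tY = vector_fields_tangent[OF splitsD(3)[OF Y], of "snd z"]
    and tXY = lie_bracket_tangent[OF A2 splitsD(3)[OF X] splitsD(3)[OF Y], of "snd z"]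
  let ?w = "\<lambda>k. b (fst z) * c (fst z) * lie_bracket X2 Y2 (snd z) k
    + (X1 (fst z) c * Y2 (snd z) k + (- Y1 (fst z) b) * X2 (snd z) k)"
  have "pushforward A2 snd (lie_bracket X Y z) k = ?w k" for k
  proof (cases "k \<in> smooth_functions A2")
    case True
    have Yk: "(\<lambda>x. Y x (k \<circ> snd)) = (\<lambda>x. c (fst x) * (\<lambda>q. Y2 q k) (snd x))"
      and Xk: "(\<lambda>x. X x (k \<circ> snd)) = (\<lambda>x. b (fst x) * (\<lambda>q. X2 q k) (snd x))"
      using splitsD(6)[OF X True] splitsD(6)[OF Y True] by auto
    have "lie_bracket X Y z (k \<circ> snd) = ?w k"
      unfolding lie_bracket_def Yk Xk
        splits_mult[OF X splitsD(4)[OF Y] vector_fields_smooth[OF splitsD(3)[OF Y] True]]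
        splits_mult[OF Y splitsD(4)[OF X] vector_fields_smooth[OF splitsD(3)[OF X] True]]
      by (simp add: algebra_simps)
    then show ?thesis using True by (simp add: pushforward_def)
  next
    case False
    then show ?thesis
      by (simp add: pushforward_def tangent_spaceD(4)[OF tX] tangent_spaceD(4)[OF tY] tangent_spaceD(4)[OF tXY])
  qed
  then have push: "pushforward A2 snd (lie_bracket X Y z) = ?w" ..
  note lin = linear_functionalD[OF cotangent_spaceD(1)[OF one_forms_cotangent[OF \<beta>, of "snd z"]]]
  have "V \<beta> z (lie_bracket X Y z) = \<beta> (snd z) ?w"
    unfolding vlift_def pullback_apply[OF t] push ..
  also have "\<dots> = b (fst z) * c (fst z) * \<beta> (snd z) (lie_bracket X2 Y2 (snd z))
      + (X1 (fst z) c * \<beta> (snd z) (Y2 (snd z)) + (- Y1 (fst z) b) * \<beta> (snd z) (X2 (snd z)))"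
    by (simp only: lin tangent_scale tangent_add tX tY tXY)
  finally have 1: "V \<beta> z (lie_bracket X Y z) = b (fst z) * c (fst z) * \<beta> (snd z) (lie_bracket X2 Y2 (snd z))
      + (X1 (fst z) c * \<beta> (snd z) (Y2 (snd z)) + (- Y1 (fst z) b) * \<beta> (snd z) (X2 (snd z)))" .
  have "(\<lambda>x. V \<beta> x (Y x)) = (\<lambda>x. c (fst x) * (\<lambda>q. \<beta> q (Y2 q)) (snd x))"
    using V_apply[OF Y \<beta>] by auto
  then have "X z (\<lambda>x. V \<beta> x (Y x)) = c (fst z) * (b (fst z) * X2 (snd z) (\<lambda>q. \<beta> q (Y2 q)))
      + \<beta> (snd z) (Y2 (snd z)) * X1 (fst z) c"
    by (simp only: splits_mult[OF X splitsD(4)[OF Y] one_forms_smooth[OF \<beta> splitsD(3)[OF Y]]])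
  with 1 show ?thesis by (simp add: lie_derivative_def algebra_simps)
qed

text \<open>Common form of the warped bivector field, with factor \<mu>, and the warped metric, with
  factor f, so that anchors and metric duals of lifts are computed together. Both mixed orders are
  listed because the notion assumes neither symmetry nor skew-symmetry.\<close>

definition warped :: "('a \<Rightarrow> real) \<Rightarrow> 'a cotensor2 \<Rightarrow> 'b cotensor2 \<Rightarrow> ('a \<times> 'b) cotensor2 \<Rightarrow> bool" where
  "warped c B1 B2 B \<longleftrightarrow> c \<in> smooth_functions A1 \<and>
    smooth_cotensor2 A1 B1 \<and> smooth_cotensor2 A2 B2 \<and> smooth_cotensor2 N B \<and>
    (\<forall>\<alpha>\<in>one_forms A1. \<forall>\<beta>\<in>one_forms A1. on_forms B (H \<alpha>) (H \<beta>) = on_forms B1 \<alpha> \<beta> \<circ> fst) \<and>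
    (\<forall>\<alpha>\<in>one_forms A2. \<forall>\<beta>\<in>one_forms A2.
      on_forms B (V \<alpha>) (V \<beta>) = (\<lambda>x. c (fst x) * on_forms B2 \<alpha> \<beta> (snd x))) \<and>
    (\<forall>\<alpha>\<in>one_forms A1. \<forall>\<beta>\<in>one_forms A2.
      on_forms B (H \<alpha>) (V \<beta>) = (\<lambda>x. 0) \<and> on_forms B (V \<beta>) (H \<alpha>) = (\<lambda>x. 0))"

lemma warpedD:
  assumes "warped c B1 B2 B"
  shows "c \<in> smooth_functions A1" "smooth_cotensor2 A1 B1" "smooth_cotensor2 A2 B2" "smooth_cotensor2 N B"
    and "\<alpha> \<in> one_forms A1 \<Longrightarrow> \<beta> \<in> one_forms A1 \<Longrightarrow> on_forms B (H \<alpha>) (H \<beta>) = on_forms B1 \<alpha> \<beta> \<circ> fst"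
    and "\<alpha>' \<in> one_forms A2 \<Longrightarrow> \<beta>' \<in> one_forms A2 \<Longrightarrow>
      on_forms B (V \<alpha>') (V \<beta>') = (\<lambda>x. c (fst x) * on_forms B2 \<alpha>' \<beta>' (snd x))"
    and "\<alpha> \<in> one_forms A1 \<Longrightarrow> \<beta>' \<in> one_forms A2 \<Longrightarrow> on_forms B (H \<alpha>) (V \<beta>') = (\<lambda>x. 0)"
    and "\<alpha> \<in> one_forms A1 \<Longrightarrow> \<beta>' \<in> one_forms A2 \<Longrightarrow> on_forms B (V \<beta>') (H \<alpha>) = (\<lambda>x. 0)"
  using assms unfolding warped_def by blast+

text \<open>The anchor is tested on functions lifted from one factor. Their differentials are lifts
  too, so the prescribed values of B decide.\<close>

lemma splits_anchor_H:
  assumes B: "warped c B1 B2 B" and \<alpha>: "\<alpha> \<in> one_forms A1"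
  shows "splits (anchor N B (H \<alpha>)) (anchor A1 B1 \<alpha>) (\<lambda>x. 0) (\<lambda>p f. 0)"
  unfolding splits_def
proof (intro conjI ballI allI)
  note w = warpedD[OF B] and H\<alpha> = H_one_form[OF \<alpha>]
  show "anchor N B (H \<alpha>) \<in> vector_fields N" by (rule anchor_vector_field[OF AN w(4) H\<alpha>])
  show "anchor A1 B1 \<alpha> \<in> vector_fields A1" by (rule anchor_vector_field[OF A1 w(2) \<alpha>])
  show "anchor N B (H \<alpha>) z (h \<circ> fst) = anchor A1 B1 \<alpha> (fst z) h" if h: "h \<in> smooth_functions A1" for h z
    using fun_cong[OF w(5)[OF \<alpha> differential_one_form[OF h]], of z]
    by (simp add: anchor_apply[OF AN w(4) H\<alpha> smooth_fst[OF h]] anchor_apply[OF A1 w(2) \<alpha> h]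
        on_forms_def H_differential[OF h])
  show "anchor N B (H \<alpha>) z (k \<circ> snd) = 0 * 0" if k: "k \<in> smooth_functions A2" for k z
    using fun_cong[OF w(7)[OF \<alpha> differential_one_form[OF k]], of z]
    by (simp add: anchor_apply[OF AN w(4) H\<alpha> smooth_snd[OF k]] on_forms_def V_differential[OF k])
qed (simp_all add: zero_vector_field)

lemma splits_anchor_V:
  assumes B: "warped c B1 B2 B" and \<alpha>: "\<alpha> \<in> one_forms A2"
  shows "splits (anchor N B (V \<alpha>)) (\<lambda>p f. 0) c (anchor A2 B2 \<alpha>)"
  unfolding splits_def
proof (intro conjI ballI allI)
  note w = warpedD[OF B] and V\<alpha> = V_one_form[OF \<alpha>]
  show "anchor N B (V \<alpha>) \<in> vector_fields N" by (rule anchor_vector_field[OF AN w(4) V\<alpha>])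
  show "anchor A2 B2 \<alpha> \<in> vector_fields A2" by (rule anchor_vector_field[OF A2 w(3) \<alpha>])
  show "anchor N B (V \<alpha>) z (h \<circ> fst) = 0" if h: "h \<in> smooth_functions A1" for h z
    using fun_cong[OF w(8)[OF differential_one_form[OF h] \<alpha>], of z]
    by (simp add: anchor_apply[OF AN w(4) V\<alpha> smooth_fst[OF h]] on_forms_def H_differential[OF h])
  show "anchor N B (V \<alpha>) z (k \<circ> snd) = c (fst z) * anchor A2 B2 \<alpha> (snd z) k"
    if k: "k \<in> smooth_functions A2" for k z
    using fun_cong[OF w(6)[OF \<alpha> differential_one_form[OF k]], of z]
    by (simp add: anchor_apply[OF AN w(4) V\<alpha> smooth_snd[OF k]] anchor_apply[OF A2 w(3) \<alpha> k]
        on_forms_def V_differential[OF k])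
qed (simp_all add: zero_vector_field warpedD(1)[OF B])

section \<open>Koszul brackets of lifts\<close>

lemma koszul_bracket_HH:
  assumes P: "warped \<mu> P1 P2 P" and Y: "splits Y Y1 c Y2" and \<alpha>: "\<alpha> \<in> one_forms A1" and \<beta>: "\<beta> \<in> one_forms A1"
  shows "koszul_bracket N P (H \<alpha>) (H \<beta>) Y z = koszul_bracket A1 P1 \<alpha> \<beta> Y1 (fst z)"
proof -
  have "Y z (on_forms P (H \<alpha>) (H \<beta>)) = Y1 (fst z) (on_forms P1 \<alpha> \<beta>)"
    unfolding warpedD(5)[OF P \<alpha> \<beta>]
    by (rule splitsD(5)[OF Y smooth_cotensor2_smooth[OF warpedD(2)[OF P] \<alpha> \<beta>]])
  then show ?thesis
    unfolding koszul_bracket_def differential_eq[OF vector_fields_tangent[OF splitsD(1)[OF Y]]]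
      differential_eq[OF vector_fields_tangent[OF splitsD(2)[OF Y]]]
      lie_derivative_H[OF splits_anchor_H[OF P \<alpha>] Y \<beta>] lie_derivative_H[OF splits_anchor_H[OF P \<beta>] Y \<alpha>]
    by simp
qed

text \<open>All three terms of the bracket vanish: the anchor of a horizontal lift has vertical part
  0 with constant weight, the anchor of a vertical lift has no horizontal part, and P is 0 on mixed
  lifts. Together with vanishing torsion this explains the symmetry of the connection in mixed
  arguments.\<close>

lemma koszul_bracket_HV:
  assumes P: "warped \<mu> P1 P2 P" and Y: "splits Y Y1 c Y2" and \<alpha>: "\<alpha> \<in> one_forms A1" and \<beta>: "\<beta> \<in> one_forms A2"
  shows "koszul_bracket N P (H \<alpha>) (V \<beta>) Y z = 0" "koszul_bracket N P (V \<beta>) (H \<alpha>) Y z = 0"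
  unfolding koszul_bracket_def differential_eq[OF vector_fields_tangent[OF splitsD(1)[OF Y]]]
    lie_derivative_V[OF splits_anchor_H[OF P \<alpha>] Y \<beta>] lie_derivative_H[OF splits_anchor_V[OF P \<beta>] Y \<alpha>]
    warpedD(7)[OF P \<alpha> \<beta>] warpedD(8)[OF P \<alpha> \<beta>]
    lie_derivative_zero_left[OF splitsD(2)[OF Y] \<alpha>]
    tangent_const[OF vector_fields_tangent[OF splitsD(1)[OF Y]]]
    tangent_const[OF vector_fields_tangent[OF splitsD(2)[OF Y]]]
  by simp_all

text \<open>Y1(\<mu>) P2(\<alpha>, \<beta>) appears three times: once from each Lie derivative,
  where the minus sign of the second is undone by skew-symmetry, and once negatively from the
  differential of \<mu> P2(\<alpha>, \<beta>). One copy is left.\<close>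

lemma koszul_bracket_VV:
  assumes P: "warped \<mu> P1 P2 P" and Y: "splits Y Y1 c Y2" and \<alpha>: "\<alpha> \<in> one_forms A2" and \<beta>: "\<beta> \<in> one_forms A2"
    and skew: "\<And>p. on_forms P2 \<beta> \<alpha> p = - on_forms P2 \<alpha> \<beta> p"
  shows "koszul_bracket N P (V \<alpha>) (V \<beta>) Y z =
    \<mu> (fst z) * c (fst z) * koszul_bracket A2 P2 \<alpha> \<beta> Y2 (snd z) + Y1 (fst z) \<mu> * on_forms P2 \<alpha> \<beta> (snd z)"
  unfolding koszul_bracket_def differential_eq[OF vector_fields_tangent[OF splitsD(1)[OF Y]]]
    differential_eq[OF vector_fields_tangent[OF splitsD(3)[OF Y]]]
    lie_derivative_V[OF splits_anchor_V[OF P \<alpha>] Y \<beta>] lie_derivative_V[OF splits_anchor_V[OF P \<beta>] Y \<alpha>]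
    warpedD(6)[OF P \<alpha> \<beta>] anchor_on_form[OF A2 warpedD(3)[OF P] \<alpha> \<beta>] anchor_on_form[OF A2 warpedD(3)[OF P] \<beta> \<alpha>]
    splits_mult[OF Y warpedD(1)[OF P] smooth_cotensor2_smooth[OF warpedD(3)[OF P] \<alpha> \<beta>]]
    skew
  by (simp add: algebra_simps)

end

subsection \<open>Warped products\<close>

locale warped_product = manifold_product A1 A2
  for A1 :: "('a::{t2_space, second_countable_topology}, 'e::euclidean_space) atlas"
    and A2 :: "('b::{t2_space, second_countable_topology}, 'd::euclidean_space) atlas" +
  fixes h1 :: "'a metric" and h2 :: "'b metric"
    and P1 :: "'a cotensor2" and P2 :: "'b cotensor2"
    and f \<mu> :: "'a \<Rightarrow> real" and g P :: "('a \<times> 'b) cotensor2"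
  assumes h1: "pseudo_riemannian_metric A1 h1" and h2: "pseudo_riemannian_metric A2 h2"
    and P1: "bivector_field A1 P1" and P2: "bivector_field A2 P2"
    and f: "f \<in> smooth_functions A1" and f_pos: "\<And>x. f x > 0" and \<mu>: "\<mu> \<in> smooth_functions A1"
    and P: "warped_bivector A1 A2 \<mu> P1 P2 P"
    and g: "warped_metric A1 A2 f (cometric A1 h1) (cometric A2 h2) g"
begin

abbreviation "g1 \<equiv> cometric A1 h1"
abbreviation "g2 \<equiv> cometric A2 h2"

lemma P_skew:
  "\<alpha> \<in> cotangent_space A1 p \<Longrightarrow> \<beta> \<in> cotangent_space A1 p \<Longrightarrow> P1 p \<alpha> \<beta> = - P1 p \<beta> \<alpha>"
  "\<alpha>' \<in> cotangent_space A2 q \<Longrightarrow> \<beta>' \<in> cotangent_space A2 q \<Longrightarrow> P2 q \<alpha>' \<beta>' = - P2 q \<beta>' \<alpha>'"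
  "\<alpha>'' \<in> cotangent_space N z \<Longrightarrow> \<beta>'' \<in> cotangent_space N z \<Longrightarrow> P z \<alpha>'' \<beta>'' = - P z \<beta>'' \<alpha>''"
  using P1 P2 P unfolding warped_bivector_def bivector_field_def by blast+

lemma P2_skew:
  "\<alpha> \<in> one_forms A2 \<Longrightarrow> \<beta> \<in> one_forms A2 \<Longrightarrow> on_forms P2 \<alpha> \<beta> p = - on_forms P2 \<beta> \<alpha> p"
  unfolding on_forms_def by (intro P_skew(2) one_forms_cotangent)

lemma g_sym:
  "\<alpha> \<in> cotangent_space N z \<Longrightarrow> \<beta> \<in> cotangent_space N z \<Longrightarrow> g z \<alpha> \<beta> = g z \<beta> \<alpha>"
  using g unfolding warped_metric_def contravariant_metric_def by blast

lemma g_nondegenerate: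
  "\<alpha> \<in> cotangent_space N z \<Longrightarrow> (\<And>\<beta>. \<beta> \<in> cotangent_space N z \<Longrightarrow> g z \<alpha> \<beta> = 0) \<Longrightarrow> \<alpha> = (\<lambda>v. 0)"
  using g unfolding warped_metric_def contravariant_metric_def by blast

lemma P_warped: "warped \<mu> P1 P2 P"
proof -
  have "smooth_cotensor2 A1 P1" "smooth_cotensor2 A2 P2" "smooth_cotensor2 N P"
    using P1 P2 P by (auto simp: warped_bivector_def bivector_field_def)
  moreover have HV: "on_forms P (H \<alpha>) (V \<beta>) = (\<lambda>x. 0)" if "\<alpha> \<in> one_forms A1" "\<beta> \<in> one_forms A2" for \<alpha> \<beta>
    using P that by (auto simp: warped_bivector_def)
  moreover have "on_forms P (V \<beta>) (H \<alpha>) = (\<lambda>x. 0)" if ab: "\<alpha> \<in> one_forms A1" "\<beta> \<in> one_forms A2" for \<alpha> \<beta>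
  proof
    fix z
    have "on_forms P (V \<beta>) (H \<alpha>) z = - on_forms P (H \<alpha>) (V \<beta>) z"
      unfolding on_forms_def by (intro P_skew(3) one_forms_cotangent H_one_form V_one_form ab)
    then show "on_forms P (V \<beta>) (H \<alpha>) z = 0" by (simp add: HV[OF ab])
  qed
  ultimately show ?thesis
    using P \<mu> by (simp add: warped_def warped_bivector_def)
qed

text \<open>What needs an argument is smoothness of the cometrics, which are built from pointwise
  duals. The warped metric is smooth on lifts, and its values on a slice of the product are those of
  the cometric up to a constant factor.\<close>

lemma g_warped: "warped f g1 g2 g"
proof -
  have gN: "smooth_cotensor2 N g"
    and HH: "\<And>\<alpha> \<beta>. \<alpha> \<in> one_forms A1 \<Longrightarrow> \<beta> \<in> one_forms A1 \<Longrightarrow> on_forms g (H \<alpha>) (H \<beta>) = on_forms g1 \<alpha> \<beta> \<circ> fst"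
    and VV: "\<And>\<alpha> \<beta>. \<alpha> \<in> one_forms A2 \<Longrightarrow> \<beta> \<in> one_forms A2 \<Longrightarrow>
      on_forms g (V \<alpha>) (V \<beta>) = (\<lambda>x. f (fst x) * on_forms g2 \<alpha> \<beta> (snd x))"
    and HV: "\<And>\<alpha> \<beta>. \<alpha> \<in> one_forms A1 \<Longrightarrow> \<beta> \<in> one_forms A2 \<Longrightarrow> on_forms g (H \<alpha>) (V \<beta>) = (\<lambda>x. 0)"
    using g by (auto simp: warped_metric_def contravariant_metric_def)
  have "smooth_cotensor2 A1 g1"
    unfolding smooth_cotensor2_def
  proof (intro conjI allI ballI)
    show "bilinear_form (cotangent_space A1 p) (g1 p)" for p by (rule cometric_bilinear[OF A1 h1])
    fix \<alpha> \<beta> assume ab: "\<alpha> \<in> one_forms A1" "\<beta> \<in> one_forms A1"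
    have "on_forms g1 \<alpha> \<beta> \<circ> fst \<in> smooth_functions N"
      using smooth_cotensor2_smooth[OF gN H_one_form[OF ab(1)] H_one_form[OF ab(2)]] HH[OF ab] by simp
    then show "on_forms g1 \<alpha> \<beta> \<in> smooth_functions A1"
      using smooth_functions_slice_fst[OF A1 A2, of "on_forms g1 \<alpha> \<beta> \<circ> fst"] by simp
  qed
  moreover have "smooth_cotensor2 A2 g2"
    unfolding smooth_cotensor2_def
  proof (intro conjI allI ballI)
    show "bilinear_form (cotangent_space A2 p) (g2 p)" for p by (rule cometric_bilinear[OF A2 h2])
    fix \<alpha> \<beta> assume ab: "\<alpha> \<in> one_forms A2" "\<beta> \<in> one_forms A2"
    have "(\<lambda>x. f (fst x) * on_forms g2 \<alpha> \<beta> (snd x)) \<in> smooth_functions N"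
      using smooth_cotensor2_smooth[OF gN V_one_form[OF ab(1)] V_one_form[OF ab(2)]] VV[OF ab] by simp
    \<comment> \<open>\<open>undefined\<close> stands for an arbitrary point of the first manifold.
      On the slice over it f is a positive constant, which is then divided out.\<close>
    then have "(\<lambda>y. f undefined * on_forms g2 \<alpha> \<beta> y) \<in> smooth_functions A2"
      using smooth_functions_slice_snd[OF A1 A2, of "\<lambda>x. f (fst x) * on_forms g2 \<alpha> \<beta> (snd x)" undefined]
      by simp
    then have "(\<lambda>y. inverse (f undefined) * (f undefined * on_forms g2 \<alpha> \<beta> y)) \<in> smooth_functions A2"
      by (rule smooth_functions_mult[OF A2 smooth_functions_const])
    then show "on_forms g2 \<alpha> \<beta> \<in> smooth_functions A2"
      using f_pos[of undefined] by (simp add: mult.assoc[symmetric])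
  qed
  moreover have "on_forms g (V \<beta>) (H \<alpha>) = (\<lambda>x. 0)" if ab: "\<alpha> \<in> one_forms A1" "\<beta> \<in> one_forms A2" for \<alpha> \<beta>
  proof
    fix z
    have "on_forms g (V \<beta>) (H \<alpha>) z = on_forms g (H \<alpha>) (V \<beta>) z"
      unfolding on_forms_def by (intro g_sym one_forms_cotangent H_one_form V_one_form ab)
    then show "on_forms g (V \<beta>) (H \<alpha>) z = 0" by (simp add: HV[OF ab])
  qed
  ultimately show ?thesis
    using f gN HH VV HV by (simp add: warped_def)
qed

lemma splits_metric:
  assumes X: "splits X X1 b X2"
  shows "\<alpha> \<in> one_forms A1 \<Longrightarrow> \<beta> \<in> one_forms A1 \<Longrightarrow>
      X z (on_forms g (H \<alpha>) (H \<beta>)) = X1 (fst z) (on_forms g1 \<alpha> \<beta>)"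
    and "\<alpha>' \<in> one_forms A2 \<Longrightarrow> \<beta>' \<in> one_forms A2 \<Longrightarrow> X z (on_forms g (V \<alpha>') (V \<beta>')) =
      f (fst z) * (b (fst z) * X2 (snd z) (on_forms g2 \<alpha>' \<beta>')) + on_forms g2 \<alpha>' \<beta>' (snd z) * X1 (fst z) f"
    and "\<alpha> \<in> one_forms A1 \<Longrightarrow> \<beta>' \<in> one_forms A2 \<Longrightarrow> X z (on_forms g (H \<alpha>) (V \<beta>')) = 0"
    and "\<alpha> \<in> one_forms A1 \<Longrightarrow> \<beta>' \<in> one_forms A2 \<Longrightarrow> X z (on_forms g (V \<beta>') (H \<alpha>)) = 0"
  by (simp_all only: warpedD(5-8)[OF g_warped] splitsD(5)[OF X] splits_mult[OF X f]
      smooth_cotensor2_smooth[OF warpedD(2)[OF g_warped]] smooth_cotensor2_smooth[OF warpedD(3)[OF g_warped]]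
      tangent_const[OF vector_fields_tangent[OF splitsD(1)[OF X]]])

text \<open>The prescribed values of g extend from global forms to fields of covectors such as J_1
  df. At the point z the field is replaced by a differential with the same value, and a lift at z
  depends on nothing else.\<close>

lemma metric_on_covectors:
  assumes \<gamma>: "\<gamma> \<in> one_forms A1" and \<gamma>': "\<gamma>' \<in> one_forms A2"
  shows "\<omega> (fst z) \<in> cotangent_space A1 (fst z) \<Longrightarrow> g z (H \<omega> z) (H \<gamma> z) = g1 (fst z) (\<omega> (fst z)) (\<gamma> (fst z))"
    and "\<omega> (fst z) \<in> cotangent_space A1 (fst z) \<Longrightarrow> g z (H \<omega> z) (V \<gamma>' z) = 0"
    and "\<omega>' (snd z) \<in> cotangent_space A2 (snd z) \<Longrightarrow> g z (V \<omega>' z) (H \<gamma> z) = 0"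
    and "\<omega>' (snd z) \<in> cotangent_space A2 (snd z) \<Longrightarrow>
      g z (V \<omega>' z) (V \<gamma>' z) = f (fst z) * g2 (snd z) (\<omega>' (snd z)) (\<gamma>' (snd z))"
proof -
  note w = warpedD[OF g_warped, unfolded on_forms_def fun_eq_iff o_def, rule_format]
  show "g z (H \<omega> z) (H \<gamma> z) = g1 (fst z) (\<omega> (fst z)) (\<gamma> (fst z))" "g z (H \<omega> z) (V \<gamma>' z) = 0"
    if \<omega>: "\<omega> (fst z) \<in> cotangent_space A1 (fst z)"
  proof -
    obtain h where h: "h \<in> smooth_functions A1" "\<omega> (fst z) = differential A1 h (fst z)"
      by (rule cotangent_eq_differential[OF A1 \<omega>])
    show "g z (H \<omega> z) (H \<gamma> z) = g1 (fst z) (\<omega> (fst z)) (\<gamma> (fst z))" "g z (H \<omega> z) (V \<gamma>' z) = 0"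
      using w(5)[OF differential_one_form[OF h(1)] \<gamma>] w(7)[OF differential_one_form[OF h(1)] \<gamma>']
      by (simp_all add: H_cong[of \<omega> z "differential A1 h", OF h(2)] h(2))
  qed
  show "g z (V \<omega>' z) (H \<gamma> z) = 0"
    "g z (V \<omega>' z) (V \<gamma>' z) = f (fst z) * g2 (snd z) (\<omega>' (snd z)) (\<gamma>' (snd z))"
    if \<omega>: "\<omega>' (snd z) \<in> cotangent_space A2 (snd z)"
  proof -
    obtain h where h: "h \<in> smooth_functions A2" "\<omega>' (snd z) = differential A2 h (snd z)"
      by (rule cotangent_eq_differential[OF A2 \<omega>])
    show "g z (V \<omega>' z) (H \<gamma> z) = 0"
      "g z (V \<omega>' z) (V \<gamma>' z) = f (fst z) * g2 (snd z) (\<omega>' (snd z)) (\<gamma>' (snd z))"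
      using w(8)[OF \<gamma> differential_one_form[OF h(1)]] w(6)[OF differential_one_form[OF h(1)] \<gamma>']
      by (simp_all add: V_cong[of \<omega>' z "differential A2 h", OF h(2)] h(2))
  qed
qed

lemma g_linear:
  assumes "\<gamma> \<in> cotangent_space N z"
  shows "\<alpha> \<in> cotangent_space N z \<Longrightarrow> \<beta> \<in> cotangent_space N z \<Longrightarrow>
      g z (\<lambda>v. \<alpha> v + \<beta> v) \<gamma> = g z \<alpha> \<gamma> + g z \<beta> \<gamma>"
    and "\<alpha> \<in> cotangent_space N z \<Longrightarrow> g z (\<lambda>v. c * \<alpha> v) \<gamma> = c * g z \<alpha> \<gamma>"
  using linear_functionalD[OF bilinear_formD(2)[OF smooth_cotensor2_bilinear[OF warpedD(4)[OF g_warped]] assms]]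
  by blast+

lemma covector_eqI:
  assumes \<omega>: "\<omega> \<in> cotangent_space N z" and \<eta>: "\<eta> \<in> cotangent_space N z"
    and eqH: "\<And>\<gamma>. \<gamma> \<in> one_forms A1 \<Longrightarrow> g z \<omega> (H \<gamma> z) = g z \<eta> (H \<gamma> z)"
    and eqV: "\<And>\<gamma>. \<gamma> \<in> one_forms A2 \<Longrightarrow> g z \<omega> (V \<gamma> z) = g z \<eta> (V \<gamma> z)"
  shows "\<omega> = \<eta>"
proof -
  have m: "(\<lambda>v. - 1 * \<eta> v) \<in> cotangent_space N z" by (rule cotangent_scale[OF \<eta>])
  have "(\<lambda>v. \<omega> v + - 1 * \<eta> v) = (\<lambda>v. 0)"
  proof (rule g_nondegenerate[OF cotangent_add[OF \<omega> m]])
    fix \<beta> assume \<beta>: "\<beta> \<in> cotangent_space N z"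
    obtain \<gamma> \<gamma>' where gam: "\<gamma> \<in> one_forms A1" "\<gamma>' \<in> one_forms A2" "\<beta> = (\<lambda>v. H \<gamma> z v + V \<gamma>' z v)"
      by (rule cotangent_split[OF \<beta>])
    note c = one_forms_cotangent[OF H_one_form[OF gam(1)], of z] one_forms_cotangent[OF V_one_form[OF gam(2)], of z]
    have split: "g z \<alpha> \<beta> = g z \<alpha> (H \<gamma> z) + g z \<alpha> (V \<gamma>' z)" if "\<alpha> \<in> cotangent_space N z" for \<alpha>
      unfolding gam(3)
      by (rule linear_functionalD(1)[OF bilinear_formD(1)[OF smooth_cotensor2_bilinear[OF warpedD(4)[OF g_warped]] that] c])
    show "g z (\<lambda>v. \<omega> v + - 1 * \<eta> v) \<beta> = 0"
      unfolding g_linear(1)[OF \<beta> \<omega> m] g_linear(2)[OF \<beta> \<eta>] split[OF \<omega>] split[OF \<eta>]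
      by (simp add: eqH[OF gam(1)] eqV[OF gam(2)])
  qed
  then show ?thesis by (simp add: fun_eq_iff)
qed

section \<open>Terms of the Koszul formula on lifts\<close>

lemmas anchor_metric =
  splits_metric[OF splits_anchor_H[OF P_warped]] splits_metric[OF splits_anchor_V[OF P_warped]]

lemmas koszul_H =
  koszul_bracket_HH[OF P_warped splits_anchor_H[OF g_warped]]
  koszul_bracket_HV[OF P_warped splits_anchor_H[OF g_warped]]
  koszul_bracket_VV[OF P_warped splits_anchor_H[OF g_warped] _ _ P2_skew]

lemmas koszul_V =
  koszul_bracket_HH[OF P_warped splits_anchor_V[OF g_warped]]
  koszul_bracket_HV[OF P_warped splits_anchor_V[OF g_warped]]
  koszul_bracket_VV[OF P_warped splits_anchor_V[OF g_warped] _ _ P2_skew]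

text \<open>The only derivatives of the warping functions that occur: f sits in the metric and is
  differentiated by anchors of P, \<mu> sits in the bracket and is differentiated by metric duals.
  The order of the arguments in P1 is turned to fit the definition of J_1.\<close>

lemma anchor_df:
  assumes "\<gamma> \<in> one_forms A1"
  shows "anchor A1 P1 \<gamma> p f = - P1 p (differential A1 f p) (\<gamma> p)"
    and "anchor A1 g1 \<gamma> p \<mu> = g1 p (differential A1 \<mu> p) (\<gamma> p)"
  using anchor_apply[OF A1 warpedD(2)[OF P_warped] assms f] anchor_apply[OF A1 warpedD(2)[OF g_warped] assms \<mu>]
    P_skew(1)[OF one_forms_cotangent[OF assms] differential_cotangent[OF f]]
    cometric_eq(2)[OF A1 h1 one_forms_cotangent[OF assms] differential_cotangent[OF \<mu>]]
  by simp_all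

context
  fixes D D1 D2
  assumes D: "levi_civita N g P D" and D1: "levi_civita A1 g1 P1 D1" and D2: "levi_civita A2 g2 P2 D2"
begin

lemma D_one_form: "\<alpha> \<in> one_forms N \<Longrightarrow> \<beta> \<in> one_forms N \<Longrightarrow> D \<alpha> \<beta> \<in> one_forms N"
  using D unfolding levi_civita_def contravariant_connection_def by blast

lemma D1_one_form: "\<alpha> \<in> one_forms A1 \<Longrightarrow> \<beta> \<in> one_forms A1 \<Longrightarrow> D1 \<alpha> \<beta> \<in> one_forms A1"
  using D1 unfolding levi_civita_def contravariant_connection_def by blast

lemma D2_one_form: "\<alpha> \<in> one_forms A2 \<Longrightarrow> \<beta> \<in> one_forms A2 \<Longrightarrow> D2 \<alpha> \<beta> \<in> one_forms A2"
  using D2 unfolding levi_civita_def contravariant_connection_def by blast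

lemmas koszul_N = koszul_formula[OF AN warpedD(4)[OF g_warped] g_sym D]
lemmas koszul_1 = koszul_formula[OF A1 warpedD(2)[OF g_warped] cometric_eq(2)[OF A1 h1] D1]
lemmas koszul_2 = koszul_formula[OF A2 warpedD(3)[OF g_warped] cometric_eq(2)[OF A2 h2] D2]

text \<open>The factor 2 is kept on both sides because the Koszul formulas, on the product and on
  the first factor, rewrite expressions of exactly this shape. For a horizontal test form the six
  terms are those of the first factor.\<close>

lemma D_HH:
  assumes "\<alpha> \<in> one_forms A1" "\<beta> \<in> one_forms A1"
  shows "\<gamma> \<in> one_forms A1 \<Longrightarrow> 2 * on_forms g (D (H \<alpha>) (H \<beta>)) (H \<gamma>) z = 2 * on_forms g1 (D1 \<alpha> \<beta>) \<gamma> (fst z)"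
    and "\<gamma>' \<in> one_forms A2 \<Longrightarrow> 2 * on_forms g (D (H \<alpha>) (H \<beta>)) (V \<gamma>') z = 0"
  using assms
  by (simp_all add: koszul_N koszul_1 H_one_form V_one_form anchor_metric koszul_H koszul_V
      koszul_bracket_zero[OF A1 warpedD(2)[OF P_warped]])

text \<open>With a horizontal test form two terms survive: the anchor of \<gamma> acting on f, and
  the \<mu>-derivative in the bracket of \<alpha> and \<beta>. With a vertical one nothing
  differentiates f or \<mu>; every term carries \<mu> from an anchor of P and f from the metric or a
  metric dual.\<close>

lemma D_VV:
  assumes "\<alpha> \<in> one_forms A2" "\<beta> \<in> one_forms A2"
  shows "\<gamma> \<in> one_forms A1 \<Longrightarrow> 2 * on_forms g (D (V \<alpha>) (V \<beta>)) (H \<gamma>) z =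
      on_forms g2 \<alpha> \<beta> (snd z) * P1 (fst z) (differential A1 f (fst z)) (\<gamma> (fst z)) +
      on_forms P2 \<alpha> \<beta> (snd z) * g1 (fst z) (differential A1 \<mu> (fst z)) (\<gamma> (fst z))"
    and "\<gamma>' \<in> one_forms A2 \<Longrightarrow> 2 * on_forms g (D (V \<alpha>) (V \<beta>)) (V \<gamma>') z =
      \<mu> (fst z) * f (fst z) * (2 * on_forms g2 (D2 \<alpha> \<beta>) \<gamma>' (snd z))"
  using assms
  by (simp_all add: koszul_N koszul_2 H_one_form V_one_form anchor_metric koszul_H koszul_V anchor_df
      algebra_simps)

text \<open>With a vertical test form only two of the six terms survive: the anchor of \<alpha>
  acting on f, and the bracket of \<gamma>' and \<beta> at the dual of \<alpha>. The order of
  \<gamma>' and \<beta> in that bracket gives the second minus sign.\<close>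

lemma D_HV:
  assumes "\<alpha> \<in> one_forms A1" "\<beta> \<in> one_forms A2"
  shows "\<gamma> \<in> one_forms A1 \<Longrightarrow> 2 * on_forms g (D (H \<alpha>) (V \<beta>)) (H \<gamma>) z = 0"
    and "\<gamma>' \<in> one_forms A2 \<Longrightarrow> 2 * on_forms g (D (H \<alpha>) (V \<beta>)) (V \<gamma>') z =
      - (on_forms g2 \<beta> \<gamma>' (snd z) * P1 (fst z) (differential A1 f (fst z)) (\<alpha> (fst z)) +
         on_forms P2 \<beta> \<gamma>' (snd z) * g1 (fst z) (differential A1 \<mu> (fst z)) (\<alpha> (fst z)))"
    and "\<gamma> \<in> one_forms A1 \<Longrightarrow> 2 * on_forms g (D (V \<beta>) (H \<alpha>)) (H \<gamma>) z = 0"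
    and "\<gamma>' \<in> one_forms A2 \<Longrightarrow> 2 * on_forms g (D (V \<beta>) (H \<alpha>)) (V \<gamma>') z =
      - (on_forms g2 \<beta> \<gamma>' (snd z) * P1 (fst z) (differential A1 f (fst z)) (\<alpha> (fst z)) +
         on_forms P2 \<beta> \<gamma>' (snd z) * g1 (fst z) (differential A1 \<mu> (fst z)) (\<alpha> (fst z)))"
  using assms P2_skew[of \<gamma>' \<beta> "snd z"]
  by (simp_all add: koszul_N H_one_form V_one_form anchor_metric koszul_H koszul_V anchor_df
      koszul_bracket_zero[OF A1 warpedD(2)[OF P_warped]] algebra_simps)

section \<open>The four formulas, from the metric coefficients of the connection\<close>

lemma connection_HH:
  assumes \<alpha>: "\<alpha> \<in> one_forms A1" and \<beta>: "\<beta> \<in> one_forms A1"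
  shows "D (H \<alpha>) (H \<beta>) = H (D1 \<alpha> \<beta>)"
proof
  fix z :: "'a \<times> 'b"
  note d = D1_one_form[OF \<alpha> \<beta>]
  show "D (H \<alpha>) (H \<beta>) z = H (D1 \<alpha> \<beta>) z"
  proof (rule covector_eqI)
    fix \<gamma> assume "\<gamma> \<in> one_forms A1"
    then show "g z (D (H \<alpha>) (H \<beta>) z) (H \<gamma> z) = g z (H (D1 \<alpha> \<beta>) z) (H \<gamma> z)"
      using D_HH(1)[OF \<alpha> \<beta>, of \<gamma> z] fun_cong[OF warpedD(5)[OF g_warped d, of \<gamma>], of z] by (simp add: on_forms_def)
  next
    fix \<gamma> assume "\<gamma> \<in> one_forms A2"
    then show "g z (D (H \<alpha>) (H \<beta>) z) (V \<gamma> z) = g z (H (D1 \<alpha> \<beta>) z) (V \<gamma> z)"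
      using D_HH(2)[OF \<alpha> \<beta>, of \<gamma> z] fun_cong[OF warpedD(7)[OF g_warped d, of \<gamma>], of z] by (simp add: on_forms_def)
  qed (intro one_forms_cotangent D_one_form H_one_form \<alpha> \<beta> d)+
qed

lemma connection_VH:
  assumes \<alpha>: "\<alpha> \<in> one_forms A1" and \<beta>: "\<beta> \<in> one_forms A2"
  shows "D (V \<beta>) (H \<alpha>) = D (H \<alpha>) (V \<beta>)"
proof
  fix z :: "'a \<times> 'b"
  show "D (V \<beta>) (H \<alpha>) z = D (H \<alpha>) (V \<beta>) z"
  proof (rule covector_eqI)
    fix \<gamma> assume "\<gamma> \<in> one_forms A1"
    then show "g z (D (V \<beta>) (H \<alpha>) z) (H \<gamma> z) = g z (D (H \<alpha>) (V \<beta>) z) (H \<gamma> z)"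
      using D_HV(1,3)[OF \<alpha> \<beta>, of \<gamma> z] by (simp add: on_forms_def)
  next
    fix \<gamma> assume "\<gamma> \<in> one_forms A2"
    then show "g z (D (V \<beta>) (H \<alpha>) z) (V \<gamma> z) = g z (D (H \<alpha>) (V \<beta>) z) (V \<gamma> z)"
      using D_HV(2,4)[OF \<alpha> \<beta>, of \<gamma> z] by (simp add: on_forms_def)
  qed (intro one_forms_cotangent D_one_form H_one_form V_one_form \<alpha> \<beta>)+
qed

abbreviation "J1df \<equiv> J_field A1 g1 P1 (differential A1 f)"

lemma J1df:
  shows "J1df p \<in> cotangent_space A1 p"
    and "\<gamma> \<in> one_forms A1 \<Longrightarrow> g1 p (J1df p) (\<gamma> p) = P1 p (differential A1 f p) (\<gamma> p)"
proof -
  note J = J_field_properties[where P = P1 and \<alpha> = "differential A1 f" and p = p, OF A1 h1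
      smooth_cotensor2_bilinear[OF warpedD(2)[OF P_warped]] differential_cotangent[OF f]]
  show "J1df p \<in> cotangent_space A1 p" by (rule J(1))
  show "g1 p (J1df p) (\<gamma> p) = P1 p (differential A1 f p) (\<gamma> p)" if "\<gamma> \<in> one_forms A1"
    by (rule J(2)[OF one_forms_cotangent[OF that]])
qed

lemma J2:
  assumes "\<beta> \<in> one_forms A2"
  shows "J_field A2 g2 P2 \<beta> p \<in> cotangent_space A2 p"
    and "\<gamma> \<in> one_forms A2 \<Longrightarrow> g2 p (J_field A2 g2 P2 \<beta> p) (\<gamma> p) = P2 p (\<beta> p) (\<gamma> p)"
proof -
  note J = J_field_properties[where P = P2 and \<alpha> = \<beta> and p = p, OF A2 h2
      smooth_cotensor2_bilinear[OF warpedD(3)[OF P_warped]] one_forms_cotangent[OF assms]]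
  show "J_field A2 g2 P2 \<beta> p \<in> cotangent_space A2 p" by (rule J(1))
  show "g2 p (J_field A2 g2 P2 \<beta> p) (\<gamma> p) = P2 p (\<beta> p) (\<gamma> p)" if "\<gamma> \<in> one_forms A2"
    by (rule J(2)[OF one_forms_cotangent[OF that]])
qed

text \<open>The d\<mu> and J_1 df terms are found by horizontal test forms, where the Koszul formula
  leaves its factor 1/2. The first term is found by vertical ones, where f occurs on both
  sides.\<close>

lemma connection_VV:
  assumes \<alpha>: "\<alpha> \<in> one_forms A2" and \<beta>: "\<beta> \<in> one_forms A2"
  shows "D (V \<alpha>) (V \<beta>) = (\<mu> \<circ> fst) *\<^sub>F V (D2 \<alpha> \<beta>)
    +\<^sub>F (\<lambda>x. 1/2 * (on_forms P2 \<alpha> \<beta> \<circ> snd) x) *\<^sub>F H (differential A1 \<mu>)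
    +\<^sub>F (\<lambda>x. 1/2 * (on_forms g2 \<alpha> \<beta> \<circ> snd) x) *\<^sub>F H J1df"
    (is "_ = ?R")
proof
  fix z :: "'a \<times> 'b"
  note d = D2_one_form[OF \<alpha> \<beta>]
  let ?a = "\<mu> (fst z)" and ?b = "1/2 * on_forms P2 \<alpha> \<beta> (snd z)" and ?c = "1/2 * on_forms g2 \<alpha> \<beta> (snd z)"
  have cot: "V (D2 \<alpha> \<beta>) z \<in> cotangent_space N z" "H (differential A1 \<mu>) z \<in> cotangent_space N z"
    "H J1df z \<in> cotangent_space N z"
    by (intro V_cotangent H_cotangent one_forms_cotangent d J1df differential_cotangent \<mu>)+
  have R: "?R z = (\<lambda>v. (?a * V (D2 \<alpha> \<beta>) z v + ?b * H (differential A1 \<mu>) z v) + ?c * H J1df z v)"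
    by (simp add: form_add_def form_scale_def)
  have expand: "g z (?R z) \<omega> = ?a * g z (V (D2 \<alpha> \<beta>) z) \<omega> + ?b * g z (H (differential A1 \<mu>) z) \<omega>
      + ?c * g z (H J1df z) \<omega>" if \<omega>: "\<omega> \<in> cotangent_space N z" for \<omega>
    unfolding R by (simp only: g_linear[OF \<omega>] cotangent_add cotangent_scale cot)
  show "D (V \<alpha>) (V \<beta>) z = ?R z"
  proof (rule covector_eqI)
    show "?R z \<in> cotangent_space N z" unfolding R by (intro cotangent_add cotangent_scale cot)
    show "D (V \<alpha>) (V \<beta>) z \<in> cotangent_space N z"
      by (intro one_forms_cotangent D_one_form V_one_form \<alpha> \<beta>)
  next
    fix \<gamma> assume \<gamma>: "\<gamma> \<in> one_forms A1"
    note m = metric_on_covectors[OF \<gamma> \<alpha>]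
    show "g z (D (V \<alpha>) (V \<beta>) z) (H \<gamma> z) = g z (?R z) (H \<gamma> z)"
      unfolding expand[OF one_forms_cotangent[OF H_one_form[OF \<gamma>]]]
        m(1)[where \<omega> = "differential A1 \<mu>", OF differential_cotangent[OF \<mu>]]
        m(1)[where \<omega> = J1df, OF J1df(1)] m(3)[where \<omega>' = "D2 \<alpha> \<beta>", OF one_forms_cotangent[OF d]]
        J1df(2)[OF \<gamma>]
      using D_VV(1)[OF \<alpha> \<beta> \<gamma>, of z] by (simp add: on_forms_def[of g])
  next
    fix \<gamma> assume \<gamma>: "\<gamma> \<in> one_forms A2"
    note m = metric_on_covectors[OF differential_one_form[OF \<mu>] \<gamma>]
    show "g z (D (V \<alpha>) (V \<beta>) z) (V \<gamma> z) = g z (?R z) (V \<gamma> z)"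
      unfolding expand[OF one_forms_cotangent[OF V_one_form[OF \<gamma>]]]
        m(2)[where \<omega> = "differential A1 \<mu>", OF differential_cotangent[OF \<mu>]]
        m(2)[where \<omega> = J1df, OF J1df(1)] m(4)[where \<omega>' = "D2 \<alpha> \<beta>", OF one_forms_cotangent[OF d]]
      using D_VV(2)[OF \<alpha> \<beta> \<gamma>, of z] by (simp add: on_forms_def)
  qed
qed

text \<open>Products of vertical covectors carry the factor f, whereas the right-hand side of
  \<open>D_HV\<close> has none; this puts f into the denominator. \<open>J1df\<close> and the J
  field of \<beta> then turn the values of P1 and P2 into metric products.\<close>

lemma connection_HV:
  assumes \<alpha>: "\<alpha> \<in> one_forms A1" and \<beta>: "\<beta> \<in> one_forms A2"
  shows "D (H \<alpha>) (V \<beta>) = (\<lambda>x. - (1 / (2 * (f \<circ> fst) x))) *\<^sub>F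
    ((on_forms g1 J1df \<alpha> \<circ> fst) *\<^sub>F V \<beta>
     +\<^sub>F (on_forms g1 (differential A1 \<mu>) \<alpha> \<circ> fst) *\<^sub>F V (J_field A2 g2 P2 \<beta>))"
    (is "_ = ?R")
proof
  fix z :: "'a \<times> 'b"
  let ?a = "- (1 / (2 * f (fst z)))" and ?b = "on_forms g1 J1df \<alpha> (fst z)"
    and ?c = "on_forms g1 (differential A1 \<mu>) \<alpha> (fst z)" and ?J = "J_field A2 g2 P2 \<beta>"
  have cot: "V \<beta> z \<in> cotangent_space N z" "V ?J z \<in> cotangent_space N z"
    by (intro V_cotangent one_forms_cotangent \<beta> J2)+
  have R: "?R z = (\<lambda>v. ?a * (?b * V \<beta> z v + ?c * V ?J z v))"
    by (simp add: form_add_def form_scale_def)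
  have expand: "g z (?R z) \<omega> = ?a * (?b * g z (V \<beta> z) \<omega> + ?c * g z (V ?J z) \<omega>)"
    if \<omega>: "\<omega> \<in> cotangent_space N z" for \<omega>
    unfolding R by (simp only: g_linear[OF \<omega>] cotangent_add cotangent_scale cot)
  show "D (H \<alpha>) (V \<beta>) z = ?R z"
  proof (rule covector_eqI)
    show "?R z \<in> cotangent_space N z" unfolding R by (intro cotangent_add cotangent_scale cot)
    show "D (H \<alpha>) (V \<beta>) z \<in> cotangent_space N z"
      by (intro one_forms_cotangent D_one_form H_one_form V_one_form \<alpha> \<beta>)
  next
    fix \<gamma> assume \<gamma>: "\<gamma> \<in> one_forms A1"
    note m = metric_on_covectors[OF \<gamma> \<beta>]
    show "g z (D (H \<alpha>) (V \<beta>) z) (H \<gamma> z) = g z (?R z) (H \<gamma> z)"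
      unfolding expand[OF one_forms_cotangent[OF H_one_form[OF \<gamma>]]]
        m(3)[where \<omega>' = \<beta>, OF one_forms_cotangent[OF \<beta>]] m(3)[where \<omega>' = ?J, OF J2(1)[OF \<beta>]]
      using D_HV(1)[OF \<alpha> \<beta> \<gamma>, of z] by (simp add: on_forms_def)
  next
    fix \<gamma> assume \<gamma>: "\<gamma> \<in> one_forms A2"
    note m = metric_on_covectors[OF \<alpha> \<gamma>]
    have "f (fst z) \<noteq> 0" using f_pos[of "fst z"] by simp
    \<comment> \<open>Stated for arbitrary reals so that \<open>cancel\<close> can be used as a
      rewrite rule whatever the metric values are.\<close>
    moreover have "- (1 / (2 * r)) * (b * (r * x) + c * (r * y)) = - (x * b + y * c) / 2"
      if "r \<noteq> 0" for r b c x y :: real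
      using that by (simp add: field_simps)
    ultimately have cancel: "- (1 / (2 * f (fst z))) * (b * (f (fst z) * x) + c * (f (fst z) * y)) = - (x * b + y * c) / 2"
      for b c x y :: real by blast
    show "g z (D (H \<alpha>) (V \<beta>) z) (V \<gamma> z) = g z (?R z) (V \<gamma> z)"
      unfolding expand[OF one_forms_cotangent[OF V_one_form[OF \<gamma>]]]
        m(4)[where \<omega>' = \<beta>, OF one_forms_cotangent[OF \<beta>]] m(4)[where \<omega>' = ?J, OF J2(1)[OF \<beta>]]
        J2(2)[OF \<beta> \<gamma>] cancel
      using D_HV(2)[OF \<alpha> \<beta> \<gamma>, of z] J1df(2)[OF \<alpha>] by (simp add: on_forms_def)
  qed
qed

end

end


theorem proposition8:
  fixes A1 :: "('a::{t2_space, second_countable_topology}, 'e::euclidean_space) atlas"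
    and A2 :: "('b::{t2_space, second_countable_topology}, 'd::euclidean_space) atlas"
    and h1 :: "'a metric" and h2 :: "'b metric"
    and g1 P1 :: "'a cotensor2" and g2 P2 :: "'b cotensor2"
    and f \<mu> :: "'a \<Rightarrow> real"
    and g\<^sub>f P\<^sub>\<mu> :: "('a \<times> 'b) cotensor2"
    and D :: "('a \<times> 'b) form \<Rightarrow> ('a \<times> 'b) form \<Rightarrow> ('a \<times> 'b) form"
    and D1 :: "'a form \<Rightarrow> 'a form \<Rightarrow> 'a form"
    and D2 :: "'b form \<Rightarrow> 'b form \<Rightarrow> 'b form"
    and \<alpha>1 \<beta>1 :: "'a form" and \<alpha>2 \<beta>2 :: "'b form"
  assumes "smooth_atlas A1" and "smooth_atlas A2"
    and "pseudo_riemannian_metric A1 h1" and "pseudo_riemannian_metric A2 h2"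
    and "g1 = cometric A1 h1" and "g2 = cometric A2 h2"
    and "bivector_field A1 P1" and "bivector_field A2 P2"
    and "f \<in> smooth_functions A1" and "\<And>x. f x > 0"
    and "\<mu> \<in> smooth_functions A1"
    and "warped_bivector A1 A2 \<mu> P1 P2 P\<^sub>\<mu>"
    and "warped_metric A1 A2 f g1 g2 g\<^sub>f"
    and "levi_civita (prod_atlas A1 A2) g\<^sub>f P\<^sub>\<mu> D"
    and "levi_civita A1 g1 P1 D1" and "levi_civita A2 g2 P2 D2"
    and "\<alpha>1 \<in> one_forms A1" and "\<beta>1 \<in> one_forms A1"
    and "\<alpha>2 \<in> one_forms A2" and "\<beta>2 \<in> one_forms A2"
  shows "(D (hlift A1 A2 \<alpha>1) (hlift A1 A2 \<beta>1) = hlift A1 A2 (D1 \<alpha>1 \<beta>1))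
       \<and> (D (vlift A1 A2 \<alpha>2) (vlift A1 A2 \<beta>2) =
           (\<mu> \<circ> fst) *\<^sub>F vlift A1 A2 (D2 \<alpha>2 \<beta>2)
           +\<^sub>F (\<lambda>x. 1/2 * (on_forms P2 \<alpha>2 \<beta>2 \<circ> snd) x) *\<^sub>F hlift A1 A2 (differential A1 \<mu>)
           +\<^sub>F (\<lambda>x. 1/2 * (on_forms g2 \<alpha>2 \<beta>2 \<circ> snd) x) *\<^sub>F
                hlift A1 A2 (J_field A1 g1 P1 (differential A1 f)))
       \<and> (D (hlift A1 A2 \<alpha>1) (vlift A1 A2 \<beta>2) =
           (\<lambda>x. - (1 / (2 * (f \<circ> fst) x))) *\<^sub>F
             ((on_forms g1 (J_field A1 g1 P1 (differential A1 f)) \<alpha>1 \<circ> fst) *\<^sub>F vlift A1 A2 \<beta>2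
              +\<^sub>F (on_forms g1 (differential A1 \<mu>) \<alpha>1 \<circ> fst) *\<^sub>F
                   vlift A1 A2 (J_field A2 g2 P2 \<beta>2)))
       \<and> (D (vlift A1 A2 \<beta>2) (hlift A1 A2 \<alpha>1) = D (hlift A1 A2 \<alpha>1) (vlift A1 A2 \<beta>2))"
proof -
  interpret warped_product A1 A2 h1 h2 P1 P2 f \<mu> g\<^sub>f P\<^sub>\<mu>
    using assms by unfold_locales auto
  show ?thesis
    \<comment> \<open>The locale works with the cometrics directly, the theorem names them by
      equations; these are unfolded to match.\<close>
    using connection_HH connection_VV connection_HV connection_VH assms(14-) unfolding assms(5,6) by blast
qed

end
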